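(* Fix real numbers $0<\varepsilon<1$ and $T>0$. For each positive integer $n$ let $\alpha_n$ be a real number and $\xi_n$ an integer-valued random variable, such that for all sufficiently large $n$: $\xi_n$ is $\alpha_n$-balanced, $\alpha_n\ge n^{-1+\varepsilon}$, and $|\xi_n|\le n^T$. For $n\geq 1$, $u\ge 0$ let $M_{n\times(n+u)}$ be the random $n\times(n+u)$ integer matrix whose entries are i.i.d. copies of $\xi_n$. Then $$\lim_{\min(u,n)\to\infty}\mathbf P\big(\mathrm{Cok}(M_{n\times(n+u)})\text{ is the trivial group}\big)=1,$$ i.e. for every $\delta>0$ there is $N$ such that for all $n,u\ge N$ this probability is at least $1-\delta$.
   Context: A random integer $\xi$ is called $\alpha$-balanced if for every prime $p$, $\max_{r\in\mathbf Z/p\mathbf Z}\mathbf P(\xi\equiv r \bmod p)\le 1-\alpha$. For an integer matrix $M$ of size $n\times m$, viewed as a linear map $\mathbf Z^m\to\mathbf Z^n$, the cokernel is $\mathrm{Cok}(M)=\mathbf Z^n/M(\mathbf Z^m)$. *)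

theory Defs
  imports
    "HOL-Probability.Probability"
    "HOL-Number_Theory.Number_Theory"
    "HOL-Algebra.Elementary_Groups"
    "Jordan_Normal_Form.Matrix"
begin

text \<open>A random integer is represented by its distribution, an \<open>int pmf\<close>.\<close>

definition balanced :: "real \<Rightarrow> int pmf \<Rightarrow> bool" where
  "balanced \<alpha> \<xi> \<longleftrightarrow> (\<forall>p::nat. prime p \<longrightarrow>
     (MAX r\<in>{0..<int p}. measure_pmf.prob \<xi> {x. [x = r] (mod int p)}) \<le> 1 - \<alpha>)"

definition cokernel :: "int mat \<Rightarrow> int vec set monoid" where
  "cokernel M =
     monoid_vec TYPE(int) (dim_row M) Mod ((\<lambda>v. M *\<^sub>v v) ` carrier_vec (dim_col M))"

text \<open>The law of an \<open>n \<times> m\<close> matrix with independent entries of law \<open>\<xi>\<close>; the default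
  value 0 given to \<^const>\<open>Pi_pmf\<close> is only used outside the index set and is discarded by
  \<^const>\<open>mat\<close>.\<close>

definition iid_mat :: "nat \<Rightarrow> nat \<Rightarrow> int pmf \<Rightarrow> int mat pmf" where
  "iid_mat n m \<xi> = map_pmf (mat n m) (Pi_pmf ({..<n} \<times> {..<m}) 0 (\<lambda>_. \<xi>))"

text \<open>The limit along \<open>min(u,n) \<rightarrow> \<infinity>\<close>, unfolded for probabilities.\<close>

lemma tendsto_1_min_at_top_iff:
  fixes f :: "nat \<Rightarrow> nat \<Rightarrow> real"
  assumes "\<And>n u. f n u \<le> 1"
  shows "((\<lambda>(n, u). f n u) \<longlongrightarrow> 1) (filtercomap (\<lambda>(n, u). min u n) at_top) \<longleftrightarrow>
    (\<forall>\<delta>>0. \<exists>N. \<forall>n\<ge>N. \<forall>u\<ge>N. f n u \<ge> 1 - \<delta>)" (is "?L \<longleftrightarrow> ?R")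
proof -
  have "?L \<longleftrightarrow> (\<forall>\<delta>>0. \<exists>N. \<forall>n\<ge>N. \<forall>u\<ge>N. \<bar>f n u - 1\<bar> < \<delta>)"
    by (simp add: tendsto_iff eventually_filtercomap_at_top_linorder dist_real_def split_beta)
       (smt (verit, best) fst_conv snd_conv)
  also have "\<dots> \<longleftrightarrow> (\<forall>\<delta>>0. \<exists>N. \<forall>n\<ge>N. \<forall>u\<ge>N. f n u > 1 - \<delta>)"
    using assms by (smt (verit, best))
  also have "\<dots> \<longleftrightarrow> ?R"
  proof (intro iffI allI impI)
    fix \<delta> :: real
    assume R: ?R and "\<delta> > 0"
    then obtain N where N: "\<forall>n\<ge>N. \<forall>u\<ge>N. f n u \<ge> 1 - \<delta> / 2"
      using half_gt_zero by blast
    have "f n u > 1 - \<delta>" if "n \<ge> N" "u \<ge> N" for n u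
      using N that \<open>\<delta> > 0\<close> by (smt (verit) field_sum_of_halves)
    then show "\<exists>N. \<forall>n\<ge>N. \<forall>u\<ge>N. f n u > 1 - \<delta>" by blast
  qed (meson less_imp_le)
  finally show ?thesis .
qed

end

theory Submission
  imports Defs "Jordan_Normal_Form.Determinant" "HOL-Library.Real_Mod" "HOL-Real_Asymp.Real_Asymp"
begin

text \<open>
  The columns generate \<open>\<int>\<^sup>n\<close> iff for every prime \<open>p\<close> no nonzero vector modulo \<open>p\<close> is orthogonal to all of
  them; call the vectors orthogonal to the first \<open>t\<close> columns the kernel at time \<open>t\<close>. Since extra columns
  only help, a fixed large number \<open>u\<close> of them suffices.

  A column lies in the span of the previous ones with probability at most \<open>q\<^sup>d\<close>, where \<open>d\<close> is the codimension
  of the span (capped) and \<open>q\<close> is small as soon as the kernel has no vector of small support; this is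
  Halasz' inequality. Sparse kernel vectors are excluded for all primes at once: one of minimal support
  \<open>S\<close> is determined, up to scaling, by \<open>S\<close>, by few columns, and by a prime dividing a nonzero minor, so a
  union bound applies. Primes up to a small power of \<open>n\<close> are then treated by a union bound over all dense vectors.

  For the remaining primes there is no union bound over \<open>p\<close>. Instead, generation fails modulo \<open>p\<close> only if the
  rank fails to grow more than \<open>u\<close> times. After the first such failure \<open>p\<close> divides a nonzero minor of the
  columns seen so far, so only \<open>n\<^sup>2\<close> primes are candidates, and each of them needs \<open>u\<close> further
  failures, which has probability at most a fixed negative power of \<open>n\<close> to the power \<open>u\<close>. Minors are known
  to be nonzero because no failure occurs modulo a fixed large auxiliary prime \<open>p0\<close>.
\<close>

section \<open>Linear algebra modulo a prime\<close>

text \<open>The bound for a single column modulo \<open>p\<close> does not tend to 0 as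
  \<open>p\<close> grows, so bounds for one prime cannot be summed over all primes. The way out is
  to make the prime a function of the past: it is the \<open>b\<close>-th prime dividing a minor of
  columns already seen, the union bound runs over \<open>b\<close>, and conditionally on those
  columns the bound for a fixed prime applies to the later ones. The index stays below
  \<open>n\<^sup>2\<close> because the minors are at most 2 to the power \<open>n\<^sup>2\<close>.
  The same device serves sparse vectors, whose prime and coefficients are both recovered from few
  columns.

  The prime \<open>p0\<close> acts as a certificate. The probability of a failure modulo
  \<open>p0\<close> before time \<open>n\<close> is dominated by a geometric series of ratio
  \<open>sqrt (2 / p0)\<close>, which is small but does not vanish as \<open>n\<close> grows; so
  \<open>p0\<close> and \<open>u\<close> are chosen from \<open>\<delta>\<close> and
  \<open>\<epsilon>\<close> before \<open>n\<close> tends to infinity. The \<open>u\<close>-th power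
  of the probability of a late failure must beat about \<open>n ^ 3\<close> pairs of a time and an
  index, which asks for \<open>u\<close> of order \<open>1 / \<epsilon>\<close>.\<close>

definition mvec :: "nat \<Rightarrow> 'a set \<Rightarrow> ('a \<Rightarrow> int) set" where
  "mvec p S = PiE_dflt S 0 (\<lambda>_. {0..<int p})"

definition lcomb :: "nat \<Rightarrow> int \<Rightarrow> ('a \<Rightarrow> int) \<Rightarrow> int \<Rightarrow> ('a \<Rightarrow> int) \<Rightarrow> 'a \<Rightarrow> int" where
  "lcomb p a v b w = (\<lambda>i. (a * v i + b * w i) mod int p)"

text \<open>A subspace over the field with \<open>p\<close> elements, kept as a set of reduced
  representatives. The prime depends on the sample, so it stays a term and is not encoded in a
  type.\<close>

definition msub :: "nat \<Rightarrow> 'a set \<Rightarrow> ('a \<Rightarrow> int) set \<Rightarrow> bool" where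
  "msub p S V \<longleftrightarrow> V \<subseteq> mvec p S \<and> (\<lambda>_. 0) \<in> V \<and> (\<forall>v\<in>V. \<forall>w\<in>V. \<forall>a b. lcomb p a v b w \<in> V)"

definition supp :: "('a \<Rightarrow> int) \<Rightarrow> 'a set" where
  "supp w = {i. w i \<noteq> 0}"

definition restr :: "'a set \<Rightarrow> ('a \<Rightarrow> int) \<Rightarrow> 'a \<Rightarrow> int" where
  "restr B v = (\<lambda>i. if i \<in> B then v i else 0)"

definition kills :: "nat \<Rightarrow> 'a set \<Rightarrow> ('a \<Rightarrow> int) \<Rightarrow> ('a \<Rightarrow> int) \<Rightarrow> bool" where
  "kills p S y w \<longleftrightarrow> int p dvd (\<Sum>i\<in>S. w i * y i)"

text \<open>The left kernel of the submatrix with rows \<open>S\<close> and columns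
  \<open>J\<close>: \<open>X t\<close> is column \<open>t\<close>, so \<open>X t i\<close> is the
  entry in row \<open>i\<close>.\<close>

definition lker :: "nat \<Rightarrow> 'a set \<Rightarrow> ('b \<Rightarrow> 'a \<Rightarrow> int) \<Rightarrow> 'b set \<Rightarrow> ('a \<Rightarrow> int) set" where
  "lker p S X J = {w \<in> mvec p S. \<forall>t\<in>J. kills p S (X t) w}"

lemma mvec_iff: "w \<in> mvec p S \<longleftrightarrow> (\<forall>i. (i \<in> S \<longrightarrow> 0 \<le> w i \<and> w i < int p) \<and> (i \<notin> S \<longrightarrow> w i = 0))"
  by (auto simp: mvec_def PiE_dflt_def)

lemma mvecD: "w \<in> mvec p S \<Longrightarrow> p > 0 \<Longrightarrow> 0 \<le> w i \<and> w i < int p"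
  by (cases "i \<in> S") (auto simp: mvec_iff)

lemma finite_mvec [simp]: "finite S \<Longrightarrow> finite (mvec p S)"
  unfolding mvec_def by (intro finite_PiE_dflt) auto

lemma card_mvec: "finite S \<Longrightarrow> card (mvec p S) = p ^ card S"
  unfolding mvec_def by (subst card_PiE_dflt) auto

lemma zero_in_mvec: "p > 0 \<Longrightarrow> (\<lambda>_. 0) \<in> mvec p S"
  by (auto simp: mvec_iff)

lemma supp_mvec: "w \<in> mvec p S \<Longrightarrow> supp w \<subseteq> S"
  by (auto simp: mvec_iff supp_def)

lemma mvec_supp:
  assumes "w \<in> mvec p S" "p > 0" "supp w \<subseteq> R"
  shows "w \<in> mvec p R"
  unfolding mvec_iff
proof (intro allI conjI impI)
  fix i
  show "0 \<le> w i" "w i < int p" using mvecD[OF assms(1,2)] by auto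
  show "w i = 0" if "i \<notin> R" using assms(3) that by (auto simp: supp_def)
qed

lemma mvec_mono: "p > 0 \<Longrightarrow> R \<subseteq> S \<Longrightarrow> mvec p R \<subseteq> mvec p S"
  unfolding mvec_iff subset_iff by (metis of_nat_0_less_iff order_refl)

lemma supp_empty_iff: "supp w = {} \<longleftrightarrow> w = (\<lambda>_. 0)"
  by (auto simp: supp_def)

lemma lcomb_in_mvec:
  assumes "p > 0" "v \<in> mvec p S" "w \<in> mvec p S"
  shows "lcomb p a v b w \<in> mvec p S"
  using assms by (auto simp: mvec_iff lcomb_def)

lemma msub_mvec: "p > 0 \<Longrightarrow> msub p S (mvec p S)"
  by (auto simp: msub_def zero_in_mvec lcomb_in_mvec)

lemma finite_msub: "finite S \<Longrightarrow> msub p S V \<Longrightarrow> finite V"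
  using finite_subset[OF _ finite_mvec] by (auto simp: msub_def)

lemma mod_eq_self: "w \<in> mvec p S \<Longrightarrow> p > 0 \<Longrightarrow> w i mod int p = w i"
  using mvecD[of w p S i] by auto

lemma kills_lcomb:
  assumes "kills p S y v" "kills p S y w"
  shows "kills p S y (lcomb p a v b w)"
proof -
  have "[(\<Sum>i\<in>S. lcomb p a v b w i * y i) = (\<Sum>i\<in>S. (a * v i + b * w i) * y i)] (mod int p)"
    by (intro cong_sum) (auto simp: lcomb_def cong_def mod_mult_left_eq)
  also have "(\<Sum>i\<in>S. (a * v i + b * w i) * y i) = a * (\<Sum>i\<in>S. v i * y i) + b * (\<Sum>i\<in>S. w i * y i)"
    by (simp add: algebra_simps sum.distrib sum_distrib_left)
  finally have "[(\<Sum>i\<in>S. lcomb p a v b w i * y i) = a * (\<Sum>i\<in>S. v i * y i) + b * (\<Sum>i\<in>S. w i * y i)] (mod int p)" .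
  moreover have "int p dvd a * (\<Sum>i\<in>S. v i * y i) + b * (\<Sum>i\<in>S. w i * y i)"
    using assms by (auto simp: kills_def)
  ultimately show ?thesis unfolding kills_def using cong_dvd_iff by blast
qed

lemma kills_zero [simp]: "kills p S y (\<lambda>_. 0)"
  by (simp add: kills_def)

lemma kills_supp:
  assumes "supp w \<subseteq> R" "supp w \<subseteq> S" "finite R" "finite S"
  shows "kills p S y w \<longleftrightarrow> kills p R y w"
proof -
  have "(\<Sum>i\<in>S. w i * y i) = (\<Sum>i\<in>R. w i * y i)"
    by (rule sum.mono_neutral_cong) (use assms in \<open>auto simp: supp_def\<close>)
  thus ?thesis by (simp add: kills_def)
qed

lemma msub_lker: "p > 0 \<Longrightarrow> msub p S (lker p S X J)"
  using msub_mvec[of p S] kills_lcomb[of p S] by (auto simp: msub_def lker_def)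

lemma lker_empty [simp]: "lker p S X {} = mvec p S"
  by (auto simp: lker_def)

lemma lker_insert: "lker p S X (insert t J) = {w \<in> lker p S X J. kills p S (X t) w}"
  by (auto simp: lker_def)

lemma lker_antimono: "I \<subseteq> J \<Longrightarrow> lker p S X J \<subseteq> lker p S X I"
  by (auto simp: lker_def)

text \<open>Padding with zeros extends a kernel vector to more rows; as functions the two are equal,
  since \<open>mvec\<close> forces 0 outside the row set.\<close>

lemma lker_mono_rows:
  assumes "R \<subseteq> S" "finite S" "p > 0" "w \<in> lker p R X J"
  shows "w \<in> lker p S X J"
proof -
  have w: "w \<in> mvec p R" using assms by (auto simp: lker_def)
  hence s: "supp w \<subseteq> R" by (rule supp_mvec)
  have f: "finite R" using assms finite_subset by blast
  have "w \<in> mvec p S" using mvec_mono[of p R S] assms w by blast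
  moreover have "kills p S y w = kills p R y w" for y
    using kills_supp[of w R S p y] s assms f by auto
  ultimately show ?thesis using assms by (auto simp: lker_def)
qed

lemma lker_supp:
  assumes "w \<in> lker p S X J" "finite S" "p > 0"
  shows "w \<in> lker p (supp w) X J"
proof -
  have w: "w \<in> mvec p S" using assms by (auto simp: lker_def)
  hence s: "supp w \<subseteq> S" by (rule supp_mvec)
  have f: "finite (supp w)" using s assms finite_subset by blast
  have "w \<in> mvec p (supp w)" using mvec_supp[OF w] assms by auto
  moreover have "kills p (supp w) y w = kills p S y w" for y
    using kills_supp[of w S "supp w" p y] s assms f by auto
  ultimately show ?thesis using assms by (auto simp: lker_def)
qed

section \<open>Dimension counts over the field with p elements\<close>

lemma prime_inverse_ex:
  assumes "prime p" "\<not> int p dvd a"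
  obtains c where "[c * a = 1] (mod int p)"
proof -
  have "coprime (int p) a" using assms by (simp add: prime_imp_coprime)
  hence "coprime a (int p)" by (simp add: coprime_commute)
  then obtain c where "[a * c = 1] (mod int p)" using cong_solve_coprime_int by blast
  thus ?thesis using that[of c] by (simp add: mult.commute)
qed

lemma mvec_not_dvd:
  assumes "w \<in> mvec p S" "p > 0" "w i \<noteq> 0"
  shows "\<not> int p dvd w i"
  using mvecD[OF assms(1,2), of i] assms(3) by (smt (verit) zdvd_not_zless)

text \<open>A linear functional vanishes on \<open>V\<close> or maps onto the residues modulo
  \<open>p\<close>. In the second case a vector \<open>u\<close> of value 1 writes every element
  uniquely as a kernel element plus a multiple of \<open>u\<close>.\<close>

lemma card_msub_kills:
  assumes p: "prime p" and S: "finite S" and V: "msub p S V"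
  shows "V = {w\<in>V. kills p S y w} \<or> card V = p * card {w\<in>V. kills p S y w}"
proof (cases "\<forall>w\<in>V. kills p S y w")
  case False
  define f where "f w = (\<Sum>i\<in>S. w i * y i)" for w
  define K where "K = {w\<in>V. kills p S y w}"
  have p0: "p > 0" using p prime_gt_0_nat by auto
  have K': "K = {w\<in>V. int p dvd f w}" by (auto simp: K_def kills_def f_def)
  from False obtain u0 where u0: "u0 \<in> V" "\<not> int p dvd f u0" by (auto simp: kills_def f_def)
  obtain c where c: "[c * f u0 = 1] (mod int p)" using prime_inverse_ex[OF p u0(2)] by blast
  have fl: "[f (lcomb p a v b w) = a * f v + b * f w] (mod int p)" for a b v w
  proof -
    have "[f (lcomb p a v b w) = (\<Sum>i\<in>S. (a * v i + b * w i) * y i)] (mod int p)"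
      unfolding f_def by (intro cong_sum) (auto simp: lcomb_def cong_def mod_mult_left_eq)
    also have "(\<Sum>i\<in>S. (a * v i + b * w i) * y i) = a * f v + b * f w"
      by (simp add: f_def algebra_simps sum.distrib sum_distrib_left)
    finally show ?thesis .
  qed
  define u where "u = lcomb p c u0 0 u0"
  have u: "u \<in> V" using V u0 by (auto simp: msub_def u_def)
  have fu: "[f u = 1] (mod int p)" using fl[of c u0 0 u0] c by (auto simp: u_def intro: cong_trans)
  define g where "g = (\<lambda>(v::'a \<Rightarrow> int, b). lcomb p 1 v b u)"
  have fg: "[f (lcomb p 1 v b u) = f v + b] (mod int p)" for v b
  proof -
    have "[f (lcomb p 1 v b u) = 1 * f v + b * f u] (mod int p)" by (rule fl)
    also have "[1 * f v + b * f u = f v + b] (mod int p)"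
      using fu by (metis cong_add_lcancel cong_scalar_left mult.right_neutral mult_1)
    finally show ?thesis .
  qed
  have "bij_betw g (K \<times> {0..<int p}) V"
  proof (rule bij_betw_byWitness[where f' = "\<lambda>w. (lcomb p 1 w (- f w) u, f w mod int p)"])
    show "g ` (K \<times> {0..<int p}) \<subseteq> V" using V u by (auto simp: g_def msub_def K')
    show "(\<lambda>w. (lcomb p 1 w (- f w) u, f w mod int p)) ` V \<subseteq> K \<times> {0..<int p}"
    proof safe
      fix w assume w: "w \<in> V"
      have "[f (lcomb p 1 w (- f w) u) = 0] (mod int p)" using fg[of w "- f w"] by simp
      thus "lcomb p 1 w (- f w) u \<in> K" using V u w by (auto simp: K' msub_def cong_0_iff)
    qed (use p0 in auto)
    show "\<forall>a\<in>K \<times> {0..<int p}. (lcomb p 1 (g a) (- f (g a)) u, f (g a) mod int p) = a"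
    proof safe
      fix v b assume v: "v \<in> K" and b: "b \<in> {0..<int p}"
      have fv: "[f v = 0] (mod int p)" using v by (auto simp: K' cong_0_iff)
      have "[f (g (v,b)) = f v + b] (mod int p)" using fg[of v b] by (simp add: g_def)
      also have "[f v + b = 0 + b] (mod int p)" by (intro cong_add fv cong_refl)
      finally have fb: "[f (g (v,b)) = b] (mod int p)" by simp
      hence "f (g (v,b)) mod int p = b mod int p" by (simp add: cong_def)
      thus 1: "f (g (v,b)) mod int p = b" using b by simp
      have vm: "v \<in> mvec p S" using v V by (auto simp: K' msub_def)
      show "lcomb p 1 (g (v, b)) (- f (g (v, b))) u = v"
      proof
        fix i
        have "lcomb p 1 (g (v, b)) (- f (g (v, b))) u i = (g (v,b) i - f (g (v,b)) * u i) mod int p"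
          by (simp add: lcomb_def)
        also have "[g (v,b) i - f (g (v,b)) * u i = (v i + b * u i) - b * u i] (mod int p)"
          by (intro cong_diff cong_mult fb cong_refl) (simp add: g_def lcomb_def)
        hence "(g (v,b) i - f (g (v,b)) * u i) mod int p = v i mod int p" by (simp add: cong_def)
        also have "\<dots> = v i" using mod_eq_self[OF vm p0] .
        finally show "lcomb p 1 (g (v, b)) (- f (g (v, b))) u i = v i" .
      qed
    qed
    show "\<forall>a'\<in>V. g (lcomb p 1 a' (- f a') u, f a' mod int p) = a'"
    proof
      fix w assume w: "w \<in> V"
      hence wm: "w \<in> mvec p S" using V by (auto simp: msub_def)
      show "g (lcomb p 1 w (- f w) u, f w mod int p) = w"
      proof
        fix i
        have "g (lcomb p 1 w (- f w) u, f w mod int p) i = ((w i - f w * u i) mod int p + (f w mod int p) * u i) mod int p"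
          by (simp add: g_def lcomb_def)
        also have "\<dots> = ((w i - f w * u i) + f w * u i) mod int p"
          by (metis mod_add_cong mod_mod_trivial mod_mult_left_eq)
        also have "\<dots> = w i" using mod_eq_self[OF wm p0] by simp
        finally show "g (lcomb p 1 w (- f w) u, f w mod int p) i = w i" .
      qed
    qed
  qed
  hence "card (K \<times> {0..<int p}) = card V" by (rule bij_betw_same_card)
  thus ?thesis by (simp add: card_cartesian_product K_def mult.commute)
qed blast

text \<open>Greedy choice of a column basis: a column is kept exactly when it shrinks the kernel,
  and then it does so by the factor \<open>p\<close>. The equation says that \<open>card C\<close>
  is the rank.\<close>

lemma lker_choose_columns:
  assumes p: "prime p" and S: "finite S" and J: "finite J"
  shows "\<exists>C\<subseteq>J. lker p S X C = lker p S X J \<and> card (lker p S X C) * p ^ card C = p ^ card S"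
  using J
proof (induction J)
  case empty
  show ?case using S by (auto simp: card_mvec)
next
  case (insert t J)
  then obtain C where C: "C \<subseteq> J" "lker p S X C = lker p S X J" "card (lker p S X C) * p ^ card C = p ^ card S"
    by auto
  have p0: "p > 0" using p prime_gt_0_nat by auto
  have fC: "finite C" "t \<notin> C" using C insert finite_subset by auto
  from card_msub_kills[OF p S msub_lker[OF p0], of X C "X t"]
  show ?case
  proof
    assume "lker p S X C = {w \<in> lker p S X C. kills p S (X t) w}"
    thus ?thesis using C by (intro exI[of _ C]) (auto simp: lker_insert)
  next
    assume *: "card (lker p S X C) = p * card {w \<in> lker p S X C. kills p S (X t) w}"
    have "lker p S X (insert t C) = lker p S X (insert t J)" using C(2) by (simp add: lker_insert)
    moreover have "card (lker p S X (insert t C)) * p ^ card (insert t C) = p ^ card S"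
      using C(3) * fC by (simp add: lker_insert mult_ac)
    ultimately show ?thesis using C(1) by (intro exI[of _ "insert t C"]) auto
  qed
qed

lemma lker_card_lower:
  assumes p: "prime p" and S: "finite S" and J: "finite J"
  shows "p ^ card S \<le> card (lker p S X J) * p ^ card J"
proof -
  obtain C where C: "C\<subseteq>J" "lker p S X C = lker p S X J" "card (lker p S X C) * p ^ card C = p ^ card S"
    using lker_choose_columns[OF p S J] by blast
  have "p ^ card C \<le> p ^ card J"
    using C(1) J p by (intro power_increasing card_mono) (auto simp: prime_gt_0_nat Suc_leI)
  thus ?thesis using C by (metis mult_le_mono2)
qed

text \<open>\<open>B\<close> is an information set of the code \<open>V\<close>.\<close>
definition info :: "nat \<Rightarrow> ('a \<Rightarrow> int) set \<Rightarrow> 'a set \<Rightarrow> bool" where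
  "info p V B \<longleftrightarrow> bij_betw (restr B) V (mvec p B)"

section \<open>Information sets of a subspace\<close>

lemma lcomb_id: "w \<in> mvec p S \<Longrightarrow> p > 0 \<Longrightarrow> lcomb p 1 w 0 v = w"
  by (auto simp: lcomb_def mod_eq_self)

lemma msub_restr_inj:
  assumes V: "msub p S V" and p: "prime p" and inj: "\<And>v. v \<in> V \<Longrightarrow> (\<forall>i\<in>R. v i = 0) \<Longrightarrow> v = (\<lambda>_. 0)"
  shows "inj_on (restr R) V"
proof (rule inj_onI)
  fix v w assume vw: "v \<in> V" "w \<in> V" "restr R v = restr R w"
  have p0: "p > 0" using p prime_gt_0_nat by auto
  have eq: "v i = w i" if "i \<in> R" for i using fun_cong[OF vw(3), of i] that by (simp add: restr_def)
  have "lcomb p 1 v (-1) w \<in> V" using V vw by (auto simp: msub_def)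
  moreover have "\<forall>i\<in>R. lcomb p 1 v (-1) w i = 0" using eq by (auto simp: lcomb_def)
  ultimately have "lcomb p 1 v (-1) w = (\<lambda>_. 0)" using inj by blast
  hence *: "(v i - w i) mod int p = 0" for i by (auto simp: lcomb_def fun_eq_iff)
  have m: "v \<in> mvec p S" "w \<in> mvec p S" using V vw by (auto simp: msub_def)
  have "v i = w i" for i
  proof -
    have "v i mod int p = w i mod int p" using *[of i] by (simp add: mod_eq_dvd_iff dvd_eq_mod_eq_0)
    thus ?thesis using mod_eq_self m p0 by metis
  qed
  thus "v = w" by auto
qed

text \<open>Shrink \<open>R\<close> while restriction to it stays injective on \<open>V\<close>.
  When no \<open>b\<close> can be removed, some vector of \<open>V\<close> is nonzero at
  \<open>b\<close> and zero on the rest of \<open>R\<close>; scaled to 1, these vectors act as unit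
  vectors and make the restriction surjective.\<close>

lemma info_ex:
  assumes V: "msub p S V" and p: "prime p" and R: "finite R"
    and inj: "\<And>v. v \<in> V \<Longrightarrow> (\<forall>i\<in>R. v i = 0) \<Longrightarrow> v = (\<lambda>_. 0)"
  shows "\<exists>B\<subseteq>R. info p V B"
  using R inj
proof (induction R rule: finite_psubset_induct)
  case (psubset R)
  have p0: "p > 0" using p prime_gt_0_nat by auto
  show ?case
  proof (cases "\<exists>b\<in>R. \<forall>v\<in>V. (\<forall>i\<in>R - {b}. v i = 0) \<longrightarrow> v = (\<lambda>_. 0)")
    case True
    then obtain b where b: "b \<in> R" "\<forall>v\<in>V. (\<forall>i\<in>R - {b}. v i = 0) \<longrightarrow> v = (\<lambda>_. 0)" by blast
    have "\<exists>B\<subseteq>R - {b}. info p V B" by (rule psubset.IH) (use b in auto)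
    thus ?thesis by blast
  next
    case False
    have inj: "inj_on (restr R) V" using msub_restr_inj[OF V p] psubset.prems by blast
    have unit: "\<exists>u\<in>V. (\<forall>i\<in>R - {b}. u i = 0) \<and> u b = 1" if b: "b \<in> R" for b
    proof -
      obtain v where v: "v \<in> V" "\<forall>i\<in>R - {b}. v i = 0" "v \<noteq> (\<lambda>_. 0)" using False b by blast
      have vm: "v \<in> mvec p S" using v V by (auto simp: msub_def)
      have "v b \<noteq> 0" using psubset.prems[OF v(1)] v by (metis Diff_iff singletonD)
      hence "\<not> int p dvd v b" using mvec_not_dvd[OF vm p0] by blast
      then obtain c where c: "[c * v b = 1] (mod int p)" using prime_inverse_ex[OF p] by blast
      have "lcomb p c v 0 v \<in> V" using V v by (auto simp: msub_def)
      moreover have "\<forall>i\<in>R-{b}. lcomb p c v 0 v i = 0" using v by (auto simp: lcomb_def)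
      moreover have "lcomb p c v 0 v b = 1" using c p prime_gt_1_nat[of p] by (auto simp: lcomb_def cong_def)
      ultimately show ?thesis by blast
    qed
    have surj: "\<exists>v\<in>V. restr R v = restr Q w" if "Q \<subseteq> R" "w \<in> mvec p R" for Q w
    proof -
      have "finite Q" using that(1) psubset.hyps finite_subset by blast
      thus ?thesis using that(1)
      proof (induction Q)
        case empty
        show ?case using V by (intro bexI[of _ "\<lambda>_. 0"]) (auto simp: restr_def msub_def)
      next
        case (insert b Q)
        then obtain v where v: "v \<in> V" "restr R v = restr Q w" by auto
        obtain u where u: "u \<in> V" "\<forall>i\<in>R - {b}. u i = 0" "u b = 1" using unit[of b] insert by auto
        have vi: "v i = (if i \<in> Q then w i else 0)" if "i \<in> R" for i
          using fun_cong[OF v(2), of i] that by (simp add: restr_def)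
        have "lcomb p 1 v (w b) u \<in> V" using V v u by (auto simp: msub_def)
        moreover have "restr R (lcomb p 1 v (w b) u) = restr (insert b Q) w"
        proof
          fix i
          have ui: "u i = 0" if "i \<in> R" "i \<in> Q" using u(2) that insert.hyps by auto
          have wm: "w i mod int p = w i" using mod_eq_self[OF \<open>w \<in> mvec p R\<close> p0] .
          show "restr R (lcomb p 1 v (w b) u) i = restr (insert b Q) w i"
            using vi[of i] ui u insert.hyps insert.prems wm by (auto simp: restr_def lcomb_def)
        qed
        ultimately show ?case by blast
      qed
    qed
    have "restr R ` V = mvec p R"
    proof
      show "restr R ` V \<subseteq> mvec p R" using V mvecD[OF _ p0, of _ S] by (auto simp: restr_def mvec_iff[of _ _ R] msub_def subset_iff)
      show "mvec p R \<subseteq> restr R ` V"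
      proof
        fix w assume w: "w \<in> mvec p R"
        have "restr R w = w" using w by (auto simp: restr_def mvec_iff)
        thus "w \<in> restr R ` V" using surj[OF subset_refl w] by (metis imageI)
      qed
    qed
    thus ?thesis using inj by (auto simp: info_def bij_betw_def)
  qed
qed

lemma info_card: "info p V B \<Longrightarrow> finite B \<Longrightarrow> card V = p ^ card B"
  unfolding info_def using bij_betw_same_card card_mvec by metis

lemma msub_card_power:
  assumes V: "msub p S V" and p: "prime p" and S: "finite S"
  shows "\<exists>d. card V = p ^ d"
proof -
  have "\<exists>B\<subseteq>S. info p V B"
  proof (rule info_ex[OF V p S])
    fix v assume "v \<in> V" "\<forall>i\<in>S. v i = 0"
    thus "v = (\<lambda>_. 0)" using V by (auto simp: msub_def mvec_iff fun_eq_iff subset_iff)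
  qed
  then obtain B where "B \<subseteq> S" "info p V B" by blast
  thus ?thesis using info_card finite_subset S by blast
qed

lemma msub_subspace:
  assumes V: "msub p S V" and p: "prime p" and S: "finite S" and d: "p ^ d \<le> card V"
  shows "\<exists>W\<subseteq>V. msub p S W \<and> card W = p ^ d"
proof -
  have p0: "p > 0" and p1: "p > 1" using p prime_gt_0_nat prime_gt_1_nat by auto
  have "\<exists>B\<subseteq>S. info p V B"
  proof (rule info_ex[OF V p S])
    fix v assume "v \<in> V" "\<forall>i\<in>S. v i = 0"
    thus "v = (\<lambda>_. 0)" using V by (auto simp: msub_def mvec_iff fun_eq_iff subset_iff)
  qed
  then obtain B where B: "B \<subseteq> S" "info p V B" by blast
  have fB: "finite B" using B S finite_subset by blast
  have "d \<le> card B" using info_card[OF B(2) fB] d p1 by (simp add: power_increasing_iff)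
  then obtain B' where B': "B' \<subseteq> B" "card B' = d" using obtain_subset_with_card_n by metis
  define W where "W = {v\<in>V. restr B v \<in> mvec p B'}"
  have "bij_betw (restr B) W (mvec p B')"
  proof -
    have "mvec p B' \<subseteq> mvec p B" using mvec_mono[OF p0 B'(1)] .
    thus ?thesis using B(2) by (auto simp: info_def bij_betw_def W_def inj_on_def)
  qed
  hence "card W = p ^ d" using B' finite_subset fB card_mvec bij_betw_same_card by metis
  moreover have "msub p S W"
  proof -
    have "restr B (lcomb p a v b w) = lcomb p a (restr B v) b (restr B w)" for a v b w
      by (auto simp: restr_def lcomb_def)
    thus ?thesis using V lcomb_in_mvec[OF p0] zero_in_mvec[OF p0, of B']
      by (auto simp: msub_def W_def restr_def[of B "\<lambda>_. 0"])
  qed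
  ultimately show ?thesis by (intro exI[of _ W]) (auto simp: W_def)
qed

text \<open>The blocks have size \<open>d\<close> and are chosen one after another. The at most
  \<open>l - 1\<close> earlier blocks have fewer than \<open>s\<close> coordinates together, so no
  nonzero vector of \<open>V\<close> lives on them and restriction to their complement is still
  injective.\<close>

lemma info_blocks:
  assumes V: "msub p S V" and p: "prime p" and S: "finite S" and d: "card V = p ^ d"
    and s: "\<And>v. v \<in> V \<Longrightarrow> v \<noteq> (\<lambda>_. 0) \<Longrightarrow> card (supp v) \<ge> s" and l: "(l - 1) * d < s"
  shows "\<exists>Bs. (\<forall>j<l. Bs j \<subseteq> S \<and> info p V (Bs j)) \<and> disjoint_family_on Bs {..<l}"
  using l
proof (induction l)
  case 0
  show ?case by (auto simp: disjoint_family_on_def)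
next
  case (Suc l)
  have p0: "p > 0" and p1: "p > 1" using p prime_gt_0_nat prime_gt_1_nat by auto
  have ls: "l * d < s" using Suc.prems by simp
  have "(l - 1) * d < s" using ls by (metis diff_le_self le_less_trans mult_le_mono1)
  then obtain Bs where Bs: "\<forall>j<l. Bs j \<subseteq> S \<and> info p V (Bs j)" "disjoint_family_on Bs {..<l}"
    using Suc.IH by blast
  define R where "R = S - (\<Union>j<l. Bs j)"
  have cB: "card (Bs j) = d" if "j < l" for j
  proof -
    have "finite (Bs j)" using Bs that S finite_subset by blast
    hence "p ^ card (Bs j) = p ^ d" using info_card Bs that d by metis
    thus ?thesis using p1 by (simp add: power_inject_exp)
  qed
  have cU: "card (\<Union>j<l. Bs j) \<le> l * d"
    using card_UN_le[of "{..<l}" Bs] cB by simp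
  have "\<exists>B\<subseteq>R. info p V B"
  proof (rule info_ex[OF V p])
    show "finite R" using S by (simp add: R_def)
    fix v assume v: "v \<in> V" "\<forall>i\<in>R. v i = 0"
    show "v = (\<lambda>_. 0)"
    proof (rule ccontr)
      assume "v \<noteq> (\<lambda>_. 0)"
      hence "s \<le> card (supp v)" using s v by blast
      also have "supp v \<subseteq> (\<Union>j<l. Bs j)"
      proof -
        have "supp v \<subseteq> S" using supp_mvec[of v p S] v V by (auto simp: msub_def)
        thus ?thesis using v(2) by (auto simp: R_def supp_def)
      qed
      hence "card (supp v) \<le> card (\<Union>j<l. Bs j)"
        using Bs(1) S by (intro card_mono) (auto intro: finite_subset)
      finally show False using cU ls by linarith
    qed
  qed
  then obtain B where B: "B \<subseteq> R" "info p V B" by blast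
  have "(\<forall>j<Suc l. (Bs(l := B)) j \<subseteq> S \<and> info p V ((Bs(l := B)) j))"
    using Bs B by (auto simp: less_Suc_eq R_def)
  moreover have "disjoint_family_on (Bs(l := B)) {..<Suc l}"
    using Bs(2) B(1) unfolding disjoint_family_on_def R_def
    by (auto simp: less_Suc_eq) blast+
  ultimately show ?case by blast
qed

section \<open>Minors, bad primes and the cokernel\<close>

lemma cong_det:
  fixes A B :: "int mat"
  assumes "A \<in> carrier_mat k k" "B \<in> carrier_mat k k"
    and "\<And>i j. i < k \<Longrightarrow> j < k \<Longrightarrow> [A $$ (i,j) = B $$ (i,j)] (mod m)"
  shows "[det A = det B] (mod m)"
  unfolding det_def'[OF assms(1)] det_def'[OF assms(2)]
proof (intro cong_sum cong_mult cong_prod cong_refl)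
  fix \<pi> i assume "\<pi> \<in> {\<pi>. \<pi> permutes {0..<k}}" "i \<in> {0..<k}"
  thus "[A $$ (i, \<pi> i) = B $$ (i, \<pi> i)] (mod m)"
    using assms(3)[of i "\<pi> i"] permutes_in_image[of \<pi> "{0..<k}" i] by auto
qed

lemma abs_det_le:
  fixes A :: "int mat"
  assumes A: "A \<in> carrier_mat k k" and K: "\<And>i j. i < k \<Longrightarrow> j < k \<Longrightarrow> real_of_int \<bar>A $$ (i,j)\<bar> \<le> K"
  shows "real_of_int \<bar>det A\<bar> \<le> fact k * K ^ k"
proof -
  have "real_of_int \<bar>det A\<bar> \<le> (\<Sum>\<pi>\<in>{\<pi>. \<pi> permutes {0..<k}}. real_of_int \<bar>signof \<pi> * (\<Prod>i = 0..<k. A $$ (i, \<pi> i))\<bar>)"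
    unfolding det_def'[OF A] of_int_sum[symmetric] of_int_le_iff by (rule sum_abs)
  also have "\<dots> \<le> (\<Sum>\<pi>\<in>{\<pi>. \<pi> permutes {0..<k}}. K ^ k)"
  proof (intro sum_mono)
    fix \<pi> assume p: "\<pi> \<in> {\<pi>. \<pi> permutes {0..<k}}"
    have "real_of_int \<bar>signof \<pi> * (\<Prod>i = 0..<k. A $$ (i, \<pi> i))\<bar> = (\<Prod>i = 0..<k. real_of_int \<bar>A $$ (i, \<pi> i)\<bar>)"
      by (simp add: abs_mult sign_def abs_prod)
    also have "\<dots> \<le> (\<Prod>i = 0..<k. K)"
      using K p permutes_in_image[of \<pi> "{0..<k}"] by (intro prod_mono) auto
    finally show "real_of_int \<bar>signof \<pi> * (\<Prod>i = 0..<k. A $$ (i, \<pi> i))\<bar> \<le> K ^ k" by simp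
  qed
  also have "\<dots> = fact k * K ^ k" by (simp add: card_permutations)
  finally show ?thesis .
qed

text \<open>The number \<open>D\<close> is the minor of the matrix on the rows \<open>S\<close> and the columns \<open>A\<close>.\<close>
lemma minor_ex:
  assumes p: "prime p" and S: "finite S" and A: "finite A" "card A = card S"
    and ker: "lker p S X A = {\<lambda>_. 0}"
  obtains D :: int where
    "\<not> int p dvd D"
    "\<And>q w. prime q \<Longrightarrow> w \<in> lker q S X A \<Longrightarrow> \<not> int q dvd D \<Longrightarrow> w = (\<lambda>_. 0)"
    "\<And>K. (\<And>t i. t \<in> A \<Longrightarrow> i \<in> S \<Longrightarrow> real_of_int \<bar>X t i\<bar> \<le> K) \<Longrightarrow> real_of_int \<bar>D\<bar> \<le> fact (card S) * K ^ card S"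
    "\<And>y. \<exists>c. \<forall>i\<in>S. D * y i = (\<Sum>t\<in>A. c t * X t i)"
proof -
  have p0: "p > 0" and p1: "p > 1" using p prime_gt_0_nat prime_gt_1_nat by auto
  define k where "k = card S"
  obtain f where f: "bij_betw f {0..<k} S" using ex_bij_betw_nat_finite[OF S] by (auto simp: k_def)
  obtain g where g: "bij_betw g {0..<k} A" using ex_bij_betw_nat_finite[OF A(1)] A(2) by (auto simp: k_def)
  have fS: "f i \<in> S" and gA: "g i \<in> A" if "i < k" for i
    using that f g by (auto simp: bij_betw_def)
  define N where "N = mat k k (\<lambda>(i,j). X (g j) (f i))"
  have N: "N \<in> carrier_mat k k" by (simp add: N_def)
  have sumS: "(\<Sum>i\<in>S. h i) = (\<Sum>i=0..<k. h (f i))" for h :: "_ \<Rightarrow> int"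
    using sum.reindex_bij_betw[OF f, of h] by simp
  have sumA: "(\<Sum>i\<in>A. h i) = (\<Sum>i=0..<k. h (g i))" for h :: "_ \<Rightarrow> int"
    using sum.reindex_bij_betw[OF g, of h] by simp
  \<comment> \<open>\<open>F w\<close> is the row vector \<open>w\<close> times the matrix, modulo
    \<open>p\<close>; the trivial kernel makes it injective.\<close>
  define F where "F w = (\<lambda>t. if t \<in> A then (\<Sum>i\<in>S. w i * X t i) mod int p else 0)" for w
  have inj: "inj_on F (mvec p S)"
  proof (rule inj_onI)
    fix v w assume vw: "v \<in> mvec p S" "w \<in> mvec p S" "F v = F w"
    have "lcomb p 1 v (-1) w \<in> lker p S X A"
    proof -
      have "kills p S (X t) (lcomb p 1 v (-1) w)" if t: "t \<in> A" for t
      proof -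
        have "(\<Sum>i\<in>S. v i * X t i) mod int p = (\<Sum>i\<in>S. w i * X t i) mod int p"
          using fun_cong[OF vw(3), of t] t by (simp add: F_def)
        moreover have "[(\<Sum>i\<in>S. lcomb p 1 v (-1) w i * X t i) = (\<Sum>i\<in>S. (1 * v i + (-1) * w i) * X t i)] (mod int p)"
          by (intro cong_sum) (auto simp: lcomb_def cong_def mod_mult_left_eq)
        moreover have "(\<Sum>i\<in>S. (1 * v i + (-1) * w i) * X t i) = (\<Sum>i\<in>S. v i * X t i) - (\<Sum>i\<in>S. w i * X t i)"
          by (simp add: algebra_simps sum_subtractf)
        ultimately show ?thesis unfolding kills_def
          by (metis cong_dvd_iff mod_eq_dvd_iff)
      qed
      thus ?thesis using lcomb_in_mvec[OF p0 vw(1,2)] by (simp add: lker_def)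
    qed
    hence 0: "lcomb p 1 v (-1) w = (\<lambda>_. 0)" using ker by blast
    show "v = w"
    proof
      fix i
      have "(v i - w i) mod int p = 0" using fun_cong[OF 0, of i] by (simp add: lcomb_def)
      hence "v i mod int p = w i mod int p" by (simp add: mod_eq_dvd_iff dvd_eq_mod_eq_0)
      thus "v i = w i" using mod_eq_self vw(1,2) p0 by metis
    qed
  qed
  have sub: "F ` mvec p S \<subseteq> mvec p A" using p0 by (auto simp: F_def mvec_iff[of _ _ A])
  have "F ` mvec p S = mvec p A"
  proof (rule card_subset_eq)
    show "card (F ` mvec p S) = card (mvec p A)" using card_image[OF inj] card_mvec S A by metis
  qed (use sub A in auto)
  moreover have "(\<lambda>t. if t = g j then 1 else 0) \<in> mvec p A" if "j < k" for j
    using gA[OF that] p1 by (auto simp: mvec_iff)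
  ultimately have "\<forall>j<k. \<exists>w. w \<in> mvec p S \<and> F w = (\<lambda>t. if t = g j then 1 else 0)"
    by (metis imageE)
  then obtain W where W: "\<And>j. j < k \<Longrightarrow> F (W j) = (\<lambda>t. if t = g j then 1 else 0)" by metis
  \<comment> \<open>The preimages of the unit vectors are the rows of a left inverse modulo
    \<open>p\<close>, so the determinant is a unit there.\<close>
  define WM where "WM = mat k k (\<lambda>(j,i). W j (f i))"
  have WM: "WM \<in> carrier_mat k k" by (simp add: WM_def)
  have "[det (WM * N) = det (1\<^sub>m k)] (mod int p)"
  proof (rule cong_det)
    fix j l assume jl: "j < k" "l < k"
    have "(WM * N) $$ (j,l) = (\<Sum>i=0..<k. W j (f i) * X (g l) (f i))"
      using jl by (simp add: WM_def N_def scalar_prod_def)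
    also have "\<dots> = (\<Sum>i\<in>S. W j i * X (g l) i)" by (simp add: sumS)
    also have "\<dots> mod int p = F (W j) (g l)" using gA[OF jl(2)] by (simp add: F_def)
    also have "\<dots> = (if g l = g j then 1 else 0)" using W[OF jl(1)] by simp
    also have "\<dots> = (if l = j then 1 else 0)"
      using bij_betw_imp_inj_on[OF g] jl by (auto simp: inj_on_def)
    also have "\<dots> = (1\<^sub>m k $$ (j,l)) mod int p" using jl p1 by auto
    finally show "[(WM * N) $$ (j,l) = 1\<^sub>m k $$ (j,l)] (mod int p)" by (simp add: cong_def)
  qed (use WM N in auto)
  hence c1: "[det WM * det N = 1] (mod int p)" using det_mult[OF WM N] by simp
  show ?thesis
  proof (rule that[of "det N"])
    show "\<not> int p dvd det N"
    proof
      assume "int p dvd det N"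
      hence "int p dvd det WM * det N" by simp
      hence "int p dvd 1" using c1 cong_dvd_iff by blast
      thus False using p1 by simp
    qed
  next
    fix q w assume q: "prime q" and w: "w \<in> lker q S X A" and nd: "\<not> int q dvd det N"
    have q0: "q > 0" using q prime_gt_0_nat by auto
    have wm: "w \<in> mvec q S" using w by (simp add: lker_def)
    \<comment> \<open>Modulo \<open>q\<close> the row vector \<open>w\<close> times \<open>N\<close>
      is 0; multiplying by the adjugate turns this into \<open>det N\<close> times
      \<open>w\<close>.\<close>
    have adj: "adj_mat N \<in> carrier_mat k k" "N * adj_mat N = det N \<cdot>\<^sub>m 1\<^sub>m k" using adj_mat[OF N] by auto
    have "w (f l) = 0" if l: "l < k" for l
    proof -
      have e: "(\<Sum>j=0..<k. N $$ (i,j) * adj_mat N $$ (j,l)) = (if i = l then det N else 0)" if "i < k" for i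
      proof -
        have "(N * adj_mat N) $$ (i,l) = (\<Sum>j=0..<k. N $$ (i,j) * adj_mat N $$ (j,l))"
          using that l N adj(1) by (simp add: scalar_prod_def)
        moreover have "(N * adj_mat N) $$ (i,l) = (if i = l then det N else 0)"
          unfolding adj(2) using that l by simp
        ultimately show ?thesis by metis
      qed
      have "(\<Sum>j=0..<k. (\<Sum>i=0..<k. w (f i) * N $$ (i,j)) * adj_mat N $$ (j,l))
           = (\<Sum>j=0..<k. \<Sum>i=0..<k. w (f i) * (N $$ (i,j) * adj_mat N $$ (j,l)))"
        by (simp add: sum_distrib_right mult.assoc)
      also have "\<dots> = (\<Sum>i=0..<k. \<Sum>j=0..<k. w (f i) * (N $$ (i,j) * adj_mat N $$ (j,l)))"
        by (rule sum.swap)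
      also have "\<dots> = (\<Sum>i=0..<k. w (f i) * (if i = l then det N else 0))"
        by (intro sum.cong refl) (simp add: sum_distrib_left[symmetric] e)
      also have "\<dots> = w (f l) * det N" using l by (simp add: if_distrib[of "(*) _"] cong: if_cong)
      finally have eq: "(\<Sum>j=0..<k. (\<Sum>i=0..<k. w (f i) * N $$ (i,j)) * adj_mat N $$ (j,l)) = w (f l) * det N" .
      have "int q dvd (\<Sum>i=0..<k. w (f i) * N $$ (i,j))" if j: "j < k" for j
      proof -
        have "(\<Sum>i=0..<k. w (f i) * N $$ (i,j)) = (\<Sum>i\<in>S. w i * X (g j) i)"
          using j by (simp add: sumS N_def)
        thus ?thesis using w gA[OF j] by (simp add: lker_def kills_def)
      qed
      hence "int q dvd (\<Sum>j=0..<k. (\<Sum>i=0..<k. w (f i) * N $$ (i,j)) * adj_mat N $$ (j,l))"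
        by (auto intro!: dvd_sum simp del: sum_distrib_right simp: dvd_mult2)
      hence "int q dvd w (f l) * det N" using eq by simp
      hence "int q dvd w (f l)" using nd q by (auto simp: prime_dvd_mult_iff)
      thus ?thesis using mvec_not_dvd[OF wm q0] by blast
    qed
    hence "w i = 0" if "i \<in> S" for i
      using that f by (metis atLeastLessThan_iff bij_betw_imp_surj_on imageE)
    thus "w = (\<lambda>_. 0)" using wm by (auto simp: mvec_iff)
  next
    fix K assume K: "\<And>t i. t \<in> A \<Longrightarrow> i \<in> S \<Longrightarrow> real_of_int \<bar>X t i\<bar> \<le> K"
    show "real_of_int \<bar>det N\<bar> \<le> fact (card S) * K ^ card S"
      unfolding k_def[symmetric] by (rule abs_det_le[OF N]) (use K fS gA in \<open>auto simp: N_def\<close>)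
  next
    fix y :: "_ \<Rightarrow> int"
    have adj: "adj_mat N \<in> carrier_mat k k" "N * adj_mat N = det N \<cdot>\<^sub>m 1\<^sub>m k" using adj_mat[OF N] by auto
    \<comment> \<open>Cramer's rule: the coefficients are the adjugate applied to
      \<open>y\<close>.\<close>
    define c where "c j = (\<Sum>l=0..<k. adj_mat N $$ (j,l) * y (f l))" for j
    define g' where "g' = the_inv_into {0..<k} g"
    have g': "g' (g j) = j" if "j < k" for j
      using that bij_betw_imp_inj_on[OF g] by (simp add: g'_def the_inv_into_f_f)
    have "det N * y (f i) = (\<Sum>j=0..<k. c j * N $$ (i,j))" if i: "i < k" for i
    proof -
      have e: "(\<Sum>j=0..<k. N $$ (i,j) * adj_mat N $$ (j,l)) = (if i = l then det N else 0)" if "l < k" for l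
      proof -
        have "(N * adj_mat N) $$ (i,l) = (\<Sum>j=0..<k. N $$ (i,j) * adj_mat N $$ (j,l))"
          using that i N adj(1) by (simp add: scalar_prod_def)
        moreover have "(N * adj_mat N) $$ (i,l) = (if i = l then det N else 0)"
          unfolding adj(2) using that i by simp
        ultimately show ?thesis by metis
      qed
      have "(\<Sum>j=0..<k. c j * N $$ (i,j)) = (\<Sum>j=0..<k. \<Sum>l=0..<k. (N $$ (i,j) * adj_mat N $$ (j,l)) * y (f l))"
        by (simp add: c_def sum_distrib_right sum_distrib_left mult_ac)
      also have "\<dots> = (\<Sum>l=0..<k. \<Sum>j=0..<k. (N $$ (i,j) * adj_mat N $$ (j,l)) * y (f l))"
        by (rule sum.swap)
      also have "\<dots> = (\<Sum>l=0..<k. (if i = l then det N else 0) * y (f l))"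
        by (intro sum.cong refl) (simp add: sum_distrib_right[symmetric] e)
      also have "\<dots> = det N * y (f i)" using i by (simp add: if_distrib[of "\<lambda>x. x * _"] cong: if_cong)
      finally show ?thesis by simp
    qed
    hence eq: "det N * y (f i) = (\<Sum>t\<in>A. c (g' t) * X t (f i))" if "i < k" for i
      using that by (simp add: sumA g' N_def)
    have "\<forall>i\<in>f ` {0..<k}. det N * y i = (\<Sum>t\<in>A. c (g' t) * X t i)"
      using eq by auto
    hence "\<forall>i\<in>S. det N * y i = (\<Sum>t\<in>A. c (g' t) * X t i)"
      by (simp only: bij_betw_imp_surj_on[OF f])
    thus "\<exists>c. \<forall>i\<in>S. det N * y i = (\<Sum>t\<in>A. c t * X t i)" by (intro exI[of _ "\<lambda>t. c (g' t)"])
  qed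
qed

section \<open>Primes dividing a minor\<close>

text \<open>For a square submatrix these are the primes dividing its determinant. The kernel form is
  free of any ordering of \<open>S\<close> and \<open>A\<close>.\<close>

definition bad_primes :: "'a set \<Rightarrow> ('b \<Rightarrow> 'a \<Rightarrow> int) \<Rightarrow> 'b set \<Rightarrow> nat set" where
  "bad_primes S X A = {q. prime q \<and> lker q S X A \<noteq> {\<lambda>_. 0}}"

text \<open>Distinct primes dividing \<open>D\<close> have a product at most the absolute value of
  \<open>D\<close>, and each of them is at least 2.\<close>

lemma power_card_primes_le:
  fixes D :: int
  assumes "D \<noteq> 0" "\<And>q. q \<in> P \<Longrightarrow> prime q \<and> int q dvd D"
  shows "finite P \<and> 2 ^ card P \<le> \<bar>D\<bar>"
proof -
  define m where "m = nat \<bar>D\<bar>"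
  have m: "m > 0" using assms(1) by (simp add: m_def)
  have "P \<subseteq> prime_factors m"
  proof
    fix q assume q: "q \<in> P"
    have "int q dvd int m" using assms(2)[OF q] by (simp add: m_def)
    thus "q \<in> prime_factors m" using assms(2)[OF q] m by (auto simp: prime_factors_dvd)
  qed
  hence fin: "finite P" and card: "card P \<le> card (prime_factors m)"
    using finite_subset card_mono by (blast, simp add: card_mono)
  have "(2::nat) ^ card P \<le> 2 ^ card (prime_factors m)" using card by simp
  also have "\<dots> = (\<Prod>q\<in>prime_factors m. 2)" by simp
  also have "\<dots> \<le> (\<Prod>q\<in>prime_factors m. q ^ multiplicity q m)"
  proof (intro prod_mono conjI)
    fix q assume q: "q \<in> prime_factors m"
    hence "multiplicity q m > 0" by (simp add: prime_factors_multiplicity)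
    moreover have "q \<ge> 2" using q prime_ge_2_nat by (auto simp: prime_factors_dvd)
    ultimately show "2 \<le> q ^ multiplicity q m" using self_le_power[of q "multiplicity q m"] by linarith
  qed auto
  also have "\<dots> = m" using prime_factorization_nat[OF m] by simp
  finally have "int (2 ^ card P) \<le> int m" by linarith
  thus ?thesis using fin by (simp add: m_def)
qed

text \<open>The prime \<open>p\<close> certifies that the minor is not 0; the size of the minor then
  limits the number of its prime divisors.\<close>

lemma card_bad_primes:
  assumes p: "prime p" and S: "finite S" and A: "finite A" "card A = card S"
    and ker: "lker p S X A = {\<lambda>_. 0}"
    and K: "\<And>t i. t \<in> A \<Longrightarrow> i \<in> S \<Longrightarrow> real_of_int \<bar>X t i\<bar> \<le> K"
  shows "finite (bad_primes S X A)" "2 ^ card (bad_primes S X A) \<le> fact (card S) * K ^ card S"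
proof -
  obtain D where D: "\<not> int p dvd D"
    "\<And>q w. prime q \<Longrightarrow> w \<in> lker q S X A \<Longrightarrow> \<not> int q dvd D \<Longrightarrow> w = (\<lambda>_. 0)"
    "real_of_int \<bar>D\<bar> \<le> fact (card S) * K ^ card S"
  proof (rule minor_ex[OF p S A ker])
    fix D :: int
    assume a: "\<not> int p dvd D"
      and b: "\<And>q w. prime q \<Longrightarrow> w \<in> lker q S X A \<Longrightarrow> \<not> int q dvd D \<Longrightarrow> w = (\<lambda>_. 0)"
      and c: "\<And>K. (\<And>t i. t \<in> A \<Longrightarrow> i \<in> S \<Longrightarrow> real_of_int \<bar>X t i\<bar> \<le> K) \<Longrightarrow> real_of_int \<bar>D\<bar> \<le> fact (card S) * K ^ card S"
    show thesis by (rule that[OF a b c[OF K]])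
  qed
  have "D \<noteq> 0" using D(1) by auto
  moreover have "prime q \<and> int q dvd D" if "q \<in> bad_primes S X A" for q
  proof -
    have q: "prime q" "lker q S X A \<noteq> {\<lambda>_. 0}" using that by (auto simp: bad_primes_def)
    have "(\<lambda>_. 0) \<in> lker q S X A" using msub_lker[of q S X A] q prime_gt_0_nat by (auto simp: msub_def)
    thus ?thesis using q D(2)[OF q(1)] by blast
  qed
  ultimately have *: "finite (bad_primes S X A) \<and> 2 ^ card (bad_primes S X A) \<le> \<bar>D\<bar>"
    by (rule power_card_primes_le)
  thus "finite (bad_primes S X A)" by blast
  have "real_of_int (2 ^ card (bad_primes S X A)) \<le> real_of_int \<bar>D\<bar>" using * of_int_le_iff by blast
  thus "2 ^ card (bad_primes S X A) \<le> fact (card S) * K ^ card S" using D(3) by simp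
qed

section \<open>From all primes to the integers\<close>

text \<open>\<open>I\<close> is a subgroup of the integers, hence consists of multiples of its least
  positive element; a prime factor of that element would divide all of \<open>I\<close>.\<close>

lemma one_mem_of_no_prime:
  fixes I :: "int set"
  assumes diff: "\<And>a b. a \<in> I \<Longrightarrow> b \<in> I \<Longrightarrow> a - b \<in> I"
    and pr: "\<And>p. prime (p::nat) \<Longrightarrow> \<exists>c\<in>I. \<not> int p dvd c"
  shows "1 \<in> I"
proof -
  have 0: "0 \<in> I" using pr[OF two_is_prime_nat] diff by force
  have neg: "- a \<in> I" if "a \<in> I" for a using diff[OF 0 that] by simp
  have add: "a + b \<in> I" if "a \<in> I" "b \<in> I" for a b using diff[OF that(1) neg[OF that(2)]] by simp
  have multn: "int k * a \<in> I" if "a \<in> I" for a k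
    by (induction k) (use 0 that add in \<open>auto simp: algebra_simps\<close>)
  have mult: "k * a \<in> I" if "a \<in> I" for a k
    using multn[OF that, of "nat \<bar>k\<bar>"] neg[of "int (nat \<bar>k\<bar>) * a"] by (cases "k \<ge> 0") auto
  obtain c where c: "c \<in> I" "\<not> int 2 dvd c" using pr[OF two_is_prime_nat] by blast
  have "\<bar>c\<bar> \<in> I" using c neg by (auto simp: abs_if)
  hence "\<exists>g::nat. g > 0 \<and> int g \<in> I" using c by (intro exI[of _ "nat \<bar>c\<bar>"]) auto
  define g :: nat where "g = (LEAST g. g > 0 \<and> int g \<in> I)"
  have g: "g > 0" "int g \<in> I" using LeastI_ex[OF \<open>\<exists>g. _ g\<close>] by (auto simp: g_def)
  have least: "g \<le> h" if "h > 0" "int h \<in> I" for h using that by (auto simp: g_def intro: Least_le)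
  have div: "int g dvd a" if "a \<in> I" for a
  proof -
    have "a mod int g = a - (a div int g) * int g" by (simp add: minus_div_mult_eq_mod)
    hence m: "a mod int g \<in> I" using diff[OF that mult[OF g(2)]] by simp
    have "a mod int g \<ge> 0" "a mod int g < int g" using g by auto
    hence "nat (a mod int g) = 0" using least[of "nat (a mod int g)"] m by fastforce
    thus ?thesis using \<open>a mod int g \<ge> 0\<close> by auto
  qed
  have "g = 1"
  proof (rule ccontr)
    assume "g \<noteq> 1"
    then obtain q where q: "prime q" "q dvd g" using prime_factor_nat by blast
    obtain c where "c \<in> I" "\<not> int q dvd c" using pr[OF q(1)] by blast
    thus False using div q(2) by (metis dvd_trans int_dvd_int_iff)
  qed
  thus ?thesis using g by simp
qed

text \<open>Fix a target vector \<open>x\<close>. The integers \<open>c\<close> for which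
  \<open>c\<close> times \<open>x\<close> lies in the column lattice form a subgroup. For each
  \<open>p\<close>, Cramer's rule on a square submatrix invertible modulo \<open>p\<close> puts a
  determinant prime to \<open>p\<close> into it, so it contains 1.\<close>

lemma trivial_cokernel:
  assumes M: "M \<in> carrier_mat n N" and X: "\<And>t i. t < N \<Longrightarrow> i < n \<Longrightarrow> X t i = M $$ (i,t)"
    and ker: "\<And>p. prime p \<Longrightarrow> lker p {..<n} X {..<N} = {\<lambda>_. 0}"
  shows "trivial_group (cokernel M)"
proof -
  define L where "L = (\<lambda>v. M *\<^sub>v v) ` carrier_vec N"
  have Lsub: "L \<subseteq> carrier_vec n" using M by (auto simp: L_def)
  have diffL: "a - b \<in> L" if "a \<in> L" "b \<in> L" for a b
  proof -
    obtain v w where "a = M *\<^sub>v v" "b = M *\<^sub>v w" "v \<in> carrier_vec N" "w \<in> carrier_vec N"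
      using \<open>a \<in> L\<close> \<open>b \<in> L\<close> by (auto simp: L_def)
    thus ?thesis using mult_minus_distrib_mat_vec[OF M, of v w] by (auto simp: L_def intro!: image_eqI[of _ _ "v - w"])
  qed
  have "x \<in> L" if x: "x \<in> carrier_vec n" for x
  proof -
    have "1 \<in> {c. c \<cdot>\<^sub>v x \<in> L}"
    proof (rule one_mem_of_no_prime)
      fix a b assume "a \<in> {c. c \<cdot>\<^sub>v x \<in> L}" "b \<in> {c. c \<cdot>\<^sub>v x \<in> L}"
      hence "a \<cdot>\<^sub>v x - b \<cdot>\<^sub>v x \<in> L" using diffL by auto
      thus "a - b \<in> {c. c \<cdot>\<^sub>v x \<in> L}" 
      proof -
        have "(a - b) \<cdot>\<^sub>v x = a \<cdot>\<^sub>v x - b \<cdot>\<^sub>v x" using x by (intro eq_vecI) (auto simp: algebra_simps)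
        thus ?thesis using \<open>a \<cdot>\<^sub>v x - b \<cdot>\<^sub>v x \<in> L\<close> by simp
      qed
    next
      fix p :: nat assume p: "prime p"
      obtain C where C: "C \<subseteq> {..<N}" "lker p {..<n} X C = {\<lambda>_. 0}" "card (lker p {..<n} X C) * p ^ card C = p ^ card {..<n}"
        using lker_choose_columns[OF p, of "{..<n}" "{..<N}" X] ker[OF p] by auto
      have cC: "card C = card {..<n}"
        using C p prime_gt_1_nat[OF p] by (auto simp: power_inject_exp)
      have fC: "finite C" using C finite_subset by blast
      obtain D where D: "\<not> int p dvd D" "\<And>y. \<exists>c. \<forall>i\<in>{..<n}. D * y i = (\<Sum>t\<in>C. c t * X t i)"
      proof (rule minor_ex[OF p _ fC cC C(2)])
        fix D :: int
        assume a: "\<not> int p dvd D" and b: "\<And>y. \<exists>c. \<forall>i\<in>{..<n}. D * y i = (\<Sum>t\<in>C. c t * X t i)"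
        show thesis by (rule that[OF a b])
      qed auto
      obtain c where c: "\<forall>i\<in>{..<n}. D * x $ i = (\<Sum>t\<in>C. c t * X t i)" using D(2)[of "\<lambda>i. x $ i"] by blast
      define v where "v = vec N (\<lambda>t. if t \<in> C then c t else 0)"
      have "D \<cdot>\<^sub>v x = M *\<^sub>v v"
      proof (rule eq_vecI)
        fix i assume "i < dim_vec (M *\<^sub>v v)"
        hence i: "i < n" using M by simp
        have "(M *\<^sub>v v) $ i = (\<Sum>t=0..<N. M $$ (i,t) * (if t \<in> C then c t else 0))"
          using i M by (simp add: scalar_prod_def v_def)
        also have "\<dots> = (\<Sum>t\<in>C. M $$ (i,t) * c t)"
          using C(1) by (intro sum.mono_neutral_cong_right) (auto simp: lessThan_atLeast0)
        also have "\<dots> = (\<Sum>t\<in>C. c t * X t i)"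
          using C(1) X i by (intro sum.cong) auto
        also have "\<dots> = D * x $ i" using c i by simp
        finally show "(D \<cdot>\<^sub>v x) $ i = (M *\<^sub>v v) $ i" using i x by simp
      qed (use M x in auto)
      moreover have "v \<in> carrier_vec N" by (simp add: v_def)
      ultimately show "\<exists>c\<in>{c. c \<cdot>\<^sub>v x \<in> L}. \<not> int p dvd c" using D(1) by (auto simp: L_def)
    qed
    thus ?thesis by simp
  qed
  hence L: "L = carrier_vec n" using Lsub by blast
  have ck: "cokernel M = monoid_vec TYPE(int) n Mod carrier (monoid_vec TYPE(int) n)"
    using L M by (simp add: cokernel_def L_def monoid_vec_simps)
  have dims: "comm_group (monoid_vec TYPE(int) n)"
  proof (rule comm_groupI)
    fix x assume "x \<in> carrier (monoid_vec TYPE(int) n)"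
    thus "\<exists>y\<in>carrier (monoid_vec TYPE(int) n). y \<otimes>\<^bsub>monoid_vec TYPE(int) n\<^esub> x = \<one>\<^bsub>monoid_vec TYPE(int) n\<^esub>"
      by (intro bexI[of _ "- x"]) (auto simp: monoid_vec_simps)
  qed (auto simp: monoid_vec_simps)
  let ?G = "monoid_vec TYPE(int) n"
  interpret G: comm_group ?G by (rule dims)
  interpret N: normal "carrier ?G" ?G by (rule G.subgroup_imp_normal[OF G.subgroup_self])
  have "carrier (?G Mod carrier ?G) \<subseteq> {carrier ?G}"
    using G.coset_join2[OF _ G.subgroup_self] by (auto simp: FactGroup_def RCOSETS_def)
  hence "trivial_group (?G Mod carrier ?G)"
    using group.trivial_group_subset[OF N.factorgroup_is_group] by (simp add: FactGroup_def)
  thus ?thesis using ck by simp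
qed

section \<open>Fourier analysis and a Halasz bound\<close>

definition fou :: "nat \<Rightarrow> int pmf \<Rightarrow> int \<Rightarrow> complex" where
  "fou p \<xi> t = measure_pmf.expectation \<xi> (\<lambda>x. cis (2 * pi * (t * x) / p))"

text \<open>The \<open>q\<close> of the overview: the cost of one unit of codimension when
  \<open>l\<close> disjoint blocks are available.\<close>

definition qmean :: "nat \<Rightarrow> int pmf \<Rightarrow> nat \<Rightarrow> real" where
  "qmean p \<xi> l = (\<Sum>t\<in>{0..<int p}. cmod (fou p \<xi> t) ^ l) / p"

lemma cis_int_mult_eq_1_iff:
  assumes "p > 0"
  shows "cis (2 * pi * of_int a / real p) = 1 \<longleftrightarrow> int p dvd a"
proof -
  have "2 * pi * of_int a / real p = of_int n * (2 * pi) \<longleftrightarrow> a = n * int p" for n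
  proof -
    have "2 * pi * of_int a / real p = of_int n * (2 * pi) \<longleftrightarrow> real_of_int a = real_of_int (n * int p)"
      using assms by (simp add: field_simps)
    thus ?thesis by (simp only: of_int_eq_iff)
  qed
  thus ?thesis by (auto simp: cis_eq_1_iff dvd_def mult.commute)
qed

lemma cis_periodic_mod:
  assumes "p > 0" "[a = b] (mod int p)"
  shows "cis (2 * pi * of_int a / real p) = cis (2 * pi * of_int b / real p)"
proof -
  have "cis (2 * pi * of_int a / real p) = cis (2 * pi * of_int b / real p) * cis (2 * pi * of_int (a - b) / real p)"
  proof -
    have "2 * pi * of_int b / real p + 2 * pi * of_int (a - b) / real p = 2 * pi * of_int a / real p"
      by (simp add: add_divide_distrib[symmetric] algebra_simps)
    thus ?thesis by (simp only: cis_mult)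
  qed
  also have "cis (2 * pi * of_int (a - b) / real p) = 1"
    using assms by (subst cis_int_mult_eq_1_iff) (auto simp: cong_iff_dvd_diff)
  finally show ?thesis by simp
qed

lemma integrable_cis_pmf [simp]: "integrable (measure_pmf p) (\<lambda>x. cis (f x))"
  by (rule measure_pmf.integrable_const_bound[where B = 1]) auto

lemma cmod_fou_le_1: "cmod (fou p \<xi> t) \<le> 1"
proof -
  have "cmod (fou p \<xi> t) \<le> measure_pmf.expectation \<xi> (\<lambda>x. cmod (cis (2 * pi * (t * x) / p)))"
    unfolding fou_def by (rule integral_norm_bound)
  thus ?thesis by simp
qed

lemma cis_sum: "finite S \<Longrightarrow> cis (\<Sum>i\<in>S. f i) = (\<Prod>i\<in>S. cis (f i))"
  by (induction S rule: finite_induct) (auto simp: cis_mult[symmetric])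

section \<open>Probability that a random column kills a subspace\<close>

lemma expectation_prod_cis:
  fixes f :: "'a \<Rightarrow> int \<Rightarrow> real"
  assumes S: "finite S"
  shows "measure_pmf.expectation (Pi_pmf S d (\<lambda>_. \<xi>)) (\<lambda>y. \<Prod>i\<in>S. cis (f i (y i)))
     = (\<Prod>i\<in>S. measure_pmf.expectation \<xi> (\<lambda>x. cis (f i x)))"
proof -
  have "measure_pmf.expectation (Pi_pmf S d (\<lambda>_. \<xi>)) (\<lambda>y. \<Prod>i\<in>S. cis (f i (y i)))
     = (\<Prod>i\<in>S. measure_pmf.expectation (Pi_pmf S d (\<lambda>_. \<xi>)) (\<lambda>y. cis (f i (y i))))"
  proof (rule prob_space.indep_vars_lebesgue_integral)
    show "prob_space (measure_pmf (Pi_pmf S d (\<lambda>_. \<xi>)))" by (rule measure_pmf.prob_space_axioms)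
    have "prob_space.indep_vars (measure_pmf (Pi_pmf S d (\<lambda>_. \<xi>))) (\<lambda>_. count_space UNIV) (\<lambda>x f. f x) S"
      by (rule indep_vars_Pi_pmf[OF S])
    hence "prob_space.indep_vars (measure_pmf (Pi_pmf S d (\<lambda>_. \<xi>))) (\<lambda>_. borel) (\<lambda>i y. (\<lambda>x. cis (f i x)) (y i)) S"
      by (rule prob_space.indep_vars_compose2[OF measure_pmf.prob_space_axioms]) auto
    thus "prob_space.indep_vars (measure_pmf (Pi_pmf S d (\<lambda>_. \<xi>))) (\<lambda>_. borel) (\<lambda>i y. cis (f i (y i))) S" by simp
  qed (use S in auto)
  also have "\<dots> = (\<Prod>i\<in>S. measure_pmf.expectation \<xi> (\<lambda>x. cis (f i x)))"
  proof (rule prod.cong[OF refl])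
    fix i assume i: "i \<in> S"
    have "measure_pmf.expectation (Pi_pmf S d (\<lambda>_. \<xi>)) (\<lambda>y. cis (f i (y i)))
        = measure_pmf.expectation (map_pmf (\<lambda>y. y i) (Pi_pmf S d (\<lambda>_. \<xi>))) (\<lambda>x. cis (f i x))" by simp
    thus "measure_pmf.expectation (Pi_pmf S d (\<lambda>_. \<xi>)) (\<lambda>y. cis (f i (y i))) = measure_pmf.expectation \<xi> (\<lambda>x. cis (f i x))"
      using Pi_pmf_component[OF S, of i d "\<lambda>_. \<xi>"] i by simp
  qed
  finally show ?thesis .
qed

text \<open>Orthogonality of characters: if \<open>y\<close> does not kill \<open>u\<close>,
  translating the sum by \<open>u\<close> multiplies it by a root of unity different from 1.\<close>

lemma sum_cis_msub:
  assumes V: "msub p S V" and S: "finite S" and p: "p > 0"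
  shows "(\<Sum>w\<in>V. cis (2 * pi * of_int (\<Sum>i\<in>S. w i * y i) / p)) = (if \<forall>w\<in>V. kills p S y w then of_nat (card V) else 0)"
proof (cases "\<forall>w\<in>V. kills p S y w")
  case True
  hence "cis (2 * pi * of_int (\<Sum>i\<in>S. w i * y i) / p) = 1" if "w \<in> V" for w
    using that p by (subst cis_int_mult_eq_1_iff) (auto simp: kills_def)
  thus ?thesis using True by simp
next
  case False
  then obtain u where u: "u \<in> V" "\<not> kills p S y u" by blast
  define e where "e w = cis (2 * pi * of_int (\<Sum>i\<in>S. w i * y i) / p)" for w
  have e_add: "e (lcomb p 1 w a u) = e w * cis (2 * pi * of_int (a * (\<Sum>i\<in>S. u i * y i)) / p)" for w a
  proof -
    have "[(\<Sum>i\<in>S. lcomb p 1 w a u i * y i) = (\<Sum>i\<in>S. (1 * w i + a * u i) * y i)] (mod int p)"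
      by (intro cong_sum) (auto simp: lcomb_def cong_def mod_mult_left_eq)
    also have "(\<Sum>i\<in>S. (1 * w i + a * u i) * y i) = (\<Sum>i\<in>S. w i * y i) + a * (\<Sum>i\<in>S. u i * y i)"
      by (simp add: algebra_simps sum.distrib sum_distrib_left)
    finally have "e (lcomb p 1 w a u) = cis (2 * pi * of_int ((\<Sum>i\<in>S. w i * y i) + a * (\<Sum>i\<in>S. u i * y i)) / p)"
      unfolding e_def by (intro cis_periodic_mod p)
    thus ?thesis by (simp only: e_def cis_mult of_int_add distrib_left add_divide_distrib)
  qed
  have inv: "lcomb p 1 (lcomb p 1 w a u) (-a) u = w" if "w \<in> V" for w a
  proof
    fix i
    have wm: "w \<in> mvec p S" using that V by (auto simp: msub_def)
    have "((w i + a * u i) mod int p + (- a) * u i) mod int p = ((w i + a * u i) + (- a) * u i) mod int p"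
      by (metis mod_add_left_eq)
    also have "\<dots> = w i" using mod_eq_self[OF wm p, of i] by simp
    finally show "lcomb p 1 (lcomb p 1 w a u) (-a) u i = w i" by (simp add: lcomb_def)
  qed
  have "bij_betw (\<lambda>w. lcomb p 1 w 1 u) V V"
    by (rule bij_betw_byWitness[where f' = "\<lambda>w. lcomb p 1 w (-1) u"])
       (use V u inv[of _ 1] inv[of _ "-1"] in \<open>auto simp: msub_def\<close>)
  hence "(\<Sum>w\<in>V. e w) = (\<Sum>w\<in>V. e (lcomb p 1 w 1 u))" by (rule sum.reindex_bij_betw[symmetric])
  also have "\<dots> = (\<Sum>w\<in>V. e w) * cis (2 * pi * of_int (\<Sum>i\<in>S. u i * y i) / p)"
    unfolding e_add by (simp add: sum_distrib_right)
  finally have "(\<Sum>w\<in>V. e w) * (1 - cis (2 * pi * of_int (\<Sum>i\<in>S. u i * y i) / p)) = 0" by (simp add: algebra_simps)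
  moreover have "cis (2 * pi * of_int (\<Sum>i\<in>S. u i * y i) / p) \<noteq> 1"
    using u(2) p by (subst cis_int_mult_eq_1_iff) (auto simp: kills_def)
  ultimately have "(\<Sum>w\<in>V. e w) = 0" by simp
  thus ?thesis by (simp only: e_def False if_False)
qed

text \<open>Taking expectations in the character sum turns its terms into products of Fourier
  coefficients, by independence of the coordinates; then the triangle inequality applies.\<close>

lemma prob_kills_le:
  assumes V: "msub p S V" and S: "finite S" and p: "p > 0"
  shows "measure_pmf.prob (Pi_pmf S 0 (\<lambda>_. \<xi>)) {y. \<forall>w\<in>V. kills p S y w} * card V \<le> (\<Sum>w\<in>V. \<Prod>i\<in>S. cmod (fou p \<xi> (w i)))"
proof -
  let ?P = "Pi_pmf S 0 (\<lambda>_. \<xi>)"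
  have fV: "finite V" using finite_msub[OF S V] .
  have "complex_of_real (measure_pmf.prob ?P {y. \<forall>w\<in>V. kills p S y w} * card V)
      = measure_pmf.expectation ?P (\<lambda>y. complex_of_real ((indicator {y. \<forall>w\<in>V. kills p S y w} y :: real) * card V))"
    by (simp only: integral_complex_of_real) (simp)
  also have "\<dots> = measure_pmf.expectation ?P (\<lambda>y. \<Sum>w\<in>V. cis (2 * pi * of_int (\<Sum>i\<in>S. w i * y i) / p))"
    by (intro Bochner_Integration.integral_cong refl) (simp only: sum_cis_msub[OF V S p], simp add: indicator_def)
  also have "\<dots> = (\<Sum>w\<in>V. measure_pmf.expectation ?P (\<lambda>y. cis (2 * pi * of_int (\<Sum>i\<in>S. w i * y i) / p)))"
    by (rule Bochner_Integration.integral_sum) simp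
  also have "\<dots> = (\<Sum>w\<in>V. \<Prod>i\<in>S. fou p \<xi> (w i))"
  proof (intro sum.cong refl)
    fix w
    have "cis (2 * pi * of_int (\<Sum>i\<in>S. w i * y i) / p) = (\<Prod>i\<in>S. cis (2 * pi * (w i * y i) / p))" for y
      by (subst cis_sum[symmetric]) (use S in \<open>auto simp: sum_distrib_left sum_divide_distrib\<close>)
    thus "measure_pmf.expectation ?P (\<lambda>y. cis (2 * pi * of_int (\<Sum>i\<in>S. w i * y i) / p)) = (\<Prod>i\<in>S. fou p \<xi> (w i))"
      using expectation_prod_cis[OF S, of 0 \<xi> "\<lambda>i x. 2 * pi * (w i * x) / p"] by (simp add: fou_def)
  qed
  finally have eq: "complex_of_real (measure_pmf.prob ?P {y. \<forall>w\<in>V. kills p S y w} * card V) = (\<Sum>w\<in>V. \<Prod>i\<in>S. fou p \<xi> (w i))" .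
  have "\<bar>measure_pmf.prob ?P {y. \<forall>w\<in>V. kills p S y w} * card V\<bar> = cmod (\<Sum>w\<in>V. \<Prod>i\<in>S. fou p \<xi> (w i))"
    using arg_cong[OF eq, of cmod] by (simp only: norm_of_real)
  hence "measure_pmf.prob ?P {y. \<forall>w\<in>V. kills p S y w} * card V = cmod (\<Sum>w\<in>V. \<Prod>i\<in>S. fou p \<xi> (w i))"
    by (simp add: abs_mult)
  also have "\<dots> \<le> (\<Sum>w\<in>V. cmod (\<Prod>i\<in>S. fou p \<xi> (w i)))" by (rule norm_sum)
  finally show ?thesis by (simp add: prod_norm)
qed

lemma prod_le_mean_power:
  fixes f :: "nat \<Rightarrow> real"
  assumes "l > 0" "\<And>j. j < l \<Longrightarrow> f j \<ge> 0"
  shows "(\<Prod>j<l. f j) \<le> (\<Sum>j<l. f j ^ l) / l"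
proof -
  have "(\<Prod>j<l. f j) = (\<Prod>j<l. f j ^ l) powr (1 / l)"
  proof -
    have "(\<Prod>j<l. f j ^ l) powr (1 / l) = ((\<Prod>j<l. f j) ^ l) powr (1 / l)" by (simp add: prod_power_distrib)
    also have "\<dots> = (\<Prod>j<l. f j)"
    proof (cases "(\<Prod>j<l. f j) = 0")
      case False
      hence pos: "(\<Prod>j<l. f j) > 0" using prod_nonneg[of "{..<l}" f] assms(2) by (simp add: less_le)
      have "((\<Prod>j<l. f j) ^ l) powr (1 / l) = (\<Prod>j<l. f j) powr (real l * (1 / l))"
        by (simp only: powr_realpow[OF pos, symmetric] powr_powr)
      thus ?thesis using assms(1) pos by simp
    next
      case True
      show ?thesis unfolding True using assms(1) by (simp add: zero_power)
    qed
    finally show ?thesis by simp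
  qed
  also have "\<dots> \<le> (\<Sum>j<l. f j ^ l / card {..<l})"
    using arith_geom_mean[of "{..<l}" "\<lambda>j. f j ^ l"] assms by auto
  finally show ?thesis by (simp add: sum_divide_distrib)
qed

text \<open>A Halasz type bound. The \<open>l\<close> disjoint information sets are decoupled by the AM-GM inequality.\<close>
lemma prob_kills_subspace_eq:
  assumes V: "msub p S V" and S: "finite S" and p: "prime p" and d: "card V = p ^ d"
    and s: "\<And>v. v \<in> V \<Longrightarrow> v \<noteq> (\<lambda>_. 0) \<Longrightarrow> card (supp v) \<ge> s" and l: "(l - 1) * d < s" "l > 0"
  shows "measure_pmf.prob (Pi_pmf S 0 (\<lambda>_. \<xi>)) {y. \<forall>w\<in>V. kills p S y w} \<le> qmean p \<xi> l ^ d"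
proof -
  have p0: "p > 0" and p1: "p > 1" using p prime_gt_0_nat prime_gt_1_nat by auto
  obtain Bs where Bs: "\<And>j. j < l \<Longrightarrow> Bs j \<subseteq> S" "\<And>j. j < l \<Longrightarrow> info p V (Bs j)" "disjoint_family_on Bs {..<l}"
    using info_blocks[OF V p S d s l(1)] by blast
  have fB: "finite (Bs j)" if "j < l" for j using Bs(1)[OF that] S finite_subset by blast
  have cB: "card (Bs j) = d" if "j < l" for j
    using info_card[OF Bs(2)[OF that] fB[OF that]] d p1 by (simp add: power_inject_exp)
  define g where "g t = cmod (fou p \<xi> t)" for t
  have g: "0 \<le> g t" "g t \<le> 1" for t by (auto simp: g_def cmod_fou_le_1)
  \<comment> \<open>On an information set the coordinates of a vector of \<open>V\<close> run freely
    over all residues, so the sum over \<open>V\<close> factors into \<open>d\<close> equal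
    sums.\<close>
  have block: "(\<Sum>w\<in>V. \<Prod>i\<in>Bs j. g (w i) ^ l) = (\<Sum>t\<in>{0..<int p}. g t ^ l) ^ d" if j: "j < l" for j
  proof -
    have "(\<Sum>w\<in>V. \<Prod>i\<in>Bs j. g (w i) ^ l) = (\<Sum>w\<in>V. \<Prod>i\<in>Bs j. g (restr (Bs j) w i) ^ l)"
      by (intro sum.cong prod.cong refl) (auto simp: restr_def)
    also have "\<dots> = (\<Sum>w\<in>mvec p (Bs j). \<Prod>i\<in>Bs j. g (w i) ^ l)"
      using Bs(2)[OF j] unfolding info_def by (rule sum.reindex_bij_betw)
    also have "mvec p (Bs j) = (\<lambda>h x. if x \<in> Bs j then h x else 0) ` PiE (Bs j) (\<lambda>_. {0..<int p})"
      by (simp add: mvec_def dflt_image_PiE)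
    also have "(\<Sum>w\<in>\<dots>. \<Prod>i\<in>Bs j. g (w i) ^ l) = (\<Sum>w\<in>PiE (Bs j) (\<lambda>_. {0..<int p}). \<Prod>i\<in>Bs j. g (w i) ^ l)"
      by (subst sum.reindex) (fastforce simp: inj_on_def PiE_def extensional_def fun_eq_iff)+
    also have "\<dots> = (\<Prod>i\<in>Bs j. \<Sum>t\<in>{0..<int p}. g t ^ l)"
      by (rule prod_sum_PiE[symmetric]) (use fB[OF j] in auto)
    also have "\<dots> = (\<Sum>t\<in>{0..<int p}. g t ^ l) ^ d" using cB[OF j] by simp
    finally show ?thesis .
  qed
  have "measure_pmf.prob (Pi_pmf S 0 (\<lambda>_. \<xi>)) {y. \<forall>w\<in>V. kills p S y w} * card V \<le> (\<Sum>w\<in>V. \<Prod>i\<in>S. g (w i))"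
    unfolding g_def by (rule prob_kills_le[OF V S p0])
  also have "\<dots> \<le> (\<Sum>w\<in>V. (\<Sum>j<l. \<Prod>i\<in>Bs j. g (w i) ^ l) / l)"
  proof (rule sum_mono)
    fix w
    have "(\<Prod>i\<in>S. g (w i)) \<le> (\<Prod>i\<in>(\<Union>j<l. Bs j). g (w i))"
    proof -
      have sub: "(\<Union>j<l. Bs j) \<subseteq> S" using Bs(1) by auto
      have "(\<Prod>i\<in>S. g (w i)) = (\<Prod>i\<in>S - (\<Union>j<l. Bs j). g (w i)) * (\<Prod>i\<in>(\<Union>j<l. Bs j). g (w i))"
        by (rule prod.subset_diff[OF sub S])
      also have "\<dots> \<le> 1 * (\<Prod>i\<in>(\<Union>j<l. Bs j). g (w i))"
        by (intro mult_right_mono prod_le_1 prod_nonneg) (use g in auto)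
      finally show ?thesis by simp
    qed
    also have "\<dots> = (\<Prod>j<l. \<Prod>i\<in>Bs j. g (w i))"
      by (rule prod.UNION_disjoint) (use fB Bs(3) in \<open>auto simp: disjoint_family_on_def\<close>)
    also have "\<dots> \<le> (\<Sum>j<l. (\<Prod>i\<in>Bs j. g (w i)) ^ l) / l"
      by (rule prod_le_mean_power) (use g l in \<open>auto intro!: prod_nonneg\<close>)
    also have "\<dots> = (\<Sum>j<l. \<Prod>i\<in>Bs j. g (w i) ^ l) / l" by (simp add: prod_power_distrib)
    finally show "(\<Prod>i\<in>S. g (w i)) \<le> (\<Sum>j<l. \<Prod>i\<in>Bs j. g (w i) ^ l) / l" .
  qed
  also have "\<dots> = (\<Sum>j<l. \<Sum>w\<in>V. \<Prod>i\<in>Bs j. g (w i) ^ l) / l"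
    by (simp add: sum_divide_distrib[symmetric] sum.swap[of _ V])
  also have "\<dots> = (\<Sum>t\<in>{0..<int p}. g t ^ l) ^ d" using l by (simp add: block)
  also have "\<dots> = qmean p \<xi> l ^ d * card V" using p0 by (simp add: qmean_def g_def d power_divide)
  finally show ?thesis using d p0 by simp
qed

lemma qmean_nonneg: "qmean p \<xi> l \<ge> 0"
  by (simp add: qmean_def sum_nonneg)

text \<open>A subspace of dimension exactly \<open>d\<close> inherits the lower bound on supports,
  and a column killing \<open>V\<close> kills it. This is what permits a capped codimension.\<close>

lemma prob_kills_subspace:
  assumes V: "msub p S V" and S: "finite S" and p: "prime p" and d: "p ^ d \<le> card V"
    and s: "\<And>v. v \<in> V \<Longrightarrow> v \<noteq> (\<lambda>_. 0) \<Longrightarrow> card (supp v) \<ge> s" and l: "(l - 1) * d < s" "l > 0"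
  shows "measure_pmf.prob (Pi_pmf S 0 (\<lambda>_. \<xi>)) {y. \<forall>w\<in>V. kills p S y w} \<le> qmean p \<xi> l ^ d"
proof -
  obtain W where W: "W \<subseteq> V" "msub p S W" "card W = p ^ d" using msub_subspace[OF V p S d] by blast
  have "measure_pmf.prob (Pi_pmf S 0 (\<lambda>_. \<xi>)) {y. \<forall>w\<in>V. kills p S y w} \<le>
        measure_pmf.prob (Pi_pmf S 0 (\<lambda>_. \<xi>)) {y. \<forall>w\<in>W. kills p S y w}"
    by (intro measure_pmf.finite_measure_mono) (use W in auto)
  also have "\<dots> \<le> qmean p \<xi> l ^ d" by (rule prob_kills_subspace_eq[OF W(2) S p W(3)]) (use W s l in auto)
  finally show ?thesis .
qed

section \<open>Estimates for the Fourier averages\<close>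

text \<open>Fourier formula for the probability that the simple random walk on the residues modulo
  \<open>p\<close>, in continuous time with jump rate 1, is at its starting point at time
  \<open>y\<close>.\<close>

definition Theta :: "nat \<Rightarrow> real \<Rightarrow> real" where
  "Theta p y = (\<Sum>t\<in>{0..<int p}. exp (- y * (1 - cos (2 * pi * t / p)))) / p"

lemma Theta_antimono: "x \<le> y \<Longrightarrow> Theta p y \<le> Theta p x"
  unfolding Theta_def by (intro divide_right_mono sum_mono) (auto intro!: mult_right_mono)

lemma bij_betw_mult_mod:
  assumes "prime p" "\<not> int p dvd c"
  shows "bij_betw (\<lambda>t. (t * c) mod int p) {0..<int p} {0..<int p}"
proof -
  have p0: "p > 0" using assms(1) prime_gt_0_nat by auto
  have "inj_on (\<lambda>t. (t * c) mod int p) {0..<int p}"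
  proof (rule inj_onI)
    fix s t assume st: "s \<in> {0..<int p}" "t \<in> {0..<int p}" "(s * c) mod int p = (t * c) mod int p"
    hence "int p dvd (s - t) * c" by (simp add: mod_eq_dvd_iff left_diff_distrib)
    hence "int p dvd s - t" using assms by (simp add: prime_dvd_mult_iff)
    hence "s mod int p = t mod int p" by (simp add: mod_eq_dvd_iff)
    thus "s = t" using st by simp
  qed
  moreover have "(\<lambda>t. (t * c) mod int p) ` {0..<int p} \<subseteq> {0..<int p}" using p0 by auto
  ultimately show ?thesis
    by (simp add: bij_betw_def endo_inj_surj)
qed

lemma cos_periodic_mod:
  assumes "p > 0" "[a = b] (mod int p)"
  shows "cos (2 * pi * of_int a / real p) = cos (2 * pi * of_int b / real p)"
  using arg_cong[OF cis_periodic_mod[OF assms], of Re] by simp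

text \<open>Multiplication by \<open>c\<close> permutes the residues, so all nonzero differences of
  values of \<open>\<xi>\<close> give the same average.\<close>

lemma sum_exp_cos_mult:
  assumes "prime p" "\<not> int p dvd c"
  shows "(\<Sum>t\<in>{0..<int p}. exp (- y * (1 - cos (2 * pi * of_int (t * c) / p)))) = p * Theta p y"
proof -
  have p0: "p > 0" using assms(1) prime_gt_0_nat by auto
  have "(\<Sum>t\<in>{0..<int p}. exp (- y * (1 - cos (2 * pi * of_int (t * c) / p))))
     = (\<Sum>t\<in>{0..<int p}. exp (- y * (1 - cos (2 * pi * of_int ((t * c) mod int p) / p))))"
    by (intro sum.cong refl arg_cong[of _ _ exp] arg_cong2[of _ _ _ _ "(*)"] arg_cong2[of _ _ _ _ "(-)"] cos_periodic_mod[OF p0]) (simp add: cong_def)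
  also have "\<dots> = (\<Sum>t\<in>{0..<int p}. exp (- y * (1 - cos (2 * pi * t / p))))"
    by (rule sum.reindex_bij_betw[OF bij_betw_mult_mod[OF assms]])
  finally show ?thesis using p0 by (simp add: Theta_def)
qed

section \<open>Comparison of the Fourier averages with Theta\<close>

definition rmass :: "nat \<Rightarrow> int pmf \<Rightarrow> int \<Rightarrow> real" where
  "rmass p \<xi> r = measure_pmf.prob \<xi> {x. [x = r] (mod int p)}"

lemma rmass_pmf:
  assumes "p > 0" "r \<in> {0..<int p}"
  shows "rmass p \<xi> r = pmf (map_pmf (\<lambda>x. x mod int p) \<xi>) r"
  unfolding rmass_def pmf_map using assms by (intro arg_cong[of _ _ "measure_pmf.prob \<xi>"]) (auto simp: cong_def)

lemma sum_rmass: "p > 0 \<Longrightarrow> (\<Sum>r\<in>{0..<int p}. rmass p \<xi> r) = 1"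
  by (simp add: rmass_pmf) (rule sum_pmf_eq_1; auto)

lemma fou_rmass:
  assumes "p > 0"
  shows "fou p \<xi> t = (\<Sum>r\<in>{0..<int p}. rmass p \<xi> r * cis (2 * pi * (t * r) / p))"
proof -
  have c: "cis (2 * pi * of_int (t * x) / p) = cis (2 * pi * of_int (t * (x mod int p)) / p)" for x
    using assms by (intro cis_periodic_mod) (auto simp: cong_def mod_mult_right_eq)
  have "fou p \<xi> t = measure_pmf.expectation (map_pmf (\<lambda>x. x mod int p) \<xi>) (\<lambda>x. cis (2 * pi * of_int (t * x) / p))"
    unfolding fou_def using c by simp
  also have "\<dots> = (\<Sum>r\<in>{0..<int p}. pmf (map_pmf (\<lambda>x. x mod int p) \<xi>) r *\<^sub>R cis (2 * pi * of_int (t * r) / p))"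
    by (rule integral_measure_pmf) (use assms in auto)
  also have "\<dots> = (\<Sum>r\<in>{0..<int p}. rmass p \<xi> r * cis (2 * pi * (t * r) / p))"
    using assms by (intro sum.cong refl) (simp add: rmass_pmf scaleR_conv_of_real)
  finally show ?thesis .
qed

text \<open>The squared modulus is the Fourier coefficient of the difference of two independent
  copies of \<open>\<xi>\<close>.\<close>

lemma one_minus_norm_fou:
  assumes p: "p > 0"
  shows "1 - cmod (fou p \<xi> t) ^ 2 =
    (\<Sum>(r,s)\<in>{0..<int p} \<times> {0..<int p}. rmass p \<xi> r * rmass p \<xi> s * (1 - cos (2 * pi * of_int (t * (r - s)) / p)))"
proof -
  let ?R = "{0..<int p}" and ?a = "rmass p \<xi>"
  define \<theta> where "\<theta> r = 2 * pi * (t * r) / p" for r :: int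
  have "complex_of_real (cmod (fou p \<xi> t) ^ 2) = fou p \<xi> t * cnj (fou p \<xi> t)"
    by (rule complex_norm_square)
  also have "\<dots> = (\<Sum>r\<in>?R. \<Sum>s\<in>?R. of_real (?a r * ?a s) * cis (\<theta> r - \<theta> s))"
    unfolding fou_rmass[OF p] \<theta>_def[symmetric]
    by (simp add: sum_product cis_cnj cis_mult[symmetric] diff_conv_add_uminus mult_ac del: add_uminus_conv_diff)
  finally have "cmod (fou p \<xi> t) ^ 2 = Re (\<Sum>r\<in>?R. \<Sum>s\<in>?R. of_real (?a r * ?a s) * cis (\<theta> r - \<theta> s))"
    by (metis Re_complex_of_real)
  also have "\<dots> = (\<Sum>r\<in>?R. \<Sum>s\<in>?R. ?a r * ?a s * cos (\<theta> r - \<theta> s))"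
    by (simp add: Re_sum)
  finally have 1: "cmod (fou p \<xi> t) ^ 2 = (\<Sum>r\<in>?R. \<Sum>s\<in>?R. ?a r * ?a s * cos (\<theta> r - \<theta> s))" .
  have "1 = (\<Sum>r\<in>?R. ?a r) * (\<Sum>r\<in>?R. ?a r)" using sum_rmass[OF p] by simp
  also have "\<dots> = (\<Sum>r\<in>?R. \<Sum>s\<in>?R. ?a r * ?a s)" by (rule sum_product)
  finally have "1 - cmod (fou p \<xi> t) ^ 2 = (\<Sum>r\<in>?R. \<Sum>s\<in>?R. ?a r * ?a s * (1 - cos (\<theta> r - \<theta> s)))"
    by (simp add: 1 right_diff_distrib sum_subtractf)
  also have "\<dots> = (\<Sum>r\<in>?R. \<Sum>s\<in>?R. ?a r * ?a s * (1 - cos (2 * pi * of_int (t * (r - s)) / p)))"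
    by (intro sum.cong refl) (simp add: \<theta>_def diff_divide_distrib right_diff_distrib)
  finally show ?thesis by (simp add: sum.cartesian_product)
qed

text \<open>By \<open>1 - v \<le> exp (- v)\<close> the squared modulus is at most the exponential
  of minus a weighted sum over pairs of different residues. Jensen separates the pairs, and after
  summing over \<open>t\<close> each pair yields the same value of \<open>Theta\<close>.\<close>

lemma qmean_even_le:
  assumes p: "prime p" and bal: "balanced \<alpha> \<xi>" and \<alpha>: "\<alpha> > 0"
  shows "qmean p \<xi> (2 * m) \<le> Theta p (m * \<alpha>)"
proof -
  have p0: "p > 0" and p1: "p > 1" using p prime_gt_0_nat prime_gt_1_nat by auto
  let ?R = "{0..<int p}" and ?a = "rmass p \<xi>"
  define D where "D = {(r,s)\<in>?R \<times> ?R. r \<noteq> s}"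
  define c where "c t z = 1 - cos (2 * pi * of_int (t * (fst z - snd z)) / p)" for t :: int and z :: "int \<times> int"
  define b where "b z = ?a (fst z) * ?a (snd z)" for z
  \<comment> \<open>The probability that two independent copies of \<open>\<xi>\<close> differ
    modulo \<open>p\<close>; balancedness makes it at least \<open>\<alpha>\<close>.\<close>
  define \<beta> where "\<beta> = (\<Sum>z\<in>D. b z)"
  have a0: "?a r \<ge> 0" for r by (simp add: rmass_def)
  have a1: "?a r \<le> 1 - \<alpha>" if "r \<in> ?R" for r
  proof -
    have "?a r \<le> (MAX r\<in>?R. measure_pmf.prob \<xi> {x. [x = r] (mod int p)})"
      unfolding rmass_def using that by (intro Max_ge) auto
    also have "\<dots> \<le> 1 - \<alpha>" using bal p by (auto simp: balanced_def)
    finally show ?thesis .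
  qed
  have finD: "finite D" by (rule finite_subset[of _ "?R \<times> ?R"]) (auto simp: D_def)
  have b0: "b z \<ge> 0" for z by (simp add: b_def a0)
  have split: "(\<Sum>z\<in>?R \<times> ?R. b z) = \<beta> + (\<Sum>r\<in>?R. ?a r * ?a r)"
  proof -
    have "?R \<times> ?R = D \<union> (\<lambda>r. (r,r)) ` ?R" by (auto simp: D_def)
    hence "(\<Sum>z\<in>?R \<times> ?R. b z) = \<beta> + (\<Sum>z\<in>(\<lambda>r. (r,r)) ` ?R. b z)"
      using finD by (simp only: \<beta>_def) (rule sum.union_disjoint; auto simp: D_def)
    also have "(\<Sum>z\<in>(\<lambda>r. (r,r)) ` ?R. b z) = (\<Sum>r\<in>?R. ?a r * ?a r)"
      by (subst sum.reindex) (auto simp: inj_on_def b_def)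
    finally show ?thesis .
  qed
  have "(\<Sum>z\<in>?R \<times> ?R. b z) = (\<Sum>r\<in>?R. ?a r) * (\<Sum>r\<in>?R. ?a r)"
    by (simp add: sum_product sum.cartesian_product b_def case_prod_beta)
  hence tot: "\<beta> + (\<Sum>r\<in>?R. ?a r * ?a r) = 1" using split sum_rmass[OF p0] by simp
  have "(\<Sum>r\<in>?R. ?a r * ?a r) \<le> (\<Sum>r\<in>?R. (1 - \<alpha>) * ?a r)"
    by (intro sum_mono mult_right_mono a1 a0)
  also have "\<dots> = 1 - \<alpha>" using sum_rmass[OF p0] by (simp add: sum_distrib_left[symmetric])
  finally have \<beta>: "\<beta> \<ge> \<alpha>" using tot by linarith
  have ndvd: "\<not> int p dvd fst z - snd z" if "z \<in> D" for z
  proof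
    assume "int p dvd fst z - snd z"
    hence "fst z mod int p = snd z mod int p" by (simp add: mod_eq_dvd_iff)
    thus False using that by (auto simp: D_def)
  qed
  have norm: "1 - cmod (fou p \<xi> t) ^ 2 = (\<Sum>z\<in>D. b z * c t z)" for t
    unfolding one_minus_norm_fou[OF p0]
    by (rule sum.mono_neutral_cong_right) (auto simp: D_def b_def c_def)
  \<comment> \<open>The weights \<open>b z / \<beta>\<close> sum to 1; the compensating factor
    \<open>\<beta>\<close> moves into the exponent.\<close>
  have jensen: "(cmod (fou p \<xi> t) ^ 2) ^ m \<le> (\<Sum>z\<in>D. b z / \<beta> * exp (- (m * \<beta>) * c t z))" for t
  proof -
    have "cmod (fou p \<xi> t) ^ 2 \<le> exp (- (\<Sum>z\<in>D. b z * c t z))"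
      using exp_ge_add_one_self[of "- (\<Sum>z\<in>D. b z * c t z)"] norm[of t] by linarith
    hence "(cmod (fou p \<xi> t) ^ 2) ^ m \<le> exp (- (\<Sum>z\<in>D. b z * c t z)) ^ m" by (intro power_mono) auto
    also have "\<dots> = exp (\<Sum>z\<in>D. (b z / \<beta>) *\<^sub>R (- (m * \<beta>) * c t z))"
    proof -
      have "\<beta> \<noteq> 0" using \<beta> \<alpha> by auto
      hence "(\<Sum>z\<in>D. (b z / \<beta>) *\<^sub>R (- (m * \<beta>) * c t z)) = m * - (\<Sum>z\<in>D. b z * c t z)"
        by (simp add: sum_distrib_left sum_negf[symmetric] mult_ac)
      thus ?thesis by (simp only: exp_of_nat_mult)
    qed
    also have "\<dots> \<le> (\<Sum>z\<in>D. b z / \<beta> * exp (- (m * \<beta>) * c t z))"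
    proof (rule convex_on_sum[OF finD _ exp_convex])
      show "D \<noteq> {}" using \<beta> \<alpha> by (auto simp: \<beta>_def)
      show "(\<Sum>z\<in>D. b z / \<beta>) = 1" using \<beta> \<alpha> by (simp add: sum_divide_distrib[symmetric] \<beta>_def[symmetric])
    qed (use \<beta> \<alpha> b0 in auto)
    finally show ?thesis .
  qed
  have "(\<Sum>t\<in>?R. cmod (fou p \<xi> t) ^ (2 * m)) \<le> (\<Sum>t\<in>?R. \<Sum>z\<in>D. b z / \<beta> * exp (- (m * \<beta>) * c t z))"
    using jensen by (intro sum_mono) (simp add: power_mult)
  also have "\<dots> = (\<Sum>z\<in>D. b z / \<beta> * (\<Sum>t\<in>?R. exp (- (m * \<beta>) * c t z)))"
    by (subst sum.swap) (simp add: sum_distrib_left)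
  also have "\<dots> = (\<Sum>z\<in>D. b z / \<beta> * (p * Theta p (m * \<beta>)))"
    unfolding c_def by (intro sum.cong refl arg_cong2[of _ _ _ _ "(*)"] sum_exp_cos_mult p ndvd)
  also have "\<dots> = (\<Sum>z\<in>D. b z) / \<beta> * (p * Theta p (m * \<beta>))"
    by (simp add: sum_distrib_right sum_divide_distrib)
  also have "\<dots> = p * Theta p (m * \<beta>)" using \<beta> \<alpha> by (simp add: \<beta>_def[symmetric])
  also have "\<dots> \<le> p * Theta p (m * \<alpha>)" using \<beta> by (intro mult_left_mono Theta_antimono) auto
  finally show ?thesis using p0 by (simp add: qmean_def field_simps)
qed

text \<open>Cauchy-Schwarz over the frequencies. It passes to an even exponent, where the squared
  modulus is available, at the price of a square root.\<close>

lemma qmean_square: "p > 0 \<Longrightarrow> qmean p \<xi> l ^ 2 \<le> qmean p \<xi> (2 * l)"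
proof -
  assume p: "p > 0"
  have "(\<Sum>t\<in>{0..<int p}. cmod (fou p \<xi> t) ^ l * 1) ^ 2 \<le> (\<Sum>t\<in>{0..<int p}. (cmod (fou p \<xi> t) ^ l)^2) * (\<Sum>t\<in>{0..<int p}. 1^2)"
    by (rule Cauchy_Schwarz_ineq_sum)
  thus ?thesis using p by (simp add: qmean_def power_divide power_mult[symmetric] mult.commute[of 2] power2_eq_square field_simps power_add[symmetric] mult_2_right)
qed

lemma qmean_le_sqrt:
  assumes p: "prime p" and bal: "balanced \<alpha> \<xi>" and \<alpha>: "\<alpha> > 0"
  shows "qmean p \<xi> l \<le> sqrt (Theta p (l * \<alpha>))"
proof -
  have "qmean p \<xi> l ^ 2 \<le> Theta p (l * \<alpha>)"
    using qmean_square[of p \<xi> l] qmean_even_le[OF assms, of l] p prime_gt_0_nat by force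
  thus ?thesis using real_le_rsqrt by blast
qed

section \<open>Upper bounds for Theta\<close>

text \<open>The double-angle formula reduces this to \<open>sin (pi * x) \<ge> x\<close>, obtained
  from the cubic Taylor polynomial.\<close>

lemma one_minus_cos_ge:
  assumes "0 \<le> x" "x \<le> 1 / 2"
  shows "1 - cos (2 * pi * x) \<ge> 2 * x ^ 2"
proof -
  have "(\<Sum>m<3. sin_coeff m * (pi * x) ^ m) = pi * x" by (simp add: sin_coeff_def eval_nat_numeral)
  hence "\<bar>sin (pi * x) - pi * x\<bar> \<le> inverse (fact 3) * \<bar>pi * x\<bar> ^ 3"
    using Maclaurin_sin_bound[of "pi * x" 3] by simp
  also have "\<bar>pi * x\<bar> = pi * x" using assms by simp
  also have "inverse (fact 3) * (pi * x) ^ 3 = (pi * x) ^ 3 / 6" by (simp add: fact_numeral)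
  finally have "sin (pi * x) \<ge> pi * x - (pi * x) ^ 3 / 6" by (simp only: abs_le_iff) linarith
  moreover have "(pi * x) ^ 3 / 6 \<le> pi * x / 2"
  proof -
    have "pi * x \<le> pi / 2" using assms by (simp add: field_simps)
    \<comment> \<open>17/10 exceeds half of \<open>pi\<close>, and its square 2.89 is below 3, as
      the cubic term requires.\<close>
    also have "pi / 2 \<le> 17 / 10" using pi_approx by simp
    finally have "(pi * x) ^ 2 \<le> (17/10) ^ 2" using assms by (intro power_mono) auto
    hence "(pi * x) * (pi * x) ^ 2 \<le> (pi * x) * 3" using assms by (intro mult_left_mono) (auto simp: power2_eq_square)
    thus ?thesis by (simp add: eval_nat_numeral mult_ac)
  qed
  moreover have "pi * x / 2 \<ge> x" using mult_right_mono[of 2 pi x] assms pi_gt3 by simp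
  ultimately have "sin (pi * x) \<ge> x" by linarith
  hence "sin (pi * x) ^ 2 \<ge> x ^ 2" using assms by (intro power_mono) auto
  moreover have "cos (2 * pi * x) = 1 - 2 * sin (pi * x) ^ 2"
    using cos_double_sin[of "pi * x"] by (simp add: mult.assoc)
  ultimately show ?thesis by linarith
qed

lemma one_minus_cos_int_ge:
  fixes d :: real
  assumes p: "p > 0" and t: "t \<in> {0..<int p}" and d: "0 \<le> d" "d * p \<le> t" "d * p \<le> int p - t"
  shows "1 - cos (2 * pi * t / p) \<ge> 2 * d ^ 2"
proof -
  define x where "x = min (real_of_int t) (p - t) / p"
  have x: "0 \<le> x" "x \<le> 1/2" using p t by (auto simp: x_def min_def field_simps)
  have "cos (2 * pi * t / p) = cos (2 * pi * x)"
  proof (cases "real_of_int t \<le> p - t")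
    case False
    have "cos (2 * pi * x) = cos (2 * pi - 2 * pi * t / p)"
      using False p by (simp add: x_def min_def field_simps)
    thus ?thesis by (simp add: cos_diff)
  qed (simp add: x_def)
  moreover have "d \<le> x" using d p by (auto simp: x_def field_simps)
  hence "2 * d ^ 2 \<le> 2 * x ^ 2" using d by (intro mult_left_mono power_mono) auto
  ultimately show ?thesis using one_minus_cos_ge[OF x] by linarith
qed

text \<open>A nonzero frequency stays at distance at least \<open>1 / p\<close> from the integers.
  Sharp enough when \<open>p\<^sup>2\<close> is small against \<open>y\<close>.\<close>

lemma Theta_le_small:
  assumes p: "p > 0" and y: "y \<ge> 0"
  shows "Theta p y \<le> 1 / p + exp (- 2 * y / p ^ 2)"
proof -
  have "(\<Sum>t\<in>{0..<int p}. exp (- y * (1 - cos (2 * pi * t / p)))) \<le> (\<Sum>t\<in>{0..<int p}. (if t = 0 then 1 else 0) + exp (- 2 * y / p ^ 2))"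
  proof (rule sum_mono)
    fix t assume t: "t \<in> {0..<int p}"
    show "exp (- y * (1 - cos (2 * pi * t / p))) \<le> (if t = 0 then 1 else 0) + exp (- 2 * y / p ^ 2)"
    proof (cases "t = 0")
      case False
      have "1 - cos (2 * pi * t / p) \<ge> 2 * (1 / p) ^ 2"
        using t p False by (intro one_minus_cos_int_ge) auto
      hence "y * (1 - cos (2 * pi * t / p)) \<ge> y * (2 * (1 / p) ^ 2)" using y by (intro mult_left_mono)
      thus ?thesis using False by (simp add: power_divide mult.commute)
    qed simp
  qed
  also have "\<dots> = 1 + p * exp (- 2 * y / p ^ 2)" using p by (simp add: sum.distrib)
  finally show ?thesis using p by (simp add: Theta_def field_simps)
qed

text \<open>The frequencies within \<open>d\<close> of an integer, about \<open>2 * d * p\<close> of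
  them, are bounded by 1; all others decay at the rate given by
  \<open>one_minus_cos_int_ge\<close>.\<close>

lemma Theta_le_large:
  assumes p: "p > 0" and y: "y \<ge> 0" and d: "d \<ge> 0"
  shows "Theta p y \<le> 2 * d + 2 / p + exp (- 2 * y * d ^ 2)"
proof -
  let ?A = "{t\<in>{0..<int p}. real_of_int t < d * p}" and ?B = "{t\<in>{0..<int p}. real_of_int (int p - t) < d * p}"
  have ceil: "real (nat \<lceil>d * p\<rceil>) \<le> d * p + 1"
    using of_int_ceiling_le_add_one[of "d * p"] d by (simp add: of_nat_nat)
  have "card ?A \<le> card {0..<\<lceil>d * p\<rceil>}" by (intro card_mono) (auto simp: less_ceiling_iff)
  hence A: "real (card ?A) \<le> d * p + 1" using ceil by simp
  have "card ?B \<le> card ((\<lambda>s. int p - s) ` {0..<\<lceil>d * p\<rceil>})"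
  proof (intro card_mono subsetI)
    fix t assume "t \<in> ?B"
    hence "int p - t \<in> {0..<\<lceil>d * p\<rceil>}" by (simp add: less_ceiling_iff)
    thus "t \<in> (\<lambda>s. int p - s) ` {0..<\<lceil>d * p\<rceil>}" by (rule rev_image_eqI) simp
  qed auto
  also have "\<dots> \<le> card {0..<\<lceil>d * p\<rceil>}" by (rule card_image_le) auto
  finally have B: "real (card ?B) \<le> d * p + 1" using ceil by simp
  have "(\<Sum>t\<in>{0..<int p}. exp (- y * (1 - cos (2 * pi * t / p)))) \<le> (\<Sum>t\<in>{0..<int p}. (of_bool (t \<in> ?A) + of_bool (t \<in> ?B)) + exp (- 2 * y * d ^ 2))"
  proof (rule sum_mono)
    fix t assume t: "t \<in> {0..<int p}"
    show "exp (- y * (1 - cos (2 * pi * t / p))) \<le> (of_bool (t \<in> ?A) + of_bool (t \<in> ?B)) + exp (- 2 * y * d ^ 2)"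
    proof (cases "t \<in> ?A \<union> ?B")
      case False
      have "1 - cos (2 * pi * t / p) \<ge> 2 * d ^ 2"
        using t p d False by (intro one_minus_cos_int_ge) (auto simp: not_less)
      hence "y * (1 - cos (2 * pi * t / p)) \<ge> y * (2 * d ^ 2)" using y by (intro mult_left_mono)
      hence "exp (- y * (1 - cos (2 * pi * t / p))) \<le> exp (- 2 * y * d ^ 2)" by (simp add: mult_ac)
      moreover have "(0::real) \<le> of_bool (t \<in> ?A) + of_bool (t \<in> ?B)" by simp
      ultimately show ?thesis by linarith
    next
      case True
      have "exp (- y * (1 - cos (2 * pi * t / p))) \<le> 1" using y by simp
      moreover have "(1::real) \<le> of_bool (t \<in> ?A) + of_bool (t \<in> ?B)" using True by auto
      ultimately show ?thesis using exp_gt_zero[of "- 2 * y * d ^ 2"] by linarith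
    qed
  qed
  also have "\<dots> = card ?A + card ?B + p * exp (- 2 * y * d ^ 2)"
    by (simp add: sum.distrib of_bool_def sum.If_cases Int_def)
  also have "\<dots> \<le> (d * p + 1) + (d * p + 1) + p * exp (- 2 * y * d ^ 2)" using A B by linarith
  finally show ?thesis using p by (simp add: Theta_def field_simps)
qed

lemma sum_cos_eq_0:
  assumes "p > 1"
  shows "(\<Sum>t\<in>{0..<int p}. cos (2 * pi * t / p)) = 0"
proof -
  define z where "z = cis (2 * pi / p)"
  have "z \<noteq> 1" using cis_int_mult_eq_1_iff[of p 1] assms by (simp add: z_def)
  moreover have "z ^ p = 1" using assms Complex.DeMoivre[of "2 * pi / p" p] by (simp add: z_def)
  ultimately have "(\<Sum>k<p. z ^ k) = 0" by (simp add: geometric_sum)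
  also have "(\<Sum>k<p. z ^ k) = (\<Sum>k<p. cis (2 * pi * k / p))"
    by (simp add: z_def Complex.DeMoivre mult_ac)
  finally have "Re (\<Sum>k<p. cis (2 * pi * k / p)) = 0" by simp
  hence "(\<Sum>k<p. cos (2 * pi * k / p)) = 0" by (simp add: Re_sum)
  moreover have "(\<Sum>t\<in>{0..<int p}. cos (2 * pi * t / p)) = (\<Sum>k<p. cos (2 * pi * k / p))"
    by (rule sum.reindex_bij_witness[of _ int nat]) auto
  ultimately show ?thesis by simp
qed

lemma exp_minus_le: "0 \<le> x \<Longrightarrow> x \<le> 1 \<Longrightarrow> exp (- x) \<le> 1 - x / (2::real)"
proof -
  assume x: "0 \<le> x" "x \<le> 1"
  have "exp (- x) = 1 / exp x" by (simp add: exp_minus field_simps)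
  also have "\<dots> \<le> 1 / (1 + x)" using x exp_ge_add_one_self[of x] by (intro divide_left_mono) auto
  also have "\<dots> \<le> 1 - x / 2"
  proof -
    have "x * x \<le> x" using x mult_left_le by blast
    thus ?thesis using x by (simp add: field_simps)
  qed
  finally show ?thesis .
qed

text \<open>For small \<open>y\<close> only the mean of \<open>1 - cos\<close> counts, and it equals
  1 as the cosines sum to 0. Truncating \<open>y\<close> at 1/2 keeps the exponents within 1, where
  the exponential is bounded by a linear function.\<close>

lemma Theta_le_exp:
  assumes p: "p > 1" and y: "0 \<le> y"
  shows "Theta p y \<le> exp (- min y (1/2) / 2)"
proof -
  define z where "z = min y (1/2)"
  have z: "0 \<le> z" "z \<le> 1/2" "z \<le> y" using y by (auto simp: z_def)
  have "(\<Sum>t\<in>{0..<int p}. exp (- z * (1 - cos (2 * pi * t / p)))) \<le> (\<Sum>t\<in>{0..<int p}. 1 - z * (1 - cos (2 * pi * t / p)) / 2)"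
  proof (rule sum_mono)
    fix t :: int
    have c: "cos (2 * pi * t / p) \<le> 1" "cos (2 * pi * t / p) \<ge> -1" by auto
    have "z * (1 - cos (2 * pi * t / p)) \<le> (1/2) * 2" using z c by (intro mult_mono) auto
    moreover have "z * (1 - cos (2 * pi * t / p)) \<ge> 0" using z c by (intro mult_nonneg_nonneg) auto
    ultimately show "exp (- z * (1 - cos (2 * pi * t / p))) \<le> 1 - z * (1 - cos (2 * pi * t / p)) / 2"
      using exp_minus_le[of "z * (1 - cos (2 * pi * t / p))"] by simp
  qed
  also have "\<dots> = p * (1 - z / 2)"
    using sum_cos_eq_0[OF p] by (simp add: sum_subtractf sum_divide_distrib[symmetric] sum_distrib_left[symmetric] algebra_simps)
  finally have "Theta p z \<le> 1 - z / 2" using p by (simp add: Theta_def field_simps)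
  also have "\<dots> \<le> exp (- z / 2)" using exp_ge_add_one_self[of "- z / 2"] by simp
  finally show ?thesis using Theta_antimono[OF z(3), of p] by (simp add: z_def)
qed

section \<open>Independent columns\<close>

text \<open>Conditioning on the past \<open>f\<close>: the factor \<open>c\<close> bounds the new
  column \<open>y\<close> for each past satisfying \<open>A\<close>.\<close>

lemma prob_pair_le:
  assumes "\<And>f. A f \<Longrightarrow> measure_pmf.prob \<mu> {y. B y f} \<le> c"
  shows "measure_pmf.prob (pair_pmf \<mu> P) {(y, f). A f \<and> B y f} \<le> c * measure_pmf.prob P {f. A f}"
proof (cases "\<exists>f. A f")
  case False
  thus ?thesis by simp
next
  case True
  hence c: "c \<ge> 0" using assms measure_nonneg order_trans by blast
  have eq: "pair_pmf \<mu> P = bind_pmf P (\<lambda>f. map_pmf (\<lambda>y. (y, f)) \<mu>)"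
    by (subst pair_commute_pmf) (simp add: pair_pmf_def map_bind_pmf map_pmf_def bind_assoc_pmf bind_return_pmf)
  have "emeasure (measure_pmf (pair_pmf \<mu> P)) {(y, f). A f \<and> B y f}
      = (\<integral>\<^sup>+f. emeasure (measure_pmf \<mu>) {y. A f \<and> B y f} \<partial>measure_pmf P)"
    unfolding eq by (simp add: emeasure_bind_pmf vimage_def)
  also have "\<dots> \<le> (\<integral>\<^sup>+f. ennreal c * indicator {f. A f} f \<partial>measure_pmf P)"
  proof (rule nn_integral_mono)
    fix f
    show "emeasure (measure_pmf \<mu>) {y. A f \<and> B y f} \<le> ennreal c * indicator {f. A f} f"
      using assms[of f] c by (cases "A f") (auto simp: measure_pmf.emeasure_eq_measure intro!: ennreal_leI)
  qed
  also have "\<dots> = ennreal (c * measure_pmf.prob P {f. A f})"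
    using c by (simp add: nn_integral_cmult measure_pmf.emeasure_eq_measure ennreal_mult)
  finally show ?thesis using c by (simp add: measure_pmf.emeasure_eq_measure)
qed

lemma prob_Pi_insert:
  assumes "finite U" "t \<notin> U"
  shows "measure_pmf.prob (Pi_pmf (insert t U) d (\<lambda>_. \<mu>)) {X. Q X}
    = measure_pmf.prob (pair_pmf \<mu> (Pi_pmf U d (\<lambda>_. \<mu>))) {(y, f). Q (f(t := y))}"
  by (subst Pi_pmf_insert[OF assms]) (simp add: vimage_def case_prod_unfold)

text \<open>The hypothesis on \<open>g\<close> bounds the conditional probability of the event at time \<open>t\<close> given the past.\<close>
lemma prob_count_le:
  fixes \<mu> :: "'a pmf" and F :: "nat \<Rightarrow> (nat \<Rightarrow> 'a) \<Rightarrow> bool"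
  assumes dep: "\<And>t X Y. (\<And>s. s \<le> t \<Longrightarrow> X s = Y s) \<Longrightarrow> F t X = F t Y"
    and g: "\<And>t X. t < m \<Longrightarrow> measure_pmf.prob \<mu> {y. F t (X(t := y))} \<le> g t"
  shows "measure_pmf.prob (Pi_pmf {..<m} d (\<lambda>_. \<mu>)) {X. u \<le> card {t. t < m \<and> F t X}} \<le> (\<Sum>t<m. g t) ^ u"
  using g
proof (induction m arbitrary: u)
  case 0
  show ?case by (cases u) auto
next
  case (Suc m)
  let ?P = "Pi_pmf {..<m} d (\<lambda>_. \<mu>)"
  have g0: "g t \<ge> 0" if "t < Suc m" for t using Suc.prems[OF that] measure_nonneg order_trans by blast
  show ?case
  proof (cases u)
    case 0
    thus ?thesis by simp
  next
    case (Suc v)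
    have cnt: "card {t. t < Suc m \<and> F t (f(m := y))} = card {t. t < m \<and> F t f} + of_bool (F m (f(m := y)))" for f y
    proof -
      have 1: "F t (f(m := y)) = F t f" if "t < m" for t by (rule dep) (use that in auto)
      have "{t. t < Suc m \<and> F t (f(m := y))} = {t. t < m \<and> F t f} \<union> (if F m (f(m := y)) then {m} else {})"
        using 1 by (auto simp: less_Suc_eq)
      thus ?thesis by (simp add: card_insert_if)
    qed
    have "measure_pmf.prob (Pi_pmf {..<Suc m} d (\<lambda>_. \<mu>)) {X. u \<le> card {t. t < Suc m \<and> F t X}}
      = measure_pmf.prob (pair_pmf \<mu> ?P) {(y, f). u \<le> card {t. t < Suc m \<and> F t (f(m := y))}}"
      unfolding lessThan_Suc by (rule prob_Pi_insert) auto
    \<comment> \<open>Either the first \<open>m\<close> times already give all \<open>Suc v\<close>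
      events, or they give \<open>v\<close> of them and time \<open>m\<close> gives one more. The
      conjunct \<open>True\<close> fits the first case to \<open>prob_pair_le\<close> with constant
      1.\<close>
    also have "\<dots> \<le> measure_pmf.prob (pair_pmf \<mu> ?P)
        ({(y, f). Suc v \<le> card {t. t < m \<and> F t f} \<and> True} \<union> {(y, f). v \<le> card {t. t < m \<and> F t f} \<and> F m (f(m := y))})"
      by (intro measure_pmf.finite_measure_mono) (auto simp: cnt Suc)
    also have "\<dots> \<le> measure_pmf.prob (pair_pmf \<mu> ?P) {(y, f). Suc v \<le> card {t. t < m \<and> F t f} \<and> True}
        + measure_pmf.prob (pair_pmf \<mu> ?P) {(y, f). v \<le> card {t. t < m \<and> F t f} \<and> F m (f(m := y))}"
      by (rule measure_Un_le) auto
    also have "\<dots> \<le> 1 * measure_pmf.prob ?P {f. Suc v \<le> card {t. t < m \<and> F t f}}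
        + g m * measure_pmf.prob ?P {f. v \<le> card {t. t < m \<and> F t f}}"
      by (intro add_mono prob_pair_le Suc.prems) auto
    also have "\<dots> \<le> 1 * (\<Sum>t<m. g t) ^ Suc v + g m * (\<Sum>t<m. g t) ^ v"
      using g0[of m] by (intro add_mono mult_left_mono Suc.IH Suc.prems) auto
    also have "\<dots> = (\<Sum>t<Suc m. g t) * (\<Sum>t<m. g t) ^ v" by (simp add: algebra_simps)
    also have "\<dots> \<le> (\<Sum>t<Suc m. g t) * (\<Sum>t<Suc m. g t) ^ v"
      using g0 by (intro mult_left_mono power_mono sum_nonneg) (auto intro!: sum_nonneg add_nonneg_nonneg)
    finally show ?thesis by (simp add: Suc)
  qed
qed

text \<open>Given the columns in \<open>I\<close>, the condition \<open>H X\<close> is fixed and the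
  columns in \<open>J\<close> are independent trials of it.\<close>

lemma prob_all_le:
  fixes \<mu> :: "'a pmf" and H :: "('b \<Rightarrow> 'a) \<Rightarrow> 'a \<Rightarrow> bool"
  assumes J: "finite J" "J \<subseteq> U" "I \<inter> J = {}" and U: "finite U"
    and dep: "\<And>X Y. (\<And>t. t \<in> I \<Longrightarrow> X t = Y t) \<Longrightarrow> H X = H Y"
    and r: "\<And>X. measure_pmf.prob \<mu> {y. H X y} \<le> r"
  shows "measure_pmf.prob (Pi_pmf U d (\<lambda>_. \<mu>)) {X. \<forall>t\<in>J. H X (X t)} \<le> r ^ card J"
  using J U
proof (induction J arbitrary: U rule: finite_induct)
  case (insert t J)
  have r0: "r \<ge> 0" using r measure_nonneg order_trans by blast
  let ?P = "Pi_pmf (U - {t}) d (\<lambda>_. \<mu>)"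
  have U: "insert t (U - {t}) = U" using insert.prems by auto
  have H: "H (f(t := y)) = H f" for f y by (rule dep) (use insert.prems in auto)
  have "measure_pmf.prob (Pi_pmf U d (\<lambda>_. \<mu>)) {X. \<forall>t\<in>insert t J. H X (X t)}
     = measure_pmf.prob (pair_pmf \<mu> ?P) {(y, f). \<forall>s\<in>insert t J. H (f(t := y)) ((f(t := y)) s)}"
    by (subst U[symmetric], rule prob_Pi_insert) (use insert.prems in auto)
  also have "\<dots> = measure_pmf.prob (pair_pmf \<mu> ?P) {(y, f). (\<forall>s\<in>J. H f (f s)) \<and> H f y}"
    using insert.hyps(2) by (intro arg_cong[of _ _ "measure_pmf.prob _"]) (auto simp: H)
  also have "\<dots> \<le> r * measure_pmf.prob ?P {f. \<forall>s\<in>J. H f (f s)}"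
    by (rule prob_pair_le) (rule r)
  also have "\<dots> \<le> r * r ^ card J"
    using r0 insert.hyps insert.prems by (intro mult_left_mono insert.IH) auto
  finally show ?case using insert.hyps by simp
qed simp

section \<open>The matrix as a family of columns\<close>

definition columns :: "nat \<Rightarrow> nat \<Rightarrow> int pmf \<Rightarrow> (nat \<Rightarrow> nat \<Rightarrow> int) pmf" where
  "columns n m \<xi> = Pi_pmf {..<m} (\<lambda>_. 0) (\<lambda>_. Pi_pmf {..<n} 0 (\<lambda>_. \<xi>))"

lemma iid_mat_columns: "iid_mat n m \<xi> = map_pmf (\<lambda>X. mat n m (\<lambda>(i,t). X t i)) (columns n m \<xi>)"
proof -
  define J :: "(nat \<Rightarrow> nat \<Rightarrow> int) \<Rightarrow> nat \<times> nat \<Rightarrow> int" where "J X = (\<lambda>(i,t). X t i)" for X :: "nat \<Rightarrow> nat \<Rightarrow> int"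
  have "Pi_pmf ({..<n} \<times> {..<m}) 0 (\<lambda>_. \<xi>) = map_pmf J (columns n m \<xi>)"
  proof (rule pmf_eqI)
    fix f :: "nat \<times> nat \<Rightarrow> int"
    define X where "X = (\<lambda>t i. f (i,t))"
    have "inj J" by (auto simp: inj_def J_def fun_eq_iff)
    moreover have "f = J X" by (auto simp: J_def X_def)
    ultimately have 1: "pmf (map_pmf J (columns n m \<xi>)) f = pmf (columns n m \<xi>) X"
      by (simp add: pmf_map_inj')
    have col: "pmf (Pi_pmf {..<n} 0 (\<lambda>_. \<xi>)) (X t) = (if \<forall>i. i \<notin> {..<n} \<longrightarrow> f (i,t) = 0 then \<Prod>i<n. pmf \<xi> (f (i,t)) else 0)" for t
      by (simp add: pmf_Pi X_def)
    show "pmf (Pi_pmf ({..<n} \<times> {..<m}) 0 (\<lambda>_. \<xi>)) f = pmf (map_pmf J (columns n m \<xi>)) f"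
    proof (cases "\<forall>x. x \<notin> {..<n} \<times> {..<m} \<longrightarrow> f x = 0")
      case True
      have "pmf (columns n m \<xi>) X = (\<Prod>t<m. \<Prod>i<n. pmf \<xi> (f (i,t)))"
        unfolding columns_def using True
        by (subst pmf_Pi') (auto simp: X_def fun_eq_iff col[unfolded X_def] intro!: prod.cong)
      also have "\<dots> = (\<Prod>i<n. \<Prod>t<m. pmf \<xi> (f (i,t)))" by (rule prod.swap)
      also have "\<dots> = (\<Prod>x\<in>{..<n} \<times> {..<m}. pmf \<xi> (f x))" by (simp add: prod.cartesian_product case_prod_beta)
      also have "\<dots> = pmf (Pi_pmf ({..<n} \<times> {..<m}) 0 (\<lambda>_. \<xi>)) f" using True by (subst pmf_Pi') auto
      finally show ?thesis using 1 by simp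
    next
      case False
      then obtain i t where it: "(i,t) \<notin> {..<n} \<times> {..<m}" "f (i,t) \<noteq> 0" by auto
      have "pmf (columns n m \<xi>) X = 0"
      proof (cases "t < m")
        case True
        hence "pmf (Pi_pmf {..<n} 0 (\<lambda>_. \<xi>)) (X t) = 0" using it col[of t] by auto
        hence z: "(\<Prod>s<m. pmf (Pi_pmf {..<n} 0 (\<lambda>_. \<xi>)) (X s)) = 0"
          using True by (intro prod_zero) auto
        show ?thesis unfolding columns_def pmf_Pi[OF finite_lessThan[of m]] by (simp only: z if_cancel)
      next
        case False
        thus ?thesis using it unfolding columns_def by (intro pmf_Pi_outside exI[of _ t]) (auto simp: X_def fun_eq_iff)
      qed
      moreover have "pmf (Pi_pmf ({..<n} \<times> {..<m}) 0 (\<lambda>_. \<xi>)) f = 0"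
        using it by (intro pmf_Pi_outside) auto
      ultimately show ?thesis using 1 by simp
    qed
  qed
  thus ?thesis by (simp add: iid_mat_def map_pmf_comp J_def)
qed

text \<open>Further columns only shrink the kernels, so an estimate for \<open>N\<close> columns
  serves every larger width. This gives uniformity in the number of extra columns.\<close>

lemma prob_iid_mat_trivial:
  assumes "N \<le> m"
  shows "measure_pmf.prob (iid_mat n m \<xi>) {M. trivial_group (cokernel M)}
     \<ge> 1 - measure_pmf.prob (columns n N \<xi>) {X. \<exists>p. prime p \<and> lker p {..<n} X {..<N} \<noteq> {\<lambda>_. 0}}"
proof -
  let ?B = "{X. \<exists>p. prime p \<and> lker p {..<n} X {..<N} \<noteq> {\<lambda>_. 0}}"
  let ?P = "columns n m \<xi>"
  have "columns n N \<xi> = map_pmf (\<lambda>X t. if t \<in> {..<N} then X t else (\<lambda>_. 0)) ?P"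
    unfolding columns_def by (rule Pi_pmf_subset) (use assms in auto)
  moreover have "lker p {..<n} (\<lambda>t. if t < N then X t else (\<lambda>_. 0)) {..<N} = lker p {..<n} X {..<N}"
    for p and X :: "nat \<Rightarrow> nat \<Rightarrow> int" by (auto simp: lker_def)
  ultimately have 1: "measure_pmf.prob (columns n N \<xi>) ?B = measure_pmf.prob ?P ?B"
    by (simp add: vimage_def)
  have "1 - measure_pmf.prob ?P ?B = measure_pmf.prob ?P (- ?B)"
    using measure_pmf.prob_compl[of ?B ?P] by (simp add: Compl_eq_Diff_UNIV)
  also have "\<dots> \<le> measure_pmf.prob ?P {X. trivial_group (cokernel (mat n m (\<lambda>(i,t). X t i)))}"
  proof (intro measure_pmf.finite_measure_mono subsetI)
    fix X assume X: "X \<in> - ?B"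
    have "trivial_group (cokernel (mat n m (\<lambda>(i,t). X t i)))"
    proof (rule trivial_cokernel[where X = X])
      fix p :: nat assume p: "prime p"
      have "lker p {..<n} X {..<m} \<subseteq> lker p {..<n} X {..<N}" using assms by (intro lker_antimono) auto
      also have "\<dots> = {\<lambda>_. 0}" using X p by auto
      finally show "lker p {..<n} X {..<m} = {\<lambda>_. 0}"
        using msub_lker[of p "{..<n}" X "{..<m}"] prime_gt_0_nat[OF p] by (auto simp: msub_def)
    qed auto
    thus "X \<in> {X. trivial_group (cokernel (mat n m (\<lambda>(i,t). X t i)))}" by simp
  qed auto
  also have "\<dots> = measure_pmf.prob (iid_mat n m \<xi>) {M. trivial_group (cokernel M)}"
    by (simp add: iid_mat_columns vimage_def)
  finally show ?thesis using 1 by simp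
qed

section \<open>Kernels of the random matrix\<close>

lemma prob_Bex_le:
  assumes "finite I" "\<And>i. i \<in> I \<Longrightarrow> measure_pmf.prob P {x. Q i x} \<le> b i"
  shows "measure_pmf.prob P {x. \<exists>i\<in>I. Q i x} \<le> (\<Sum>i\<in>I. b i)"
proof -
  have "{x. \<exists>i\<in>I. Q i x} = (\<Union>i\<in>I. {x. Q i x})" by auto
  also have "measure_pmf.prob P \<dots> \<le> (\<Sum>i\<in>I. measure_pmf.prob P {x. Q i x})"
    by (rule measure_pmf.finite_measure_subadditive_finite) (use assms in auto)
  also have "\<dots> \<le> (\<Sum>i\<in>I. b i)" by (intro sum_mono assms)
  finally show ?thesis .
qed

lemma prob_Bex_le_card:
  assumes "finite I" "\<And>i. i \<in> I \<Longrightarrow> measure_pmf.prob P {x. Q i x} \<le> b" "real (card I) \<le> c" "b \<ge> 0"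
  shows "measure_pmf.prob P {x. \<exists>i\<in>I. Q i x} \<le> c * b"
proof -
  have "measure_pmf.prob P {x. \<exists>i\<in>I. Q i x} \<le> (\<Sum>i\<in>I. b)" by (rule prob_Bex_le) (use assms in auto)
  also have "\<dots> \<le> c * b" using assms by (simp add: mult_right_mono)
  finally show ?thesis .
qed

lemma card_subsets_le: "finite A \<Longrightarrow> card {S. S \<subseteq> A \<and> card S = k} \<le> card A ^ k"
  by (cases "k \<le> card A") (auto simp: n_subsets binomial_le_pow binomial_eq_0)

definition line :: "nat \<Rightarrow> ('a \<Rightarrow> int) \<Rightarrow> ('a \<Rightarrow> int) set" where
  "line p w = range (\<lambda>a. lcomb p a w 0 w)"

lemma in_line: "w \<in> mvec p S \<Longrightarrow> p > 0 \<Longrightarrow> w \<in> line p w"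
  unfolding line_def using lcomb_id by (metis rangeI)

lemma msub_line:
  assumes "w \<in> mvec p S" "p > 0"
  shows "msub p S (line p w)"
  unfolding msub_def
proof (intro conjI ballI allI)
  show "line p w \<subseteq> mvec p S" using assms lcomb_in_mvec by (auto simp: line_def)
  show "(\<lambda>_. 0) \<in> line p w" unfolding line_def by (rule range_eqI[of _ _ 0]) (auto simp: lcomb_def)
  fix u v a b assume "u \<in> line p w" "v \<in> line p w"
  then obtain c d where cd: "u = lcomb p c w 0 w" "v = lcomb p d w 0 w" by (auto simp: line_def)
  have "lcomb p a u b v = lcomb p (a * c + b * d) w 0 w"
  proof
    fix i
    have "[a * ((c * w i) mod int p) + b * ((d * w i) mod int p) = a * (c * w i) + b * (d * w i)] (mod int p)"
      by (intro cong_add cong_mult cong_refl) (auto simp: cong_def)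
    thus "lcomb p a u b v i = lcomb p (a * c + b * d) w 0 w i"
      by (simp add: cd lcomb_def cong_def algebra_simps)
  qed
  thus "lcomb p a u b v \<in> line p w" by (auto simp: line_def)
qed

lemma supp_line:
  assumes "w \<in> mvec p S" "prime p" "v \<in> line p w" "v \<noteq> (\<lambda>_. 0)"
  shows "supp v = supp w"
proof -
  have p0: "p > 0" using assms prime_gt_0_nat by auto
  obtain a where a: "v = lcomb p a w 0 w" using assms by (auto simp: line_def)
  have "\<not> int p dvd a" using assms(4) a by (auto simp: lcomb_def)
  hence "v i = 0 \<longleftrightarrow> int p dvd w i" for i
    using assms(2) by (simp add: a lcomb_def dvd_eq_mod_eq_0[symmetric] prime_dvd_mult_iff)
  moreover have "int p dvd w i \<longleftrightarrow> w i = 0" for i using mvec_not_dvd[OF assms(1) p0] by auto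
  ultimately show ?thesis by (auto simp: supp_def)
qed

lemma card_line_ge:
  assumes "w \<in> mvec p S" "prime p" "w \<noteq> (\<lambda>_. 0)" "finite S"
  shows "p \<le> card (line p w)"
proof -
  have p0: "p > 0" using assms prime_gt_0_nat by auto
  obtain i where i: "w i \<noteq> 0" using assms(3) by auto
  have nd: "\<not> int p dvd w i" using mvec_not_dvd[OF assms(1) p0 i] .
  have "inj_on (\<lambda>a. lcomb p a w 0 w) {0..<int p}"
  proof (rule inj_onI)
    fix a b assume ab: "a \<in> {0..<int p}" "b \<in> {0..<int p}" "lcomb p a w 0 w = lcomb p b w 0 w"
    have "(a * w i) mod int p = (b * w i) mod int p" using fun_cong[OF ab(3), of i] by (simp add: lcomb_def)
    show "a = b" by (rule inj_onD[OF bij_betw_imp_inj_on[OF bij_betw_mult_mod[OF assms(2) nd]] _ ab(1,2)]) fact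
  qed
  hence "p = card ((\<lambda>a. lcomb p a w 0 w) ` {0..<int p})" by (simp add: card_image)
  also have "\<dots> \<le> card (line p w)"
    using finite_msub[OF assms(4) msub_line[OF assms(1) p0]] by (intro card_mono) (auto simp: line_def)
  finally show ?thesis .
qed

text \<open>The case of dimension 1: all nonzero multiples of \<open>w\<close> have the support of
  \<open>w\<close>, so up to \<open>card (supp w)\<close> blocks are available.\<close>

lemma prob_kills_one:
  assumes p: "prime p" and w: "w \<in> mvec p S" and S: "finite S" and l: "l \<le> card (supp w)" "l > 0"
  shows "measure_pmf.prob (Pi_pmf S 0 (\<lambda>_. \<xi>)) {y. kills p S y w} \<le> qmean p \<xi> l"
proof -
  have p0: "p > 0" using p prime_gt_0_nat by auto
  have w0: "w \<noteq> (\<lambda>_. 0)" using l by (auto simp: supp_def)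
  have "kills p S y v" if "kills p S y w" "v \<in> line p w" for y v
    using that kills_lcomb[OF that(1,1)] by (auto simp: line_def)
  hence "measure_pmf.prob (Pi_pmf S 0 (\<lambda>_. \<xi>)) {y. kills p S y w} \<le>
        measure_pmf.prob (Pi_pmf S 0 (\<lambda>_. \<xi>)) {y. \<forall>v\<in>line p w. kills p S y v}"
    by (intro measure_pmf.finite_measure_mono) auto
  also have "\<dots> \<le> qmean p \<xi> l ^ 1"
  proof (rule prob_kills_subspace[OF msub_line[OF w p0] S p])
    show "p ^ 1 \<le> card (line p w)" using card_line_ge[OF w p w0 S] by simp
    show "card (supp v) \<ge> card (supp w)" if "v \<in> line p w" "v \<noteq> (\<lambda>_. 0)" for v
      using supp_line[OF w p that] by simp
  qed (use l in auto)
  finally show ?thesis by simp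
qed

text \<open>Dual form of: column \<open>t\<close> is in the span of the previous ones modulo \<open>p\<close>.\<close>
definition rankfail :: "nat \<Rightarrow> nat \<Rightarrow> (nat \<Rightarrow> nat \<Rightarrow> int) \<Rightarrow> nat \<Rightarrow> bool" where
  "rankfail p n X t \<longleftrightarrow> (\<forall>w\<in>lker p {..<n} X {..<t}. kills p {..<n} (X t) w)"

definition small_ker :: "nat \<Rightarrow> nat \<Rightarrow> nat \<Rightarrow> (nat \<Rightarrow> nat \<Rightarrow> int) \<Rightarrow> nat \<Rightarrow> bool" where
  "small_ker p s n X t \<longleftrightarrow> (\<exists>w\<in>lker p {..<n} X {..<t}. w \<noteq> (\<lambda>_. 0) \<and> card (supp w) \<le> s)"

lemma lker_cong: "(\<And>t. t \<in> J \<Longrightarrow> X t = Y t) \<Longrightarrow> lker p S X J = lker p S Y J"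
  by (auto simp: lker_def)

text \<open>A column divides the size of the kernel by \<open>p\<close> unless it is a rank failure.
  In terms of dimension: \<open>n - t\<close> plus the number of failures so far.\<close>

lemma card_lker_rankfail:
  assumes p: "prime p"
  shows "card (lker p {..<n} X {..<t}) * p ^ t = p ^ (n + card {r. r < t \<and> rankfail p n X r})"
proof (induction t)
  case 0
  show ?case by (simp add: card_mvec)
next
  case (Suc t)
  have p0: "p > 0" and p1: "p > 1" using p prime_gt_0_nat prime_gt_1_nat by auto
  let ?V = "lker p {..<n} X {..<t}"
  have W: "lker p {..<n} X {..<Suc t} = {w \<in> ?V. kills p {..<n} (X t) w}"
    by (simp add: lessThan_Suc lker_insert)
  have set: "{r. r < Suc t \<and> rankfail p n X r} = {r. r < t \<and> rankfail p n X r} \<union> (if rankfail p n X t then {t} else {})"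
    by (auto simp: less_Suc_eq)
  have crd: "card {r. r < Suc t \<and> rankfail p n X r} = card {r. r < t \<and> rankfail p n X r} + of_bool (rankfail p n X t)"
    unfolding set by (simp add: card_insert_if)
  show ?case
  proof (cases "rankfail p n X t")
    case True
    hence "lker p {..<n} X {..<Suc t} = ?V" using W by (auto simp: rankfail_def)
    thus ?thesis using Suc crd True by simp
  next
    case False
    hence "?V \<noteq> {w \<in> ?V. kills p {..<n} (X t) w}" by (auto simp: rankfail_def)
    hence "card ?V = p * card (lker p {..<n} X {..<Suc t})"
      using card_msub_kills[OF p _ msub_lker[OF p0], of "{..<n}" X "{..<t}" "X t"] W by auto
    thus ?thesis using Suc crd False by (simp add: mult_ac)
  qed
qed

lemma zero_in_lker: "p > 0 \<Longrightarrow> (\<lambda>_. 0) \<in> lker p S X J"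
  using msub_lker[of p S X J] by (auto simp: msub_def)

lemma lker_nontrivial_card:
  assumes p: "prime p" and S: "finite S" and n: "lker p S X J \<noteq> {\<lambda>_. 0}"
  shows "p \<le> card (lker p S X J)"
proof -
  have p0: "p > 0" using p prime_gt_0_nat by auto
  obtain d where d: "card (lker p S X J) = p ^ d" using msub_card_power[OF msub_lker[OF p0] p S] by blast
  have "d \<noteq> 0"
  proof
    assume "d = 0"
    hence "card (lker p S X J) = 1" using d by simp
    then obtain v where v: "lker p S X J = {v}" using card_1_singletonE by blast
    hence "v = (\<lambda>_. 0)" using zero_in_lker[OF p0, of S X J] by simp
    thus False using v n by simp
  qed
  thus ?thesis unfolding d using p0 by (simp add: self_le_power)
qed

section \<open>Primes and vectors recovered from few columns\<close>

text \<open>Indexing the bad primes makes the prime a function of the columns in \<open>A\<close>,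
  so that a union bound can run over the index. Out of range the value is arbitrary, hence the guard
  \<open>is_bad\<close>.\<close>

definition nth_bad :: "nat \<Rightarrow> 'a set \<Rightarrow> ('b \<Rightarrow> 'a \<Rightarrow> int) \<Rightarrow> 'b set \<Rightarrow> nat" where
  "nth_bad b S X A = sorted_list_of_set (bad_primes S X A) ! b"

definition is_bad :: "nat \<Rightarrow> 'a set \<Rightarrow> ('b \<Rightarrow> 'a \<Rightarrow> int) \<Rightarrow> 'b set \<Rightarrow> bool" where
  "is_bad b S X A \<longleftrightarrow> finite (bad_primes S X A) \<and> b < card (bad_primes S X A)"

lemma is_bad_prime: "is_bad b S X A \<Longrightarrow> prime (nth_bad b S X A)"
proof -
  assume "is_bad b S X A"
  hence "nth_bad b S X A \<in> set (sorted_list_of_set (bad_primes S X A))"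
    unfolding nth_bad_def is_bad_def by (intro nth_mem) simp
  thus ?thesis using \<open>is_bad b S X A\<close> by (simp add: is_bad_def bad_primes_def)
qed

lemma bad_prime_index:
  assumes "q \<in> bad_primes S X A" "finite (bad_primes S X A)" "card (bad_primes S X A) \<le> B"
  shows "\<exists>b<B. is_bad b S X A \<and> nth_bad b S X A = q"
proof -
  have "q \<in> set (sorted_list_of_set (bad_primes S X A))" using assms by simp
  then obtain b where "b < length (sorted_list_of_set (bad_primes S X A))" "sorted_list_of_set (bad_primes S X A) ! b = q"
    by (auto simp: in_set_conv_nth)
  thus ?thesis using assms by (intro exI[of _ b]) (auto simp: is_bad_def nth_bad_def)
qed

lemma bad_primes_cong: "(\<And>t. t \<in> A \<Longrightarrow> X t = Y t) \<Longrightarrow> bad_primes S X A = bad_primes S Y A"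
  using lker_cong[of A X Y] by (simp add: bad_primes_def)

text \<open>A spanning vector recovered from the columns in \<open>C\<close> alone, when the kernel
  is a line with full support. Otherwise the value is arbitrary, so \<open>sparse_event\<close>
  tests range and support again.\<close>

definition generator :: "nat \<Rightarrow> 'a set \<Rightarrow> ('b \<Rightarrow> 'a \<Rightarrow> int) \<Rightarrow> 'b set \<Rightarrow> 'a \<Rightarrow> int" where
  "generator p S X C = (SOME w. w \<in> mvec p S \<and> supp w = S \<and> lker p S X C = line p w)"

text \<open>The vector is chosen of minimal support, which makes it unique up to scaling on its support.\<close>
lemma minimal_small_ker:
  assumes p: "prime p" and sk: "small_ker p s n X m"
  obtains w where "w \<in> mvec p (supp w)" "supp w \<subseteq> {..<n}" "supp w \<noteq> {}" "card (supp w) \<le> s"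
    "lker p (supp w) X {..<m} = line p w"
proof -
  have p0: "p > 0" using p prime_gt_0_nat by auto
  define W where "W = {w \<in> lker p {..<n} X {..<m}. w \<noteq> (\<lambda>_. 0)}"
  obtain w0 where w0: "w0 \<in> W" "card (supp w0) \<le> s" using sk by (auto simp: small_ker_def W_def)
  define w where "w = arg_min (\<lambda>w. card (supp w)) (\<lambda>w. w \<in> W)"
  have w: "w \<in> W" and min: "\<And>v. v \<in> W \<Longrightarrow> card (supp w) \<le> card (supp v)"
    using arg_min_natI[of "\<lambda>w. w \<in> W" w0] arg_min_nat_le[of "\<lambda>w. w \<in> W"] w0 by (auto simp: w_def)
  have wk: "w \<in> lker p {..<n} X {..<m}" "w \<noteq> (\<lambda>_. 0)" using w by (auto simp: W_def)
  hence wn: "w \<in> mvec p {..<n}" by (simp add: lker_def)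
  have sn: "supp w \<subseteq> {..<n}" by (rule supp_mvec[OF wn])
  have fs: "finite (supp w)" using sn finite_subset by blast
  have ws: "w \<in> mvec p (supp w)" using mvec_supp[OF wn p0] by simp
  have wks: "w \<in> lker p (supp w) X {..<m}" by (rule lker_supp[OF wk(1) _ p0]) simp
  have ne: "supp w \<noteq> {}" using wk(2) supp_empty_iff by metis
  have "lker p (supp w) X {..<m} = line p w"
  proof
    show "line p w \<subseteq> lker p (supp w) X {..<m}"
      using msub_lker[OF p0, of "supp w" X "{..<m}"] wks by (auto simp: msub_def line_def)
    show "lker p (supp w) X {..<m} \<subseteq> line p w"
    proof
      fix v assume v: "v \<in> lker p (supp w) X {..<m}"
      hence vm: "v \<in> mvec p (supp w)" by (simp add: lker_def)
      obtain i where i: "i \<in> supp w" using ne by blast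
      have "\<not> int p dvd w i" using mvec_not_dvd[OF ws p0] i by (auto simp: supp_def)
      then obtain c where c: "[c * w i = 1] (mod int p)" using prime_inverse_ex[OF p] by blast
      \<comment> \<open>\<open>z\<close> cancels coordinate \<open>i\<close> of \<open>v\<close>, so
        its support is strictly smaller than that of \<open>w\<close> and minimality forces
        \<open>z\<close> to be 0.\<close>
      define z where "z = lcomb p 1 v (- (v i * c)) w"
      have z: "z \<in> lker p (supp w) X {..<m}"
        using msub_lker[OF p0, of "supp w" X "{..<m}"] v wks by (auto simp: msub_def z_def)
      hence zn: "z \<in> lker p {..<n} X {..<m}" using lker_mono_rows[OF sn _ p0] by simp
      have "z i = 0"
      proof -
        have "[v i + - (v i * c) * w i = v i + - v i * 1] (mod int p)"
          using cong_mult[OF cong_refl[of "- v i"] c] by (intro cong_add cong_refl) (simp add: mult_ac)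
        thus ?thesis by (simp add: z_def lcomb_def cong_def)
      qed
      hence "supp z \<subset> supp w" using supp_mvec[of z p "supp w"] z i by (auto simp: lker_def supp_def)
      hence "card (supp z) < card (supp w)" using fs psubset_card_mono by blast
      hence "z \<notin> W" using min[of z] by linarith
      hence z0: "z = (\<lambda>_. 0)" using zn by (auto simp: W_def)
      have "v = lcomb p (v i * c) w 0 w"
      proof
        fix j
        have "(v j - v i * c * w j) mod int p = 0" using fun_cong[OF z0, of j] by (simp add: z_def lcomb_def)
        hence "v j mod int p = (v i * c * w j) mod int p" by (simp add: mod_eq_dvd_iff dvd_eq_mod_eq_0)
        thus "v j = lcomb p (v i * c) w 0 w j" using mod_eq_self[OF vm p0] by (simp add: lcomb_def)
      qed
      thus "v \<in> line p w" by (auto simp: line_def)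
    qed
  qed
  moreover have "card (supp w) \<le> s" using min[OF w0(1)] w0(2) by linarith
  ultimately show ?thesis using that[OF ws sn ne] by blast
qed

section \<open>The exceptional events\<close>

text \<open>\<open>s\<close> is the sparsity threshold, \<open>D\<close> the cap on codimensions,
  \<open>B\<close> bounds the binary logarithm of minors, and from time \<open>i0\<close> on sparse
  kernel vectors count as excluded. The bound \<open>r\<close> is uniform in the prime because it is
  applied to primes that depend on the sample. Up to \<open>2 * s\<close> of the first
  \<open>i0\<close> columns are spent on identifying prime and vector.\<close>

locale random_columns =
  fixes n u s D B i0 P0 p0 :: nat and K :: real and \<xi> :: "int pmf" and r :: "nat \<Rightarrow> real"
  assumes p0: "prime p0" and D: "D \<ge> 1" and s: "2 * s \<le> i0" and i0: "i0 \<le> n"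
    and r: "\<And>p \<sigma>. prime p \<Longrightarrow> 1 \<le> \<sigma> \<Longrightarrow> \<sigma> \<le> s \<Longrightarrow> qmean p \<xi> \<sigma> \<le> r \<sigma>" and r1: "\<And>\<sigma>. r \<sigma> \<le> 1"
    and K: "\<And>x. x \<in> set_pmf \<xi> \<Longrightarrow> \<bar>real_of_int x\<bar> \<le> K"
    and B: "\<And>k. k \<le> n \<Longrightarrow> fact k * K ^ k \<le> 2 ^ B"
begin

abbreviation "N \<equiv> n + u"
abbreviation "Col \<equiv> Pi_pmf {..<n} 0 (\<lambda>_. \<xi>)"
abbreviation "ker p X t \<equiv> lker p {..<n} X {..<t}"

lemma r0: "1 \<le> \<sigma> \<Longrightarrow> \<sigma> \<le> s \<Longrightarrow> r \<sigma> \<ge> 0"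
  using r[OF p0] qmean_nonneg order_trans by blast

text \<open>The requirements on the past belong to the event: for a past that violates them it is
  impossible, so its conditional probability is small given any past.\<close>

definition fail :: "nat \<Rightarrow> (nat \<Rightarrow> nat \<Rightarrow> int) \<Rightarrow> nat \<Rightarrow> bool" where
  "fail p X t \<longleftrightarrow> ker p X t \<noteq> {\<lambda>_. 0} \<and> rankfail p n X t \<and> (i0 \<le> t \<longrightarrow> \<not> small_ker p s n X t)"

text \<open>The codimension is capped at \<open>D\<close>, since Halasz needs \<open>s / d\<close> disjoint information sets.\<close>
definition fbound :: "nat \<Rightarrow> nat \<Rightarrow> real" where
  "fbound p t = (if t < i0 then qmean p \<xi> 1 ^ (n - t)
     else qmean p \<xi> (s div (min (max (n - t) 1) D) + 1) ^ (min (max (n - t) 1) D))"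

lemma fail_cong:
  assumes "\<And>r. r \<le> t \<Longrightarrow> X r = Y r"
  shows "fail p X t = fail p Y t"
proof -
  have "ker p X t = ker p Y t" by (rule lker_cong) (use assms in auto)
  thus ?thesis using assms[of t] by (simp add: fail_def rankfail_def small_ker_def)
qed

text \<open>The kernel has dimension at least \<open>n - t\<close>, and at least 1 since it is
  nontrivial. Before \<open>i0\<close> the large codimension makes up for using a single block; from
  \<open>i0\<close> on all supports exceed \<open>s\<close>, which leaves room for
  \<open>s div d + 1\<close> blocks.\<close>

lemma prob_fail:
  assumes p: "prime p"
  shows "measure_pmf.prob Col {y. fail p (X(t := y)) t} \<le> fbound p t"
proof -
  have pp: "p > 0" and p1: "p > 1" using p prime_gt_0_nat prime_gt_1_nat by auto
  have fb0: "fbound p t \<ge> 0" by (auto simp: fbound_def qmean_nonneg)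
  let ?V = "ker p X t"
  have V: "ker p (X(t := y)) t = ?V" for y by (rule lker_cong) auto
  have ev: "fail p (X(t := y)) t \<longleftrightarrow> ?V \<noteq> {\<lambda>_. 0} \<and> (i0 \<le> t \<longrightarrow> \<not> small_ker p s n X t) \<and> (\<forall>w\<in>?V. kills p {..<n} y w)" for y
    using V by (auto simp: fail_def rankfail_def small_ker_def)
  show ?thesis
  proof (cases "?V \<noteq> {\<lambda>_. 0} \<and> (i0 \<le> t \<longrightarrow> \<not> small_ker p s n X t)")
    case False
    hence "{y. fail p (X(t := y)) t} = {}" using ev by auto
    thus ?thesis using fb0 by simp
  next
    case True
    have sub: "msub p {..<n} ?V" by (rule msub_lker[OF pp])
    have c1: "p ^ 1 \<le> card ?V" using lker_nontrivial_card[OF p _ conjunct1[OF True]] by simp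
    have c2: "p ^ (n - t) \<le> card ?V"
    proof (cases "t \<le> n")
      case True
      have "p ^ (n - t) * p ^ t \<le> card ?V * p ^ t"
        using lker_card_lower[OF p, of "{..<n}" "{..<t}" X] True by (simp add: power_add[symmetric])
      thus ?thesis using pp by simp
    next
      case False
      thus ?thesis using c1 pp by simp
    qed
    have "measure_pmf.prob Col {y. \<forall>w\<in>?V. kills p {..<n} y w} \<le> fbound p t"
    proof (cases "t < i0")
      case True
      have "measure_pmf.prob Col {y. \<forall>w\<in>?V. kills p {..<n} y w} \<le> qmean p \<xi> 1 ^ (n - t)"
      proof (rule prob_kills_subspace[OF sub _ p c2])
        fix v assume "v \<in> ?V" "v \<noteq> (\<lambda>_. 0)"
        hence "supp v \<subseteq> {..<n}" "supp v \<noteq> {}" using sub supp_mvec[of v p "{..<n}"] supp_empty_iff[of v] by (auto simp: msub_def)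
        hence "card (supp v) \<noteq> 0" using finite_subset[of "supp v" "{..<n}"] by simp
        thus "1 \<le> card (supp v)" by linarith
      qed auto
      thus ?thesis using True by (simp add: fbound_def)
    next
      case False
      define d where "d = min (max (n - t) 1) D"
      have d: "d \<ge> 1" using D by (simp add: d_def)
      have "d \<le> max (n - t) 1" by (simp add: d_def)
      hence "p ^ d \<le> p ^ max (n - t) 1" using p1 by (simp add: power_increasing)
      also have "\<dots> \<le> card ?V" using c1 c2 by (simp add: max_def)
      finally have cd: "p ^ d \<le> card ?V" .
      have "measure_pmf.prob Col {y. \<forall>w\<in>?V. kills p {..<n} y w} \<le> qmean p \<xi> (s div d + 1) ^ d"
      proof (rule prob_kills_subspace[OF sub _ p cd])
        fix v assume v: "v \<in> ?V" "v \<noteq> (\<lambda>_. 0)"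
        have "\<not> small_ker p s n X t" using \<open>_ \<and> (_ \<longrightarrow> \<not> small_ker p s n X t)\<close> False by simp
        thus "s + 1 \<le> card (supp v)" using v unfolding small_ker_def by force
      qed (auto simp: le_less_trans[OF div_times_less_eq_dividend])
      thus ?thesis using False by (simp add: fbound_def d_def)
    qed
    moreover have "{y. fail p (X(t := y)) t} = {y. \<forall>w\<in>?V. kills p {..<n} y w}" using ev True by auto
    ultimately show ?thesis by simp
  qed
qed

section \<open>Sparse kernel vectors\<close>

lemma prob_columns_all_kill:
  assumes p: "prime p" and w: "w \<in> mvec p {..<n}" and l: "l \<le> card (supp w)" "l > 0" and m: "m \<le> N"
  shows "measure_pmf.prob (columns n N \<xi>) {X. \<forall>t<m. kills p {..<n} (X t) w} \<le> qmean p \<xi> l ^ m"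
proof -
  have "measure_pmf.prob (columns n N \<xi>) {X. \<forall>t\<in>{..<m}. kills p {..<n} (X t) w} \<le> qmean p \<xi> l ^ card {..<m}"
    unfolding columns_def
    by (rule prob_all_le[where I = "{}" and H = "\<lambda>X y. kills p {..<n} y w"])
       (use m prob_kills_one[OF p w _ l] in auto)
  thus ?thesis by (simp add: Ball_def)
qed

text \<open>For one fixed prime the at most \<open>p0 ^ \<sigma>\<close> coefficient vectors on each
  support can be enumerated.\<close>

lemma prob_small_ker_p0:
  "measure_pmf.prob (columns n N \<xi>) {X. small_ker p0 s n X i0} \<le> (\<Sum>\<sigma>=1..s. (real n ^ \<sigma> * real p0 ^ \<sigma>) * r \<sigma> ^ i0)"
proof -
  have pp: "p0 > 0" using p0 prime_gt_0_nat by auto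
  have "measure_pmf.prob (columns n N \<xi>) {X. small_ker p0 s n X i0} \<le>
    measure_pmf.prob (columns n N \<xi>) {X. \<exists>\<sigma>\<in>{1..s}. \<exists>S\<in>{S. S \<subseteq> {..<n} \<and> card S = \<sigma>}. \<exists>w\<in>{w\<in>mvec p0 S. supp w = S}. \<forall>t<i0. kills p0 {..<n} (X t) w}"
  proof (intro measure_pmf.finite_measure_mono subsetI)
    fix X assume "X \<in> {X. small_ker p0 s n X i0}"
    then obtain w where w: "w \<in> ker p0 X i0" "w \<noteq> (\<lambda>_. 0)" "card (supp w) \<le> s" by (auto simp: small_ker_def)
    have wm: "w \<in> mvec p0 {..<n}" using w by (simp add: lker_def)
    have sn: "supp w \<subseteq> {..<n}" by (rule supp_mvec[OF wm])
    have "card (supp w) \<noteq> 0" using w(2) sn finite_subset supp_empty_iff by fastforce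
    moreover have "w \<in> mvec p0 (supp w)" by (rule mvec_supp[OF wm pp]) simp
    moreover have "\<forall>t<i0. kills p0 {..<n} (X t) w" using w by (simp add: lker_def)
    ultimately show "X \<in> {X. \<exists>\<sigma>\<in>{1..s}. \<exists>S\<in>{S. S \<subseteq> {..<n} \<and> card S = \<sigma>}. \<exists>w\<in>{w\<in>mvec p0 S. supp w = S}. \<forall>t<i0. kills p0 {..<n} (X t) w}"
      using w(3) sn by (intro CollectI bexI[of _ "card (supp w)"] bexI[of _ "supp w"] bexI[of _ w]) auto
  qed auto
  also have "\<dots> \<le> (\<Sum>\<sigma>=1..s. real n ^ \<sigma> * (real p0 ^ \<sigma> * r \<sigma> ^ i0))"
  proof (rule prob_Bex_le)
    fix \<sigma> assume \<sigma>: "\<sigma> \<in> {1..s}"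
    have r\<sigma>: "r \<sigma> \<ge> 0" using r0 \<sigma> by simp
    show "measure_pmf.prob (columns n N \<xi>) {X. \<exists>S\<in>{S. S \<subseteq> {..<n} \<and> card S = \<sigma>}. \<exists>w\<in>{w\<in>mvec p0 S. supp w = S}. \<forall>t<i0. kills p0 {..<n} (X t) w}
      \<le> real n ^ \<sigma> * (real p0 ^ \<sigma> * r \<sigma> ^ i0)"
    proof (rule prob_Bex_le_card)
      fix S assume S: "S \<in> {S. S \<subseteq> {..<n} \<and> card S = \<sigma>}"
      have fS: "finite S" using S finite_subset by auto
      show "measure_pmf.prob (columns n N \<xi>) {X. \<exists>w\<in>{w\<in>mvec p0 S. supp w = S}. \<forall>t<i0. kills p0 {..<n} (X t) w}
        \<le> real p0 ^ \<sigma> * r \<sigma> ^ i0"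
      proof (rule prob_Bex_le_card)
        have "card {w\<in>mvec p0 S. supp w = S} \<le> card (mvec p0 S)" by (intro card_mono) (use fS in auto)
        also have "\<dots> = p0 ^ \<sigma>" using card_mvec[OF fS] S by simp
        finally show "real (card {w\<in>mvec p0 S. supp w = S}) \<le> real p0 ^ \<sigma>" by (metis of_nat_le_iff of_nat_power)
        fix w assume w: "w \<in> {w\<in>mvec p0 S. supp w = S}"
        have "w \<in> mvec p0 {..<n}" using w mvec_mono[OF pp, of S "{..<n}"] S by auto
        hence "measure_pmf.prob (columns n N \<xi>) {X. \<forall>t<i0. kills p0 {..<n} (X t) w} \<le> qmean p0 \<xi> \<sigma> ^ i0"
          by (rule prob_columns_all_kill[OF p0]) (use w S \<sigma> i0 in auto)
        also have "\<dots> \<le> r \<sigma> ^ i0" by (intro power_mono r p0 qmean_nonneg) (use \<sigma> in auto)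
        finally show "measure_pmf.prob (columns n N \<xi>) {X. \<forall>t<i0. kills p0 {..<n} (X t) w} \<le> r \<sigma> ^ i0" .
      qed (use fS r\<sigma> in auto)
    next
      show "real (card {S. S \<subseteq> {..<n} \<and> card S = \<sigma>}) \<le> real n ^ \<sigma>"
        using card_subsets_le[of "{..<n}" \<sigma>] by (metis card_lessThan finite_lessThan of_nat_le_iff of_nat_power)
    qed (use r\<sigma> in auto)
  qed auto
  finally show ?thesis by (simp add: mult.assoc)
qed

text \<open>Prime and vector depend only on the columns in \<open>A \<union> C\<close>, so every
  other column is an independent test, and no union over primes or coefficients remains.\<close>

definition sparse_event :: "nat set \<Rightarrow> nat set \<Rightarrow> nat set \<Rightarrow> nat \<Rightarrow> (nat \<Rightarrow> nat \<Rightarrow> int) \<Rightarrow> (nat \<Rightarrow> int) \<Rightarrow> bool" where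
  "sparse_event S A C b X y \<longleftrightarrow> is_bad b S X A \<and>
     (let p = nth_bad b S X A; w = generator p S X C in w \<in> mvec p S \<and> supp w = S \<and> kills p {..<n} y w)"

lemma sparse_event_cong:
  assumes "\<And>t. t \<in> A \<union> C \<Longrightarrow> X t = Y t"
  shows "sparse_event S A C b X = sparse_event S A C b Y"
proof -
  have "bad_primes S X A = bad_primes S Y A" by (rule bad_primes_cong) (use assms in auto)
  moreover have "lker p S X C = lker p S Y C" for p by (rule lker_cong) (use assms in auto)
  ultimately show ?thesis
    by (intro ext) (simp add: sparse_event_def is_bad_def nth_bad_def generator_def)
qed

text \<open>\<open>A\<close> and \<open>C\<close> use up at most \<open>2 * \<sigma>\<close>
  columns; each remaining one passes with probability at most \<open>r \<sigma>\<close>, whatever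
  the prime.\<close>

lemma prob_sparse_event:
  assumes S: "S \<subseteq> {..<n}" "card S = \<sigma>" and \<sigma>: "1 \<le> \<sigma>" "\<sigma> \<le> s"
    and A: "A \<subseteq> {..<i0}" "card A = \<sigma>" and C: "C \<subseteq> {..<i0}" "card C \<le> \<sigma>"
  shows "measure_pmf.prob (columns n N \<xi>) {X. \<forall>t\<in>{..<i0} - (A \<union> C). sparse_event S A C b X (X t)} \<le> r \<sigma> ^ (i0 - 2 * \<sigma>)"
proof -
  have r\<sigma>: "r \<sigma> \<ge> 0" using r0 \<sigma> by simp
  have "measure_pmf.prob (columns n N \<xi>) {X. \<forall>t\<in>{..<i0} - (A \<union> C). sparse_event S A C b X (X t)} \<le> r \<sigma> ^ card ({..<i0} - (A \<union> C))"
    unfolding columns_def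
  proof (rule prob_all_le[where I = "A \<union> C"])
    fix X
    show "measure_pmf.prob Col {y. sparse_event S A C b X y} \<le> r \<sigma>"
    proof (cases "\<exists>y. sparse_event S A C b X y")
      case False
      thus ?thesis using r\<sigma> by simp
    next
      case True
      define p where "p = nth_bad b S X A"
      define w where "w = generator p S X C"
      have p: "prime p" using True is_bad_prime by (auto simp: sparse_event_def p_def)
      have w: "w \<in> mvec p S" "supp w = S" using True by (auto simp: sparse_event_def p_def w_def Let_def)
      have wn: "w \<in> mvec p {..<n}" using w mvec_mono[OF prime_gt_0_nat[OF p] S(1)] by auto
      have "measure_pmf.prob Col {y. sparse_event S A C b X y} \<le> measure_pmf.prob Col {y. kills p {..<n} y w}"
        by (intro measure_pmf.finite_measure_mono) (auto simp: sparse_event_def p_def w_def Let_def)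
      also have "\<dots> \<le> qmean p \<xi> \<sigma>" by (rule prob_kills_one[OF p wn]) (use w S \<sigma> in auto)
      also have "\<dots> \<le> r \<sigma>" by (rule r[OF p \<sigma>])
      finally show ?thesis .
    qed
  next
    fix X Y :: "nat \<Rightarrow> nat \<Rightarrow> int" assume "\<And>t. t \<in> A \<union> C \<Longrightarrow> X t = Y t"
    thus "sparse_event S A C b X = sparse_event S A C b Y" by (rule sparse_event_cong)
  qed (use i0 in auto)
  also have "\<dots> \<le> r \<sigma> ^ (i0 - 2 * \<sigma>)"
  proof (rule power_decreasing)
    have f: "finite A" "finite C" using A C finite_subset by blast+
    have "card (A \<union> C) \<le> 2 * \<sigma>" using card_Un_le[of A C] A C by linarith
    moreover have "card ({..<i0} - (A \<union> C)) = i0 - card (A \<union> C)"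
      using A C f by (subst card_Diff_subset) auto
    ultimately show "i0 - 2 * \<sigma> \<le> card ({..<i0} - (A \<union> C))" by linarith
  qed (use r\<sigma> r1 in auto)
  finally show ?thesis .
qed

text \<open>Here \<open>C\<close> cuts out the line of a minimal sparse kernel vector and \<open>A\<close> bounds the number of primes.\<close>
definition Sparse :: "(nat \<Rightarrow> nat \<Rightarrow> int) set" where
  "Sparse = {X. \<exists>\<sigma>\<in>{1..s}. \<exists>S\<in>{S. S \<subseteq> {..<n} \<and> card S = \<sigma>}. \<exists>A\<in>{A. A \<subseteq> {..<i0} \<and> card A = \<sigma>}.
     \<exists>C\<in>{C. C \<subseteq> {..<i0} \<and> card C = \<sigma> - 1}. \<exists>b\<in>{..<B}. \<forall>t\<in>{..<i0} - (A \<union> C). sparse_event S A C b X (X t)}"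

lemma prob_Sparse:
  "measure_pmf.prob (columns n N \<xi>) Sparse \<le> (\<Sum>\<sigma>=1..s. real n ^ \<sigma> * (real n ^ \<sigma> * (real n ^ (\<sigma> - 1) * (real B * r \<sigma> ^ (i0 - 2 * \<sigma>)))))"
  unfolding Sparse_def
proof (rule prob_Bex_le)
  fix \<sigma> assume \<sigma>: "\<sigma> \<in> {1..s}"
  have r\<sigma>: "r \<sigma> \<ge> 0" using r0 \<sigma> by simp
  have cs: "real (card {S. S \<subseteq> {..<m} \<and> card S = k}) \<le> real n ^ k" if "m \<le> n" for m k
  proof -
    have "real (card {S. S \<subseteq> {..<m} \<and> card S = k}) \<le> real m ^ k"
      using card_subsets_le[of "{..<m}" k] by (metis card_lessThan finite_lessThan of_nat_le_iff of_nat_power)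
    also have "\<dots> \<le> real n ^ k" using that by (intro power_mono) auto
    finally show ?thesis .
  qed
  show "measure_pmf.prob (columns n N \<xi>) {X. \<exists>S\<in>{S. S \<subseteq> {..<n} \<and> card S = \<sigma>}. \<exists>A\<in>{A. A \<subseteq> {..<i0} \<and> card A = \<sigma>}.
     \<exists>C\<in>{C. C \<subseteq> {..<i0} \<and> card C = \<sigma> - 1}. \<exists>b\<in>{..<B}. \<forall>t\<in>{..<i0} - (A \<union> C). sparse_event S A C b X (X t)}
     \<le> real n ^ \<sigma> * (real n ^ \<sigma> * (real n ^ (\<sigma> - 1) * (real B * r \<sigma> ^ (i0 - 2 * \<sigma>))))"
    by (intro prob_Bex_le_card prob_sparse_event cs)
       (use \<sigma> i0 r\<sigma> in auto)
qed auto

text \<open>Let \<open>S\<close> be the support of a minimal sparse kernel vector modulo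
  \<open>p\<close>. Modulo \<open>p\<close> the rows \<open>S\<close> have rank
  \<open>\<sigma> - 1\<close>, which gives \<open>C\<close>. Modulo \<open>p0\<close> they have full
  rank, since a kernel vector would be sparse; this gives \<open>A\<close> and a nonzero minor,
  which \<open>p\<close> divides.\<close>

lemma Sparse_if_small_ker:
  assumes p: "prime p" and X: "X \<in> set_pmf (columns n N \<xi>)"
    and sk: "small_ker p s n X i0" and nsk: "\<not> small_ker p0 s n X i0"
  shows "X \<in> Sparse"
proof -
  have pp: "p > 0" "p > 1" using p prime_gt_0_nat prime_gt_1_nat by auto
  have pp0: "p0 > 0" "p0 > 1" using p0 prime_gt_0_nat prime_gt_1_nat by auto
  obtain w where w: "w \<in> mvec p (supp w)" "supp w \<subseteq> {..<n}" "supp w \<noteq> {}" "card (supp w) \<le> s"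
    "lker p (supp w) X {..<i0} = line p w" using minimal_small_ker[OF p sk] .
  define S where "S = supp w"
  define \<sigma> where "\<sigma> = card S"
  have S: "finite S" "S \<subseteq> {..<n}" using w finite_subset by (auto simp: S_def)
  have \<sigma>: "1 \<le> \<sigma>" "\<sigma> \<le> s" using w S card_gt_0_iff[of S] by (auto simp: \<sigma>_def S_def Suc_le_eq)
  have w0: "w \<noteq> (\<lambda>_. 0)" using w(3) by (auto simp: supp_def)
  obtain C where C: "C \<subseteq> {..<i0}" "lker p S X C = lker p S X {..<i0}" "card (lker p S X C) * p ^ card C = p ^ card S"
    using lker_choose_columns[OF p S(1), of "{..<i0}" X] by auto
  have "card (lker p S X C) = p"
  proof -
    have "card (line p w) \<le> p"
    proof -
      have "line p w \<subseteq> (\<lambda>a. lcomb p a w 0 w) ` {0..<int p}"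
      proof
        fix v assume "v \<in> line p w"
        then obtain a where a: "v = lcomb p a w 0 w" by (auto simp: line_def)
        have "lcomb p a w 0 w = lcomb p (a mod int p) w 0 w" by (auto simp: lcomb_def mod_mult_left_eq)
        thus "v \<in> (\<lambda>a. lcomb p a w 0 w) ` {0..<int p}" using a pp by auto
      qed
      hence "card (line p w) \<le> card ((\<lambda>a. lcomb p a w 0 w) ` {0..<int p})" by (intro card_mono) auto
      also have "\<dots> \<le> p" using card_image_le[of "{0..<int p}" "\<lambda>a. lcomb p a w 0 w"] by simp
      finally show ?thesis .
    qed
    moreover have "p \<le> card (line p w)" by (rule card_line_ge[OF w(1) p w0]) (use S in \<open>simp add: S_def\<close>)
    ultimately show ?thesis using C(2) w(5) by (simp add: S_def)
  qed
  hence "p ^ (card C + 1) = p ^ \<sigma>" using C(3) by (simp add: \<sigma>_def)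
  hence "card C + 1 = \<sigma>" using power_inject_exp[OF pp(2)] by blast
  hence cC: "card C = \<sigma> - 1" by simp
  obtain A where A: "A \<subseteq> {..<i0}" "lker p0 S X A = lker p0 S X {..<i0}" "card (lker p0 S X A) * p0 ^ card A = p0 ^ card S"
    using lker_choose_columns[OF p0 S(1), of "{..<i0}" X] by auto
  have kA: "lker p0 S X A = {\<lambda>_. 0}"
  proof -
    have "v = (\<lambda>_. 0)" if v: "v \<in> lker p0 S X {..<i0}" for v
    proof (rule ccontr)
      assume "v \<noteq> (\<lambda>_. 0)"
      moreover have "v \<in> ker p0 X i0" using lker_mono_rows[OF S(2) _ pp0(1) v] by simp
      moreover have "card (supp v) \<le> s"
        using card_mono[OF S(1), of "supp v"] supp_mvec[of v p0 S] v \<sigma> by (auto simp: lker_def \<sigma>_def)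
      ultimately show False using nsk by (auto simp: small_ker_def)
    qed
    hence "lker p0 S X {..<i0} \<subseteq> {\<lambda>_. 0}" by blast
    moreover have "{\<lambda>_. 0} \<subseteq> lker p0 S X {..<i0}" using zero_in_lker[OF pp0(1), of S X "{..<i0}"] by blast
    ultimately show ?thesis unfolding A(2) by (rule equalityI)
  qed
  hence cA: "card A = \<sigma>" using A(3) pp0 by (simp add: \<sigma>_def power_inject_exp)
  have fA: "finite A" using A finite_subset by blast
  have KX: "real_of_int \<bar>X t i\<bar> \<le> K" if "t < N" "i < n" for t i
  proof -
    have "X t \<in> set_pmf Col" using X that by (auto simp: columns_def set_Pi_pmf PiE_dflt_def)
    hence "X t i \<in> set_pmf \<xi>" using that by (auto simp: set_Pi_pmf PiE_dflt_def)
    thus ?thesis using K by simp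
  qed
  have KA: "real_of_int \<bar>X t i\<bar> \<le> K" if "t \<in> A" "i \<in> S" for t i
    using that A(1) S(2) i0 by (intro KX) auto
  note bp = card_bad_primes[OF p0 S(1) fA cA[unfolded \<sigma>_def] kA KA]
  have "card S \<le> n" using card_mono[OF _ S(2)] by simp
  hence "(2::real) ^ card (bad_primes S X A) \<le> 2 ^ B" using bp(2) B[of "card S"] by linarith
  hence cB: "card (bad_primes S X A) \<le> B" by (simp add: power_increasing_iff)
  have "w \<in> lker p S X {..<i0}" using in_line[OF w(1) pp(1)] w(5) by (simp add: S_def)
  hence wA: "w \<in> lker p S X A" using lker_antimono[OF A(1)] by blast
  hence "p \<in> bad_primes S X A" using p w0 by (auto simp: bad_primes_def)
  then obtain b where b: "b < B" "is_bad b S X A" "nth_bad b S X A = p" using bad_prime_index[OF _ bp(1) cB] by blast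
  \<comment> \<open>\<open>v\<close> may differ from \<open>w\<close>, but it spans the same line
    and is therefore killed by all the first \<open>i0\<close> columns.\<close>
  define v where "v = generator p S X C"
  have v: "v \<in> mvec p S \<and> supp v = S \<and> lker p S X C = line p v"
    unfolding v_def generator_def by (rule someI[of _ w]) (use w C in \<open>simp add: S_def\<close>)
  have "v \<in> lker p S X C" using v in_line[OF _ pp(1)] by blast
  hence "v \<in> ker p X i0" using lker_mono_rows[OF S(2) _ pp(1)] C(2) by auto
  hence "sparse_event S A C b X (X t)" if "t < i0" for t
    using that b v by (simp add: sparse_event_def Let_def v_def[symmetric] lker_def)
  hence "\<forall>t\<in>{..<i0} - (A \<union> C). sparse_event S A C b X (X t)" by simp
  hence "\<exists>b\<in>{..<B}. \<forall>t\<in>{..<i0} - (A \<union> C). sparse_event S A C b X (X t)" using b(1) by (intro bexI[of _ b]) auto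
  moreover have "C \<in> {C. C \<subseteq> {..<i0} \<and> card C = \<sigma> - 1}" "A \<in> {A. A \<subseteq> {..<i0} \<and> card A = \<sigma>}"
    "S \<in> {S. S \<subseteq> {..<n} \<and> card S = \<sigma>}" "\<sigma> \<in> {1..s}"
    using \<sigma> S(2) A(1) cA C(1) cC by (simp_all add: \<sigma>_def)
  ultimately show ?thesis unfolding Sparse_def
    by - (rule CollectI, rule bexI[of _ \<sigma>], rule bexI[of _ S], rule bexI[of _ A], rule bexI[of _ C], assumption+)
qed

section \<open>Rank failures modulo large primes and modulo p0\<close>

text \<open>Rows on which the first \<open>j\<close> columns form a matrix invertible modulo
  \<open>p0\<close>, chosen from these columns alone; they exist by \<open>rows_ex\<close>.\<close>

definition rows :: "nat \<Rightarrow> (nat \<Rightarrow> nat \<Rightarrow> int) \<Rightarrow> nat set" where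
  "rows j X = (SOME S. S \<subseteq> {..<n} \<and> card S = j \<and> lker p0 S X {..<j} = {\<lambda>_. 0})"

text \<open>The time \<open>j\<close> is the one just after the first rank failure modulo the prime, which is then the \<open>b\<close>-th
  bad prime of a square submatrix that depends on the first \<open>j\<close> columns only.\<close>
definition late_fail :: "nat \<Rightarrow> nat \<Rightarrow> (nat \<Rightarrow> nat \<Rightarrow> int) \<Rightarrow> nat \<Rightarrow> bool" where
  "late_fail j b X t \<longleftrightarrow> j \<le> t \<and> is_bad b (rows j X) X {..<j} \<and> P0 < nth_bad b (rows j X) X {..<j}
     \<and> fail (nth_bad b (rows j X) X {..<j}) X t"

lemma rows_cong:
  assumes "\<And>t. t < j \<Longrightarrow> X t = Y t"
  shows "rows j X = rows j Y" "is_bad b S X {..<j} = is_bad b S Y {..<j}" "nth_bad b S X {..<j} = nth_bad b S Y {..<j}"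
proof -
  have "lker q S X {..<j} = lker q S Y {..<j}" for q S by (rule lker_cong) (use assms in auto)
  thus "rows j X = rows j Y" by (simp add: rows_def)
  have "bad_primes S X {..<j} = bad_primes S Y {..<j}" by (rule bad_primes_cong) (use assms in auto)
  thus "is_bad b S X {..<j} = is_bad b S Y {..<j}" "nth_bad b S X {..<j} = nth_bad b S Y {..<j}"
    by (simp_all add: is_bad_def nth_bad_def)
qed

text \<open>From time \<open>j\<close> on the prime is determined by the past, so
  \<open>fbound\<close> for that prime bounds the conditional probability; \<open>g\<close> removes
  the dependence on the prime.\<close>

lemma prob_late_fail:
  assumes g: "\<And>p t. prime p \<Longrightarrow> P0 < p \<Longrightarrow> t < N \<Longrightarrow> fbound p t \<le> g t" and g0: "\<And>t. 0 \<le> g t"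
  shows "measure_pmf.prob (columns n N \<xi>) {X. u \<le> card {t. t < N \<and> late_fail j b X t}} \<le> (\<Sum>t<N. g t) ^ u"
  unfolding columns_def
proof (rule prob_count_le)
  fix t and X Y :: "nat \<Rightarrow> nat \<Rightarrow> int" assume XY: "\<And>s. s \<le> t \<Longrightarrow> X s = Y s"
  show "late_fail j b X t = late_fail j b Y t"
  proof (cases "j \<le> t")
    case True
    have "\<And>s. s < j \<Longrightarrow> X s = Y s" using XY True by simp
    note c = rows_cong[OF this]
    show ?thesis using c fail_cong[OF XY] by (simp add: late_fail_def)
  qed (simp add: late_fail_def)
next
  fix t X assume t: "t < N"
  show "measure_pmf.prob Col {y. late_fail j b (X(t := y)) t} \<le> g t"
  proof (cases "j \<le> t \<and> is_bad b (rows j X) X {..<j} \<and> P0 < nth_bad b (rows j X) X {..<j}")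
    case True
    define p where "p = nth_bad b (rows j X) X {..<j}"
    have p: "prime p" using True is_bad_prime by (auto simp: p_def)
    have "rows j (X(t := y)) = rows j X" "nth_bad b S (X(t := y)) {..<j} = nth_bad b S X {..<j}" for y S
      using rows_cong[of j "X(t := y)" X] True by auto
    hence "measure_pmf.prob Col {y. late_fail j b (X(t := y)) t} \<le> measure_pmf.prob Col {y. fail p (X(t := y)) t}"
      by (intro measure_pmf.finite_measure_mono) (auto simp: late_fail_def p_def)
    also have "\<dots> \<le> fbound p t" by (rule prob_fail[OF p])
    also have "\<dots> \<le> g t" by (rule g) (use p True t in \<open>auto simp: p_def\<close>)
    finally show ?thesis .
  next
    case False
    have "\<not> late_fail j b (X(t := y)) t" for y
      using False rows_cong[of j "X(t := y)" X] by (auto simp: late_fail_def)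
    thus ?thesis using g0 by simp
  qed
qed

lemma prob_p0_fail:
  "measure_pmf.prob (columns n N \<xi>) {X. \<exists>t<n. fail p0 X t} \<le> (\<Sum>t<n. fbound p0 t)"
proof -
  have "measure_pmf.prob (columns n N \<xi>) {X. \<exists>t<n. fail p0 X t} \<le>
    measure_pmf.prob (columns n N \<xi>) {X. 1 \<le> card {t. t < N \<and> (t < n \<and> fail p0 X t)}}"
  proof (intro measure_pmf.finite_measure_mono subsetI)
    fix X assume "X \<in> {X. \<exists>t<n. fail p0 X t}"
    then obtain t where "t < n" "fail p0 X t" by auto
    hence "t \<in> {t. t < N \<and> (t < n \<and> fail p0 X t)}" by simp
    hence "card {t. t < N \<and> (t < n \<and> fail p0 X t)} \<noteq> 0" by (subst card_eq_0_iff) auto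
    hence "1 \<le> card {t. t < N \<and> (t < n \<and> fail p0 X t)}" by linarith
    thus "X \<in> {X. 1 \<le> card {t. t < N \<and> (t < n \<and> fail p0 X t)}}" by (simp only: mem_Collect_eq)
  qed auto
  also have "\<dots> \<le> (\<Sum>t<N. if t < n then fbound p0 t else 0) ^ 1"
    unfolding columns_def
  proof (rule prob_count_le)
    fix t and X Y :: "nat \<Rightarrow> nat \<Rightarrow> int" assume "\<And>s. s \<le> t \<Longrightarrow> X s = Y s"
    thus "(t < n \<and> fail p0 X t) = (t < n \<and> fail p0 Y t)" using fail_cong by blast
  qed (auto intro: prob_fail[OF p0])
  also have "\<dots> = (\<Sum>t<n. fbound p0 t)"
    by (simp add: sum.If_cases Int_def lessThan_def) (intro sum.cong; auto)
  finally show ?thesis .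
qed

section \<open>Dense kernel vectors modulo small primes\<close>

definition Dense :: "(nat \<Rightarrow> nat \<Rightarrow> int) set" where
  "Dense = {X. \<exists>p\<in>{p. prime p \<and> p \<le> P0}. \<exists>w\<in>{w\<in>mvec p {..<n}. s < card (supp w)}. \<forall>t<N. kills p {..<n} (X t) w}"

text \<open>For a small prime, \<open>qmean p \<xi> l\<close> will turn out to be about
  \<open>1 / p\<close>, so that the \<open>n + u\<close> columns outweigh the \<open>p ^ n\<close>
  vectors by a factor of order \<open>p ^ u\<close>.\<close>

lemma prob_Dense:
  assumes l: "l \<le> s + 1" "l > 0"
  shows "measure_pmf.prob (columns n N \<xi>) Dense \<le> (\<Sum>p | prime p \<and> p \<le> P0. real p ^ n * qmean p \<xi> l ^ N)"
  unfolding Dense_def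
proof (rule prob_Bex_le)
  fix p assume p: "p \<in> {p. prime p \<and> p \<le> P0}"
  show "measure_pmf.prob (columns n N \<xi>) {X. \<exists>w\<in>{w\<in>mvec p {..<n}. s < card (supp w)}. \<forall>t<N. kills p {..<n} (X t) w}
    \<le> real p ^ n * qmean p \<xi> l ^ N"
  proof (rule prob_Bex_le_card)
    have "card {w\<in>mvec p {..<n}. s < card (supp w)} \<le> card (mvec p {..<n})" by (intro card_mono) auto
    also have "\<dots> = p ^ n" by (simp add: card_mvec)
    finally show "real (card {w\<in>mvec p {..<n}. s < card (supp w)}) \<le> real p ^ n" by (metis of_nat_le_iff of_nat_power)
  next
    fix w assume w: "w \<in> {w\<in>mvec p {..<n}. s < card (supp w)}"
    show "measure_pmf.prob (columns n N \<xi>) {X. \<forall>t<N. kills p {..<n} (X t) w} \<le> qmean p \<xi> l ^ N"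
      by (rule prob_columns_all_kill) (use w p l in auto)
  qed (auto simp: qmean_nonneg)
qed (auto intro: finite_subset[of _ "{..P0}"])

section \<open>Deterministic combination of the events\<close>

text \<open>Without rank failures modulo \<open>p0\<close> the kernel at time \<open>j\<close> has
  dimension \<open>n - j\<close>. The complement of an information set \<open>I\<close> of it has
  \<open>j\<close> rows, and a kernel vector supported there vanishes on \<open>I\<close>, hence is
  0.\<close>

lemma rows_ex:
  assumes nf: "\<And>t. t < n \<Longrightarrow> \<not> rankfail p0 n X t" and j: "j \<le> n"
  shows "\<exists>S. S \<subseteq> {..<n} \<and> card S = j \<and> lker p0 S X {..<j} = {\<lambda>_. 0}"
proof -
  have pp0: "p0 > 0" "p0 > 1" using p0 prime_gt_0_nat prime_gt_1_nat by auto
  let ?V = "ker p0 X j"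
  have sub: "msub p0 {..<n} ?V" by (rule msub_lker[OF pp0(1)])
  have e: "{r. r < j \<and> rankfail p0 n X r} = {}" using nf j by auto
  have "card ?V * p0 ^ j = p0 ^ (n - j) * p0 ^ j"
    using card_lker_rankfail[OF p0, of n X j] j unfolding e by (simp add: power_add[symmetric])
  hence cV: "card ?V = p0 ^ (n - j)" using pp0 by simp
  obtain I where I: "I \<subseteq> {..<n}" "info p0 ?V I"
  proof -
    have "\<exists>I\<subseteq>{..<n}. info p0 ?V I"
    proof (rule info_ex[OF sub p0])
      fix v assume "v \<in> ?V" "\<forall>i\<in>{..<n}. v i = 0"
      thus "v = (\<lambda>_. 0)" by (auto simp: lker_def mvec_iff fun_eq_iff)
    qed auto
    thus ?thesis using that by blast
  qed
  have fI: "finite I" using I finite_subset by blast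
  have "p0 ^ card I = p0 ^ (n - j)" using info_card[OF I(2) fI] cV by simp
  hence cI: "card I = n - j" using pp0 by (simp add: power_inject_exp)
  define S where "S = {..<n} - I"
  have cS: "card S = j" using cI I fI j by (simp add: S_def card_Diff_subset)
  have "v = (\<lambda>_. 0)" if v: "v \<in> lker p0 S X {..<j}" for v
  proof -
    have "v \<in> ?V" using lker_mono_rows[OF _ _ pp0(1) v] by (simp add: S_def)
    moreover have "restr I v = restr I (\<lambda>_. 0)"
      using v by (auto simp: restr_def lker_def mvec_iff S_def fun_eq_iff)
    moreover have "inj_on (restr I) ?V" using I(2) by (simp add: info_def bij_betw_def)
    ultimately show ?thesis using zero_in_lker[OF pp0(1), of "{..<n}" X "{..<j}"] by (metis inj_onD)
  qed
  hence "lker p0 S X {..<j} \<subseteq> {\<lambda>_. 0}" by blast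
  moreover have "{\<lambda>_. 0} \<subseteq> lker p0 S X {..<j}" using zero_in_lker[OF pp0(1), of S X "{..<j}"] by blast
  ultimately have "lker p0 S X {..<j} = {\<lambda>_. 0}" by (rule equalityI)
  moreover have "S \<subseteq> {..<n}" by (simp add: S_def)
  ultimately show ?thesis using cS by blast
qed

lemma entries_le:
  assumes X: "X \<in> set_pmf (columns n N \<xi>)" and "t < N" "i < n"
  shows "real_of_int \<bar>X t i\<bar> \<le> K"
proof -
  have "X t \<in> set_pmf Col" using X assms by (auto simp: columns_def set_Pi_pmf PiE_dflt_def)
  hence "X t i \<in> set_pmf \<xi>" using assms by (auto simp: set_Pi_pmf PiE_dflt_def)
  thus ?thesis using K by simp
qed

text \<open>A nontrivial kernel after \<open>n + u\<close> columns means at least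
  \<open>u + 1\<close> rank failures modulo \<open>p\<close>. For large \<open>p\<close> the first
  one makes \<open>p\<close> a bad prime with few choices, and the others are late failures; small
  primes are covered by \<open>Dense\<close>.\<close>

lemma ker_trivial:
  assumes p: "prime p" and X: "X \<in> set_pmf (columns n N \<xi>)"
    and e1: "\<not> small_ker p0 s n X i0" and e2: "X \<notin> Sparse" and e3: "\<not> (\<exists>t<n. fail p0 X t)"
    and e4: "X \<notin> Dense"
    and e5: "\<not> (\<exists>j\<in>{..n}. \<exists>b\<in>{..<B}. u \<le> card {t. t < N \<and> late_fail j b X t})"
  shows "ker p X N = {\<lambda>_. 0}"
proof (rule ccontr)
  assume nt: "ker p X N \<noteq> {\<lambda>_. 0}"
  have pp: "p > 0" "p > 1" using p prime_gt_0_nat prime_gt_1_nat by auto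
  have pp0: "p0 > 0" "p0 > 1" using p0 prime_gt_0_nat prime_gt_1_nat by auto
  have nsk: "\<not> small_ker q s n X t" if "prime q" "i0 \<le> t" for q t
  proof -
    have "\<not> small_ker q s n X i0" using Sparse_if_small_ker[OF that(1) X _ e1] e2 by blast
    moreover have "ker q X t \<subseteq> ker q X i0" using that by (intro lker_antimono) auto
    ultimately show ?thesis unfolding small_ker_def by blast
  qed
  \<comment> \<open>Before time \<open>n\<close> the kernel modulo \<open>p0\<close> is nontrivial
    by counting, so a rank failure would be a \<open>fail\<close>.\<close>
  have nf0: "\<not> rankfail p0 n X t" if t: "t < n" for t
  proof -
    have "p0 ^ n \<le> card (ker p0 X t) * p0 ^ t"
      using lker_card_lower[OF p0, of "{..<n}" "{..<t}" X] by simp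
    hence "p0 ^ (n - t) * p0 ^ t \<le> card (ker p0 X t) * p0 ^ t" using t by (simp add: power_add[symmetric])
    hence "p0 ^ (n - t) \<le> card (ker p0 X t)" using pp0 by simp
    moreover have "1 < p0 ^ (n - t)" using pp0(2) t by (intro one_less_power) auto
    ultimately have "ker p0 X t \<noteq> {\<lambda>_. 0}" by auto
    thus ?thesis using e3 t nsk[OF p0] by (auto simp: fail_def)
  qed
  have ntt: "ker p X t \<noteq> {\<lambda>_. 0}" if "t \<le> N" for t
  proof -
    have "ker p X N \<subseteq> ker p X t" using that by (intro lker_antimono) auto
    thus ?thesis using nt zero_in_lker[OF pp(1), of "{..<n}" X "{..<N}"] by auto
  qed
  have fl: "fail p X t" if "t < N" "rankfail p n X t" for t
    using that ntt[of t] nsk[OF p, of t] by (auto simp: fail_def)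
  show False
  proof (cases "p \<le> P0")
    case True
    obtain w where w: "w \<in> ker p X N" "w \<noteq> (\<lambda>_. 0)" using nt zero_in_lker[OF pp(1), of "{..<n}" X "{..<N}"] by blast
    have "s < card (supp w)" using nsk[OF p, of N] w i0 unfolding small_ker_def by force
    moreover have "w \<in> mvec p {..<n}" "\<forall>t<N. kills p {..<n} (X t) w" using w by (auto simp: lker_def)
    ultimately show False using e4 p True unfolding Dense_def by blast
  next
    case False
    define F where "F = {t. t < N \<and> rankfail p n X t}"
    have fF: "finite F" by (simp add: F_def)
    have "p * p ^ N \<le> card (ker p X N) * p ^ N" using lker_nontrivial_card[OF p _ nt] by simp
    also have "\<dots> = p ^ (n + card F)" unfolding F_def by (rule card_lker_rankfail[OF p])
    finally have "p ^ Suc N \<le> p ^ (n + card F)" by simp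
    hence "Suc N \<le> n + card F" using power_increasing_iff[OF pp(2)] by blast
    hence cF: "u + 1 \<le> card F" by simp
    hence Fne: "F \<noteq> {}" by auto
    define j0 where "j0 = Min F"
    have j0F: "j0 \<in> F" and j0min: "\<And>t. t \<in> F \<Longrightarrow> j0 \<le> t" using fF Fne by (auto simp: j0_def)
    have j0N: "j0 < N" "rankfail p n X j0" using j0F by (auto simp: F_def)
    have "\<not> rankfail p n X r" if "r < j0" for r using j0min[of r] that j0N(1) by (auto simp: F_def)
    hence bf: "{r. r < j0 \<and> rankfail p n X r} = {}" by blast
    have "p * p ^ j0 \<le> card (ker p X j0) * p ^ j0" using lker_nontrivial_card[OF p _ ntt[of j0]] j0N by simp
    also have "\<dots> = p ^ n" using card_lker_rankfail[OF p, of n X j0] bf by simp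
    finally have "p ^ Suc j0 \<le> p ^ n" by simp
    \<comment> \<open>No column failed before \<open>j0\<close>, so the nontrivial kernel at that
      time has dimension exactly \<open>n - j0\<close>.\<close>
    hence jn: "Suc j0 \<le> n" using power_increasing_iff[OF pp(2)] by blast
    \<comment> \<open>The failing column itself is included, so that the kernel at time
      \<open>j\<close> has dimension \<open>n - j + 1\<close>.\<close>
    define j where "j = Suc j0"
    have "{r. r < j \<and> rankfail p n X r} = {j0}" using bf j0N by (auto simp: j_def less_Suc_eq)
    hence cj: "card (ker p X j) * p ^ j = p ^ (n + 1)" using card_lker_rankfail[OF p, of n X j] by simp
    define S where "S = rows j X"
    have S: "S \<subseteq> {..<n}" "card S = j" "lker p0 S X {..<j} = {\<lambda>_. 0}"
      using someI_ex[OF rows_ex[OF nf0, of j]] jn by (auto simp: S_def rows_def j_def)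
    have fS: "finite S" using S finite_subset by blast
    \<comment> \<open>Were the square submatrix invertible modulo \<open>p\<close>, a kernel vector
      would be determined by its \<open>n - j\<close> coordinates off \<open>S\<close>, too few for
      dimension \<open>n - j + 1\<close>.\<close>
    have pb: "p \<in> bad_primes S X {..<j}"
    proof (rule ccontr)
      assume "p \<notin> bad_primes S X {..<j}"
      hence triv: "lker p S X {..<j} = {\<lambda>_. 0}" using p by (simp add: bad_primes_def)
      have sub: "msub p {..<n} (ker p X j)" by (rule msub_lker[OF pp(1)])
      have "inj_on (restr ({..<n} - S)) (ker p X j)"
      proof (rule msub_restr_inj[OF sub p])
        fix v assume v: "v \<in> ker p X j" "\<forall>i\<in>{..<n} - S. v i = 0"
        have "supp v \<subseteq> S" using v supp_mvec[of v p "{..<n}"] by (auto simp: lker_def supp_def)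
        hence "v \<in> lker p S X {..<j}"
          using lker_mono_rows[OF _ fS pp(1) lker_supp[OF v(1) _ pp(1)]] by simp
        thus "v = (\<lambda>_. 0)" using triv by simp
      qed
      moreover have "restr ({..<n} - S) ` ker p X j \<subseteq> mvec p ({..<n} - S)"
        using mvecD[OF _ pp(1), of _ "{..<n}"] by (auto simp: restr_def mvec_iff[of _ _ "{..<n} - S"] lker_def)
      ultimately have "card (ker p X j) \<le> card (mvec p ({..<n} - S))"
        by (intro card_inj_on_le[of "restr ({..<n} - S)"]) auto
      also have "\<dots> = p ^ (n - j)" using S fS by (simp add: card_mvec card_Diff_subset)
      finally have "card (ker p X j) * p ^ j \<le> p ^ (n - j) * p ^ j" by (rule mult_le_mono1)
      moreover have "p ^ (n - j) * p ^ j = p ^ n" using jn by (simp only: power_add[symmetric] j_def) simp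
      ultimately have "p ^ (n + 1) \<le> p ^ n" by (simp only: cj)
      hence "n + 1 \<le> n" using power_increasing_iff[OF pp(2)] by blast
      thus False by simp
    qed
    have KA: "real_of_int \<bar>X t i\<bar> \<le> K" if "t \<in> {..<j}" "i \<in> S" for t i
      using that S jn by (intro entries_le[OF X]) (auto simp: j_def)
    note bp = card_bad_primes[OF p0 fS finite_lessThan _ S(3) KA]
    have cS: "card {..<j} = card S" using S by simp
    have "card S \<le> n" using S jn by (simp add: j_def)
    hence "(2::real) ^ card (bad_primes S X {..<j}) \<le> 2 ^ B" using bp(2)[OF cS] B[of "card S"] by linarith
    hence cB: "card (bad_primes S X {..<j}) \<le> B" by (simp add: power_increasing_iff)
    obtain b where b: "b < B" "is_bad b S X {..<j}" "nth_bad b S X {..<j} = p"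
      using bad_prime_index[OF pb bp(1)[OF cS] cB] by blast
    have "F - {j0} \<subseteq> {t. t < N \<and> late_fail j b X t}"
    proof
      fix t assume t: "t \<in> F - {j0}"
      hence "j0 < t" using j0min[of t] by auto
      thus "t \<in> {t. t < N \<and> late_fail j b X t}"
        using t b fl False by (auto simp: late_fail_def F_def S_def j_def)
    qed
    hence "card (F - {j0}) \<le> card {t. t < N \<and> late_fail j b X t}" by (intro card_mono) auto
    moreover have "card (F - {j0}) = card F - 1" using j0F by simp
    ultimately have "u \<le> card {t. t < N \<and> late_fail j b X t}" using cF by linarith
    thus False using e5 b(1) jn by (auto simp: j_def)
  qed
qed

lemma prob_ker_nontrivial:
  assumes g: "\<And>p t. prime p \<Longrightarrow> P0 < p \<Longrightarrow> t < N \<Longrightarrow> fbound p t \<le> g t" and g0: "\<And>t. 0 \<le> g t"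
    and l: "l \<le> s + 1" "l > 0"
  shows "measure_pmf.prob (columns n N \<xi>) {X. \<exists>p. prime p \<and> ker p X N \<noteq> {\<lambda>_. 0}} \<le>
    (\<Sum>\<sigma>=1..s. (real n ^ \<sigma> * real p0 ^ \<sigma>) * r \<sigma> ^ i0)
    + (\<Sum>\<sigma>=1..s. real n ^ \<sigma> * (real n ^ \<sigma> * (real n ^ (\<sigma> - 1) * (real B * r \<sigma> ^ (i0 - 2 * \<sigma>)))))
    + (\<Sum>t<n. fbound p0 t)
    + (\<Sum>p | prime p \<and> p \<le> P0. real p ^ n * qmean p \<xi> l ^ N)
    + real (n + 1) * (real B * (\<Sum>t<N. g t) ^ u)"
proof -
  let ?P = "columns n N \<xi>"
  define A where "A = {X. \<exists>p. prime p \<and> ker p X N \<noteq> {\<lambda>_. 0}}"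
  define A1 where "A1 = {X. small_ker p0 s n X i0}"
  define A3 where "A3 = {X. \<exists>t<n. fail p0 X t}"
  define A5 where "A5 = {X. \<exists>j\<in>{..n}. \<exists>b\<in>{..<B}. u \<le> card {t. t < N \<and> late_fail j b X t}}"
  have un: "measure_pmf.prob ?P (Y \<union> Z) \<le> measure_pmf.prob ?P Y + measure_pmf.prob ?P Z" for Y Z
    by (rule measure_Un_le) auto
  have "measure_pmf.prob ?P A5 \<le> real (n + 1) * (real B * (\<Sum>t<N. g t) ^ u)"
    unfolding A5_def
    by (intro prob_Bex_le_card prob_late_fail g g0) (auto intro!: mult_nonneg_nonneg zero_le_power sum_nonneg g0)
  moreover have "measure_pmf.prob ?P A = measure_pmf.prob ?P (A \<inter> set_pmf ?P)" by (rule measure_Int_set_pmf[symmetric])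
  moreover have "A \<inter> set_pmf ?P \<subseteq> A1 \<union> Sparse \<union> A3 \<union> Dense \<union> A5"
    using ker_trivial unfolding A_def A1_def A3_def A5_def by blast
  hence "measure_pmf.prob ?P (A \<inter> set_pmf ?P) \<le> measure_pmf.prob ?P (A1 \<union> Sparse \<union> A3 \<union> Dense \<union> A5)"
    by (intro measure_pmf.finite_measure_mono) auto
  ultimately show ?thesis
    using prob_small_ker_p0 prob_Sparse prob_p0_fail prob_Dense[OF l]
      un[of "A1 \<union> Sparse \<union> A3 \<union> Dense" A5] un[of "A1 \<union> Sparse \<union> A3" Dense] un[of "A1 \<union> Sparse" A3] un[of A1 Sparse]
    unfolding A_def[symmetric] A1_def[symmetric] A3_def[symmetric] by linarith
qed

end

section \<open>Asymptotics\<close>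

lemma sum_power_le:
  fixes a :: real
  assumes "0 \<le> a" "a \<le> 1"
  shows "(\<Sum>\<sigma>=1..s. a ^ \<sigma>) \<le> real s * a"
proof -
  have "(\<Sum>\<sigma>=1..s. a ^ \<sigma>) \<le> (\<Sum>\<sigma>=1..s. a)"
    using assms power_decreasing[of 1 _ a] by (intro sum_mono) auto
  thus ?thesis by simp
qed

lemma sum_geometric_le:
  fixes z :: real
  assumes "0 \<le> z" "z \<le> 1 / 2"
  shows "(\<Sum>t<n. z ^ (n - t)) \<le> 2 * z"
proof -
  have "(\<Sum>t<n. z ^ (n - t)) = (\<Sum>k<n. z ^ Suc k)"
    by (rule sum.reindex_bij_witness[of _ "\<lambda>k. n - Suc k" "\<lambda>t. n - Suc t"]) (auto simp del: power_Suc simp: Suc_diff_Suc)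
  also have "\<dots> = z * (\<Sum>k<n. z ^ k)" by (simp add: sum_distrib_left)
  also have "\<dots> \<le> z * 2"
  proof (rule mult_left_mono)
    have "(\<Sum>k<n. z ^ k) \<le> (\<Sum>k<n. (1 / 2) ^ k)" using assms by (intro sum_mono power_mono) auto
    also have "\<dots> \<le> 2" by (simp add: sum_gp_strict)
    finally show "(\<Sum>k<n. z ^ k) \<le> 2" .
  qed (use assms in auto)
  finally show ?thesis by simp
qed

lemma sum_inverse_squares_le: "(\<Sum>p=2..m. 1 / real p ^ 2) \<le> 1"
proof -
  have "(\<Sum>p=2..m. 1 / real p ^ 2) \<le> 1 - 1 / real m" if "m \<ge> 1"
    using that
  proof (induction m rule: dec_induct)
    case (step m)
    have m: "real m \<ge> 1" using step by simp
    have "1 / real (Suc m) ^ 2 \<le> 1 / (real m * real (Suc m))"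
      using m by (intro divide_left_mono) (auto simp: power2_eq_square intro!: mult_right_mono)
    also have "\<dots> = 1 / real m - 1 / real (Suc m)" using m by (simp add: field_simps)
    finally have "1 / real (Suc m) ^ 2 \<le> 1 / real m - 1 / real (Suc m)" .
    thus ?case using step by simp
  qed simp
  thus ?thesis by (cases "m \<ge> 1") (auto intro: order_trans)
qed

lemma sum_primes_power_le:
  assumes "u \<ge> 2"
  shows "(\<Sum>p | prime p \<and> p \<le> P. 1 / real p ^ u) \<le> 4 / 2 ^ u"
proof -
  have "(\<Sum>p | prime p \<and> p \<le> P. 1 / real p ^ u) \<le> (\<Sum>p=2..P. 1 / real p ^ u)"
    by (rule sum_mono2) (auto simp: prime_ge_2_nat)
  also have "\<dots> \<le> (\<Sum>p=2..P. 1 / 2 ^ (u - 2) * (1 / real p ^ 2))"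
  proof (rule sum_mono)
    fix p assume p: "p \<in> {2..P}"
    have "(2::real) ^ (u - 2) * real p ^ 2 \<le> real p ^ (u - 2) * real p ^ 2"
      using p by (intro mult_right_mono power_mono) auto
    also have "\<dots> = real p ^ u" by (simp only: power_add[symmetric] le_add_diff_inverse2[OF assms])
    finally show "1 / real p ^ u \<le> 1 / 2 ^ (u - 2) * (1 / real p ^ 2)"
      using p by (simp add: frac_le)
  qed
  also have "\<dots> = 1 / 2 ^ (u - 2) * (\<Sum>p=2..P. 1 / real p ^ 2)" by (rule sum_distrib_left[symmetric])
  also have "\<dots> \<le> 1 / 2 ^ (u - 2) * 1" by (intro mult_left_mono sum_inverse_squares_le) auto
  also have "\<dots> = 4 / 2 ^ u"
  proof -
    have "(2::real) ^ u = 2 ^ (u - 2) * 2 ^ 2" by (simp only: power_add[symmetric] le_add_diff_inverse2[OF assms])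
    thus ?thesis by simp
  qed
  finally show ?thesis .
qed

text \<open>This bounds the binary logarithm of every minor by \<open>n\<^sup>2\<close>. For
  \<open>k = n\<close> the logarithm is really of order \<open>n * ln n\<close>, but any fixed power
  of \<open>n\<close> can be absorbed by the choice of \<open>u\<close>.\<close>

lemma fact_power_le:
  fixes x T :: real
  assumes x: "x = real n" "x \<ge> 1" and T: "T > 0" and k: "k \<le> n" and l: "(1 + T) * ln x \<le> x * ln 2"
  shows "fact k * (x powr T) ^ k \<le> 2 ^ (n\<^sup>2)"
proof -
  have "fact k \<le> real (k ^ k)" using fact_le_power[of k] by simp
  also have "\<dots> \<le> x ^ k" using k x(1) by (simp add: power_mono)
  finally have f: "fact k \<le> x ^ k" .
  have x1: "1 \<le> x powr (1 + T)" using x T by (intro ge_one_powr_ge_zero) auto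
  have "fact k * (x powr T) ^ k \<le> x ^ k * (x powr T) ^ k" using f by (intro mult_right_mono) auto
  also have "\<dots> = (x powr (1 + T)) ^ k" using x by (simp add: power_mult_distrib[symmetric] powr_add)
  also have "\<dots> \<le> (x powr (1 + T)) ^ n" using k x1 by (intro power_increasing) auto
  also have "x powr (1 + T) \<le> 2 ^ n"
  proof -
    have "x powr (1 + T) = exp ((1 + T) * ln x)" using x by (simp add: powr_def)
    also have "\<dots> \<le> exp (x * ln 2)" using l by simp
    also have "\<dots> = 2 ^ n" using x by (simp add: powr_realpow[symmetric] powr_def)
    finally show ?thesis .
  qed
  hence "(x powr (1 + T)) ^ n \<le> (2 ^ n) ^ n" by (intro power_mono) auto
  also have "\<dots> = 2 ^ (n\<^sup>2)" by (simp add: power_mult[symmetric] power2_eq_square)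
  finally show ?thesis .
qed

lemma powr_mult_eq:
  fixes x :: real
  assumes "a + b = c"
  shows "x powr a * x powr b = x powr c"
  using powr_add[of x a b] assms by simp

lemma powr_square_eq:
  fixes x :: real
  assumes "2 * a = c"
  shows "(x powr a) ^ 2 = x powr c"
  using powr_mult_eq[of a a c x] assms by (simp add: power2_eq_square)

text \<open>The scales: supports up to \<open>n powr (1 - \<epsilon>/2)\<close> are sparse, codimensions are capped at
  \<open>n powr (\<epsilon>/8)\<close>, and primes up to \<open>n powr (\<epsilon>/16)\<close> are small.\<close>
lemma prob_nontrivial_le:
  fixes \<epsilon> T \<alpha> x z0 :: real and n u p0 :: nat and \<xi> :: "int pmf"
  defines "x \<equiv> real n" and "z0 \<equiv> sqrt (2 / real p0)"
  assumes \<epsilon>: "0 < \<epsilon>" "\<epsilon> < 1" and T: "0 < T" and bal: "balanced \<alpha> \<xi>" and \<alpha>: "\<alpha> \<ge> x powr (- 1 + \<epsilon>)"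
    and bd: "\<And>y. y \<in> set_pmf \<xi> \<Longrightarrow> \<bar>real_of_int y\<bar> \<le> x powr T"
    and p0: "prime p0" "8 \<le> p0" and u: "u \<ge> 2" "real u * \<epsilon> \<ge> 256"
    and n: "x \<ge> 16"
    and f1: "16 \<le> x powr (\<epsilon> / 2)"
    and f2: "(1 + T) * ln x \<le> x * ln 2"
    and f3: "4 * x powr (- \<epsilon> / 16) + exp (- 2 * x powr (\<epsilon> / 8)) \<le> x powr (- \<epsilon> / 32)"
    and f4: "(x + u) * (exp (- (x powr (\<epsilon> / 2)) / 16) + 2 * (1 / 2) powr (x powr (\<epsilon> / 8))) \<le> x powr (- \<epsilon> / 64)"
    and f5: "x * exp (- (x powr (3 * \<epsilon> / 8)) / 2) \<le> 1 / (x + u)"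
    and f6: "exp (- 2 * x powr (\<epsilon> / 4) / real p0 ^ 2) \<le> 1 / p0"
    and f7: "x * real p0 * exp (- (x powr (\<epsilon> / 2)) / 32) \<le> 1"
    and f8: "x ^ 3 * exp (- (x powr (\<epsilon> / 2)) / 32) \<le> 1"
    and f9: "x powr (- \<epsilon> / 64) \<le> 1 / 2"
  shows "measure_pmf.prob (columns n (n + u) \<xi>) {X. \<exists>p. prime p \<and> lker p {..<n} X {..<n + u} \<noteq> {\<lambda>_. 0}} \<le>
    2 * z0 + 12 / 2 ^ u + x ^ 2 * real p0 * exp (- (x powr (\<epsilon> / 2)) / 32) + x ^ 6 * exp (- (x powr (\<epsilon> / 2)) / 32)
    + x powr (- \<epsilon> / 64) + 2 * real (u + 3) ^ u / x"
proof -
  have x0: "x > 0" "x \<ge> 1" using n by auto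
  define y where "y = x powr (\<epsilon> / 2)"
  define s where "s = nat \<lfloor>x powr (1 - \<epsilon> / 2)\<rfloor>"
  define D where "D = nat \<lfloor>x powr (\<epsilon> / 8)\<rfloor>"
  define P0 where "P0 = nat \<lfloor>x powr (\<epsilon> / 16)\<rfloor>"
  define i0 where "i0 = n div 2"
  \<comment> \<open>The square root, coming from \<open>qmean_le_sqrt\<close>, of the bound in
    \<open>Theta_le_exp\<close>; it is free of the prime.\<close>
  define r where "r \<sigma> = exp (- min (real \<sigma> * \<alpha>) (1 / 2) / 4)" for \<sigma> :: nat
  define z1 where "z1 = x powr (- \<epsilon> / 64)"
  have "0 < x powr (- 1 + \<epsilon>)" using x0 by simp
  hence \<alpha>0: "\<alpha> > 0" using \<alpha> by linarith
  have s_le: "real s \<le> x powr (1 - \<epsilon> / 2)" and s_gt: "x powr (1 - \<epsilon> / 2) < real s + 1" by (auto simp: s_def)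
  have D_le: "real D \<le> x powr (\<epsilon> / 8)" and D_gt: "x powr (\<epsilon> / 8) < real D + 1" by (auto simp: D_def)
  have P_gt: "x powr (\<epsilon> / 16) < real P0 + 1" and P_le: "real P0 \<le> x powr (\<epsilon> / 16)" by (auto simp: P0_def)
  have xs: "x powr (1 - \<epsilon> / 2) * y = x" using x0 by (simp add: y_def powr_add[symmetric])
  have s16: "real s \<le> x / 16"
  proof -
    have "real s * 16 \<le> x powr (1 - \<epsilon> / 2) * y" using s_le f1 by (intro mult_mono) (auto simp: y_def)
    thus ?thesis using xs by simp
  qed
  have D1: "D \<ge> 1"
  proof -
    have "1 \<le> x powr (\<epsilon> / 8)" using x0 \<epsilon> by (intro ge_one_powr_ge_zero) auto
    thus ?thesis by (simp add: D_def le_nat_floor)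
  qed
  have s1: "s \<ge> 1"
  proof -
    have "1 \<le> x powr (1 - \<epsilon> / 2)" using x0 \<epsilon> by (intro ge_one_powr_ge_zero) auto
    thus ?thesis by (simp add: s_def le_nat_floor)
  qed
  have i0: "real i0 \<ge> (x - 1) / 2" "i0 \<le> n"
  proof -
    have "n \<le> 2 * i0 + 1" by (simp add: i0_def)
    hence "real n \<le> real (2 * i0 + 1)" by (simp only: of_nat_le_iff)
    thus "real i0 \<ge> (x - 1) / 2" by (simp add: x_def)
    show "i0 \<le> n" by (simp add: i0_def)
  qed
  have "2 * real s \<le> x / 8" using s16 by simp
  also have "x / 8 \<le> (x - 1) / 2" using n by (simp add: field_simps)
  finally have "2 * real s \<le> real i0" using i0(1) by (rule order_trans)
  hence s2: "2 * s \<le> i0" by simp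
  have q_r: "qmean p \<xi> \<sigma> \<le> r \<sigma>" if p: "prime p" for p \<sigma>
  proof -
    have "qmean p \<xi> \<sigma> \<le> sqrt (Theta p (\<sigma> * \<alpha>))" by (rule qmean_le_sqrt[OF p bal \<alpha>0])
    also have "\<dots> \<le> sqrt (exp (- min (\<sigma> * \<alpha>) (1 / 2) / 2))"
      using Theta_le_exp[OF prime_gt_1_nat[OF p], of "\<sigma> * \<alpha>"] \<alpha>0 by simp
    also have "\<dots> = sqrt (r \<sigma> ^ 2)" by (simp add: r_def power2_eq_square exp_add[symmetric])
    also have "\<dots> = r \<sigma>" by (simp add: r_def)
    finally show ?thesis .
  qed
  have r_le: "r \<sigma> \<le> 1" for \<sigma> using \<alpha>0 by (simp add: r_def)
  interpret R: random_columns n u s D "n\<^sup>2" i0 P0 p0 "x powr T" \<xi> r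
  proof
    show "2 * s \<le> i0" by (rule s2)
    fix k assume "k \<le> n"
    thus "fact k * (x powr T) ^ k \<le> 2 ^ (n\<^sup>2)"
      using fact_power_le[OF _ x0(2) T _ f2] by (simp add: x_def)
  qed (use p0 D1 i0 q_r r_le bd in auto)
  \<comment> \<open>The origin of the sparsity threshold. If the minimum is
    \<open>\<sigma> * \<alpha>\<close>, then
    \<open>x * \<alpha> \<ge> x powr \<epsilon> \<ge> y\<close>; if it is 1/2, then
    \<open>\<sigma> * y \<le> x\<close> because \<open>\<sigma> \<le> s\<close>.\<close>
  have min_ge: "x * min (real \<sigma> * \<alpha>) (1 / 2) \<ge> real \<sigma> * y / 2" if \<sigma>: "\<sigma> \<le> s" for \<sigma>
  proof -
    have "real \<sigma> * y \<le> x powr (1 - \<epsilon> / 2) * y" using \<sigma> s_le by (intro mult_right_mono) (auto simp: y_def)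
    hence 1: "real \<sigma> * y \<le> x" using xs by simp
    have "x * x powr (- 1 + \<epsilon>) = x powr \<epsilon>" using powr_add[of x 1 "- 1 + \<epsilon>"] x0 by simp
    moreover have "y \<le> x powr \<epsilon>" unfolding y_def using x0 \<epsilon> by (intro powr_mono) auto
    ultimately have "y \<le> x * \<alpha>" using mult_left_mono[OF \<alpha>, of x] x0 by linarith
    hence "real \<sigma> * y \<le> real \<sigma> * (x * \<alpha>)" by (intro mult_left_mono) auto
    moreover have "0 \<le> real \<sigma> * y" by (simp add: y_def)
    ultimately have "real \<sigma> * y / 2 \<le> x * (real \<sigma> * \<alpha>)" by (simp add: mult_ac)
    thus ?thesis using 1 x0 by (auto simp: min_def)
  qed
  \<comment> \<open>A quarter of the \<open>n\<close> columns already yields a factor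
    \<open>exp (- y / 32)\<close> per element of the support, which beats the polynomial number of
    choices per element.\<close>
  have r_pow: "r \<sigma> ^ k \<le> exp (- y / 32) ^ \<sigma>" if \<sigma>: "\<sigma> \<le> s" and k: "real k \<ge> x / 4" for \<sigma> k
  proof -
    have m0: "min (real \<sigma> * \<alpha>) (1 / 2) \<ge> 0" using \<alpha>0 by simp
    have "real k * min (real \<sigma> * \<alpha>) (1 / 2) \<ge> x / 4 * min (real \<sigma> * \<alpha>) (1 / 2)"
      using k m0 by (intro mult_right_mono)
    hence "real k * (min (real \<sigma> * \<alpha>) (1 / 2) / 4) \<ge> real \<sigma> * (y / 32)"
      using min_ge[OF \<sigma>] by (simp add: mult.commute)
    hence "exp (real k * (- min (real \<sigma> * \<alpha>) (1 / 2) / 4)) \<le> exp (real \<sigma> * (- y / 32))" by simp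
    thus ?thesis unfolding r_def exp_of_nat_mult[symmetric] .
  qed
  let ?e = "exp (- y / 32)"
  have sx: "real s \<le> x" using s16 x0 by linarith
  have r_nonneg: "r \<sigma> \<ge> 0" for \<sigma> by (simp add: r_def)
  have E1: "(\<Sum>\<sigma>=1..s. (real n ^ \<sigma> * real p0 ^ \<sigma>) * r \<sigma> ^ i0) \<le> x ^ 2 * real p0 * ?e"
  proof -
    have "(\<Sum>\<sigma>=1..s. (real n ^ \<sigma> * real p0 ^ \<sigma>) * r \<sigma> ^ i0) \<le> (\<Sum>\<sigma>=1..s. (x * real p0 * ?e) ^ \<sigma>)"
    proof (rule sum_mono)
      fix \<sigma> assume \<sigma>: "\<sigma> \<in> {1..s}"
      have "r \<sigma> ^ i0 \<le> ?e ^ \<sigma>" by (rule r_pow) (use \<sigma> i0 n in auto)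
      thus "(real n ^ \<sigma> * real p0 ^ \<sigma>) * r \<sigma> ^ i0 \<le> (x * real p0 * ?e) ^ \<sigma>"
        unfolding power_mult_distrib x_def[symmetric] using x0 by (intro mult_left_mono) auto
    qed
    also have "\<dots> \<le> real s * (x * real p0 * ?e)"
      by (rule sum_power_le) (use x0 f7 in \<open>auto simp: y_def\<close>)
    also have "\<dots> \<le> x * (x * real p0 * ?e)" using sx x0 by (intro mult_right_mono) auto
    finally show ?thesis by (simp add: power2_eq_square mult_ac)
  qed
  have E2: "(\<Sum>\<sigma>=1..s. real n ^ \<sigma> * (real n ^ \<sigma> * (real n ^ (\<sigma> - 1) * (real (n\<^sup>2) * r \<sigma> ^ (i0 - 2 * \<sigma>))))) \<le> x ^ 6 * ?e"
  proof -
    have "(\<Sum>\<sigma>=1..s. real n ^ \<sigma> * (real n ^ \<sigma> * (real n ^ (\<sigma> - 1) * (real (n\<^sup>2) * r \<sigma> ^ (i0 - 2 * \<sigma>)))))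
      \<le> (\<Sum>\<sigma>=1..s. x\<^sup>2 * (x ^ 3 * ?e) ^ \<sigma>)"
    proof (rule sum_mono)
      fix \<sigma> assume \<sigma>: "\<sigma> \<in> {1..s}"
      have "i0 \<le> (i0 - 2 * \<sigma>) + 2 * s" using \<sigma> by auto
      hence "real i0 \<le> real ((i0 - 2 * \<sigma>) + 2 * s)" by (simp only: of_nat_le_iff)
      hence "real i0 - 2 * real s \<le> real (i0 - 2 * \<sigma>)" by simp
      moreover have "x / 4 \<le> (x - 1) / 2 - x / 8" using n by (simp add: field_simps)
      ultimately have k: "real (i0 - 2 * \<sigma>) \<ge> x / 4" using s16 i0(1) by linarith
      have rr: "r \<sigma> ^ (i0 - 2 * \<sigma>) \<le> ?e ^ \<sigma>" by (rule r_pow) (use \<sigma> k in auto)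
      have "x ^ \<sigma> * (x ^ \<sigma> * (x ^ (\<sigma> - 1) * (x\<^sup>2 * r \<sigma> ^ (i0 - 2 * \<sigma>))))
        \<le> x ^ \<sigma> * (x ^ \<sigma> * (x ^ \<sigma> * (x\<^sup>2 * ?e ^ \<sigma>)))"
        using x0 rr r_nonneg by (intro mult_mono mult_left_mono power_increasing mult_nonneg_nonneg) auto
      also have "\<dots> = x\<^sup>2 * (x ^ 3 * ?e) ^ \<sigma>"
        by (simp add: power_mult_distrib power_mult[symmetric] power3_eq_cube mult_ac)
      finally show "real n ^ \<sigma> * (real n ^ \<sigma> * (real n ^ (\<sigma> - 1) * (real (n\<^sup>2) * r \<sigma> ^ (i0 - 2 * \<sigma>)))) \<le> x\<^sup>2 * (x ^ 3 * ?e) ^ \<sigma>"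
        by (simp add: x_def)
    qed
    also have "\<dots> = x\<^sup>2 * (\<Sum>\<sigma>=1..s. (x ^ 3 * ?e) ^ \<sigma>)" by (rule sum_distrib_left[symmetric])
    also have "\<dots> \<le> x\<^sup>2 * (real s * (x ^ 3 * ?e))"
      by (intro mult_left_mono sum_power_le) (use x0 f8 in \<open>auto simp: y_def\<close>)
    also have "\<dots> \<le> x\<^sup>2 * (x * (x ^ 3 * ?e))" using sx x0 by (intro mult_left_mono mult_right_mono) auto
    finally show ?thesis by (simp add: eval_nat_numeral mult_ac)
  qed
  \<comment> \<open>One summand for times before \<open>i0\<close>, one for capped and one for
    uncapped codimension; the last two together dominate the power whose exponent is their
    minimum.\<close>
  define G where "G z t = exp (- y / 16) + z ^ D + z ^ max (n - t) 1" for z :: real and t :: nat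
  have fb: "R.fbound p t \<le> G z t" if p: "prime p" and z: "0 \<le> z" "z \<le> 1" and Tz: "Theta p (x powr (\<epsilon> / 4)) \<le> z ^ 2" for p t z
  proof (cases "t < i0")
    case True
    have "qmean p \<xi> 1 ^ (n - t) \<le> r 1 ^ (n - t)" by (intro power_mono q_r p qmean_nonneg)
    also have "\<dots> \<le> exp (- y / 16)"
    proof -
      have "real (n - t) \<ge> x / 2" using True by (simp add: i0_def x_def)
      moreover have m0: "min (real 1 * \<alpha>) (1 / 2) \<ge> 0" using \<alpha>0 by simp
      ultimately have "real (n - t) * min (real 1 * \<alpha>) (1 / 2) \<ge> x / 2 * min (real 1 * \<alpha>) (1 / 2)"
        by (intro mult_right_mono)
      hence "real (n - t) * (min (real 1 * \<alpha>) (1 / 2) / 4) \<ge> y / 16" using min_ge[OF s1] by simp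
      hence "exp (real (n - t) * (- min (real 1 * \<alpha>) (1 / 2) / 4)) \<le> exp (- y / 16)" by simp
      thus ?thesis unfolding r_def exp_of_nat_mult[symmetric] .
    qed
    finally have "R.fbound p t \<le> exp (- y / 16)" using True by (simp add: R.fbound_def)
    moreover have "0 \<le> z ^ D" "0 \<le> z ^ max (n - t) 1" using z by auto
    ultimately show ?thesis by (simp add: G_def)
  next
    case False
    define d where "d = min (max (n - t) 1) D"
    have d: "d \<ge> 1" "d \<le> D" using D1 by (auto simp: d_def)
    define l where "l = s div d + 1"
    \<comment> \<open>\<open>l * d > s\<close> with \<open>d \<le> x powr (\<epsilon> / 8)\<close>
      gives \<open>l \<ge> x powr (1 - 5 * \<epsilon> / 8)\<close>, hence
      \<open>l * \<alpha> \<ge> x powr (3 * \<epsilon> / 8)\<close>.\<close>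
    have "s < l * d" using dividend_less_div_times[of d s] d by (simp add: l_def algebra_simps)
    hence "real s + 1 \<le> real l * real d" by (metis Suc_leI of_nat_Suc of_nat_le_iff of_nat_mult add.commute)
    also have "\<dots> \<le> real l * x powr (\<epsilon> / 8)" using d D_le by (intro mult_left_mono) auto
    finally have "x powr (1 - \<epsilon> / 2) \<le> real l * x powr (\<epsilon> / 8)" using s_gt by linarith
    hence "x powr (1 - \<epsilon> / 2) * x powr (- \<epsilon> / 8) \<le> real l * x powr (\<epsilon> / 8) * x powr (- \<epsilon> / 8)"
      by (intro mult_right_mono) auto
    hence "x powr (1 - 5 * \<epsilon> / 8) \<le> real l" using x0 by (simp add: mult.assoc powr_add[symmetric])
    hence "x powr (1 - 5 * \<epsilon> / 8) * x powr (- 1 + \<epsilon>) \<le> real l * \<alpha>" using \<alpha> by (intro mult_mono) auto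
    hence "x powr (3 * \<epsilon> / 8) \<le> real l * \<alpha>" by (simp add: powr_add[symmetric])
    moreover have "x powr (\<epsilon> / 4) \<le> x powr (3 * \<epsilon> / 8)" using x0 \<epsilon> by (intro powr_mono) auto
    ultimately have la: "x powr (\<epsilon> / 4) \<le> real l * \<alpha>" by linarith
    have "qmean p \<xi> l \<le> sqrt (Theta p (l * \<alpha>))" by (rule qmean_le_sqrt[OF p bal \<alpha>0])
    also have "\<dots> \<le> sqrt (z ^ 2)" by (rule real_sqrt_le_mono, rule order_trans[OF Theta_antimono[OF la] Tz])
    also have "\<dots> = z" using z by simp
    finally have "qmean p \<xi> l ^ d \<le> z ^ d" by (intro power_mono qmean_nonneg)
    also have "\<dots> \<le> z ^ D + z ^ max (n - t) 1" using z by (auto simp: d_def min_def)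
    finally have "R.fbound p t \<le> z ^ D + z ^ max (n - t) 1" using False by (simp add: R.fbound_def d_def l_def)
    moreover have "0 < exp (- y / 16)" by (rule exp_gt_zero)
    ultimately show ?thesis unfolding G_def by linarith
  qed
  \<comment> \<open>\<open>D + 1\<close> exceeds \<open>x powr (\<epsilon> / 8)\<close>, so the
    capped terms stay negligible even when summed over all \<open>n + u\<close> times.\<close>
  have half: "(x + u) * (exp (- y / 16) + z ^ D) \<le> z1" if z: "0 \<le> z" "z \<le> 1 / 2" for z
  proof -
    have "z ^ D \<le> (1 / 2) ^ D" using z by (intro power_mono) auto
    also have "\<dots> = 2 * (1 / 2) powr (real D + 1)" by (simp add: powr_add powr_realpow)
    also have "\<dots> \<le> 2 * (1 / 2) powr (x powr (\<epsilon> / 8))" using D_gt by (intro mult_left_mono powr_mono') auto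
    finally have "(x + u) * (exp (- y / 16) + z ^ D) \<le> (x + u) * (exp (- y / 16) + 2 * (1 / 2) powr (x powr (\<epsilon> / 8)))"
      using x0 by (intro mult_left_mono add_mono) auto
    thus ?thesis using f4 by (simp add: y_def z1_def)
  qed
  have geo: "(\<Sum>t<n. z ^ max (n - t) 1) \<le> 2 * z" if z: "0 \<le> z" "z \<le> 1 / 2" for z :: real
  proof -
    have "(\<Sum>t<n. z ^ max (n - t) 1) = (\<Sum>t<n. z ^ (n - t))"
      by (intro sum.cong refl arg_cong[of _ _ "(^) z"] max_absorb1) simp
    thus ?thesis using sum_geometric_le[OF z] by simp
  qed
  \<comment> \<open>\<open>Theta\<close> at \<open>p0\<close> will be at most \<open>2 / p0\<close>
    by \<open>f6\<close>, and \<open>p0 \<ge> 8\<close> keeps the ratio \<open>z0\<close> of the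
    geometric series at most 1/2.\<close>
  have z0: "0 \<le> z0" "z0 \<le> 1 / 2" "z0 ^ 2 = 2 / real p0"
  proof -
    have "2 / real p0 \<le> (1 / 2) ^ 2" using p0(2) by (simp add: field_simps)
    thus "z0 \<le> 1 / 2" unfolding z0_def by (intro real_le_lsqrt) auto
  qed (auto simp: z0_def)
  have E3: "(\<Sum>t<n. R.fbound p0 t) \<le> 2 * z0 + z1"
  proof -
    have "Theta p0 (x powr (\<epsilon> / 4)) \<le> 1 / p0 + exp (- 2 * x powr (\<epsilon> / 4) / real p0 ^ 2)"
      using p0 by (intro Theta_le_small) auto
    also have "\<dots> \<le> z0 ^ 2" using f6 z0 by simp
    finally have "(\<Sum>t<n. R.fbound p0 t) \<le> (\<Sum>t<n. G z0 t)" using z0 by (intro sum_mono fb p0) auto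
    also have "\<dots> = x * (exp (- y / 16) + z0 ^ D) + (\<Sum>t<n. z0 ^ max (n - t) 1)"
      unfolding G_def sum.distrib x_def by (simp add: distrib_left)
    also have "x * (exp (- y / 16) + z0 ^ D) \<le> (x + u) * (exp (- y / 16) + z0 ^ D)"
      using z0 by (intro mult_right_mono) auto
    finally show ?thesis using half[OF z0(1,2)] geo[OF z0(1,2)] by linarith
  qed
  have z1: "0 \<le> z1" "z1 \<le> 1 / 2" using f9 by (auto simp: z1_def)
  \<comment> \<open>\<open>Theta_le_large\<close> is used with
    \<open>d = x powr (- \<epsilon> / 16)\<close>, the inverse of the bound for small primes. Then
    \<open>2 / p\<close> is at most \<open>2 * d\<close>, and the exponent becomes
    \<open>- 2 * x powr (\<epsilon> / 8)\<close>.\<close>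
  have g: "R.fbound p t \<le> G z1 t" if p: "prime p" "P0 < p" for p t
  proof (rule fb[OF p(1)])
    have pp: "p > 0" using prime_gt_0_nat[OF p(1)] .
    have px: "x powr (\<epsilon> / 16) \<le> real p" using P_gt p(2) by linarith
    have "2 / real p \<le> 2 / x powr (\<epsilon> / 16)" using px x0 pp by (intro divide_left_mono) auto
    moreover have "x powr (- \<epsilon> / 16) = 1 / x powr (\<epsilon> / 16)" using powr_minus_divide[of x "\<epsilon> / 16"] by simp
    ultimately have p1: "2 / real p \<le> 2 * x powr (- \<epsilon> / 16)" by simp
    have "(x powr (- \<epsilon> / 16)) ^ 2 = x powr (- \<epsilon> / 8)" by (rule powr_square_eq) simp
    moreover have "x powr (\<epsilon> / 4) * x powr (- \<epsilon> / 8) = x powr (\<epsilon> / 8)" by (rule powr_mult_eq) simp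
    ultimately have p2: "- 2 * x powr (\<epsilon> / 4) * (x powr (- \<epsilon> / 16)) ^ 2 = - 2 * x powr (\<epsilon> / 8)"
      by (simp only: mult.assoc)
    have "Theta p (x powr (\<epsilon> / 4)) \<le> 2 * x powr (- \<epsilon> / 16) + 2 / p + exp (- 2 * x powr (\<epsilon> / 4) * (x powr (- \<epsilon> / 16)) ^ 2)"
      by (intro Theta_le_large pp) auto
    hence "Theta p (x powr (\<epsilon> / 4)) \<le> 4 * x powr (- \<epsilon> / 16) + exp (- 2 * x powr (\<epsilon> / 8))"
      unfolding p2 using p1 by linarith
    also have "\<dots> \<le> x powr (- \<epsilon> / 32)" by (rule f3)
    also have "x powr (- \<epsilon> / 32) = z1 ^ 2" unfolding z1_def by (rule powr_square_eq[symmetric]) simp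
    finally show "Theta p (x powr (\<epsilon> / 4)) \<le> z1 ^ 2" .
  qed (use z1 in auto)
  have G0: "0 \<le> G z1 t" for t using z1 by (simp add: G_def)
  \<comment> \<open>Times before \<open>n\<close> sum geometrically, the last \<open>u\<close>
    contribute \<open>z1\<close> each. Since \<open>u * \<epsilon> / 64 \<ge> 4\<close>, the
    \<open>u\<close>-th power gains \<open>x ^ 4\<close> against the at most
    \<open>2 * x ^ 3\<close> pairs of a time and an index.\<close>
  have E5: "real (n + 1) * (real (n\<^sup>2) * (\<Sum>t<n + u. G z1 t) ^ u) \<le> 2 * real (u + 3) ^ u / x"
  proof -
    have "(\<Sum>t<n + u. z1 ^ max (n - t) 1) = (\<Sum>t<n. z1 ^ max (n - t) 1) + (\<Sum>t=n..<n + u. z1 ^ max (n - t) 1)"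
      unfolding lessThan_atLeast0 by (rule sum.atLeastLessThan_concat[symmetric]) auto
    also have "(\<Sum>t=n..<n + u. z1 ^ max (n - t) 1) = u * z1" by simp
    finally have "(\<Sum>t<n + u. z1 ^ max (n - t) 1) \<le> 2 * z1 + u * z1" using geo[OF z1] by linarith
    moreover have "(\<Sum>t<n + u. G z1 t) = (x + u) * (exp (- y / 16) + z1 ^ D) + (\<Sum>t<n + u. z1 ^ max (n - t) 1)"
      unfolding G_def sum.distrib x_def by (simp add: algebra_simps)
    ultimately have "(\<Sum>t<n + u. G z1 t) \<le> real (u + 3) * z1" using half[OF z1] by (simp add: algebra_simps)
    hence "(\<Sum>t<n + u. G z1 t) ^ u \<le> (real (u + 3) * z1) ^ u" by (intro power_mono sum_nonneg G0)
    also have "\<dots> = real (u + 3) ^ u * x powr (- \<epsilon> / 64 * real u)"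
      using x0 powr_power[of x "- \<epsilon> / 64" u] by (simp add: power_mult_distrib z1_def mult.commute)
    also have "\<dots> \<le> real (u + 3) ^ u * x powr (- 4)"
    proof (intro mult_left_mono powr_mono)
      show "- \<epsilon> / 64 * real u \<le> - 4" using u by (simp add: mult.commute)
    qed (use x0 in auto)
    also have "x powr (- 4) = 1 / x ^ 4" using x0 powr_minus_divide[of x 4] by (simp add: powr_numeral)
    finally have a: "(\<Sum>t<n + u. G z1 t) ^ u \<le> real (u + 3) ^ u * (1 / x ^ 4)" .
    have "real (n + 1) * (real (n\<^sup>2) * (\<Sum>t<n + u. G z1 t) ^ u) \<le> (2 * x) * (x\<^sup>2 * (real (u + 3) ^ u * (1 / x ^ 4)))"
      by (intro mult_mono a mult_nonneg_nonneg zero_le_power sum_nonneg G0) (use n in \<open>auto simp: x_def\<close>)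
    also have "\<dots> = 2 * real (u + 3) ^ u / x" using x0 by (simp add: field_simps eval_nat_numeral)
    finally show ?thesis .
  qed
  \<comment> \<open>An even exponent near \<open>s\<close>, so that \<open>qmean_even_le\<close>
    applies directly. The square root in \<open>qmean_le_sqrt\<close> would leave a bound of order
    \<open>1 / sqrt p\<close> per column, too weak against \<open>p ^ n\<close> vectors.\<close>
  define h where "h = (s + 1) div 2"
  have h: "2 * h \<le> s + 1" "2 * h > 0" using s1 by (auto simp: h_def)
  have E4: "(\<Sum>p | prime p \<and> p \<le> P0. real p ^ n * qmean p \<xi> (2 * h) ^ (n + u)) \<le> 12 / 2 ^ u"
  proof -
    have ha: "x powr (\<epsilon> / 2) / 4 \<le> real h * \<alpha>"
    proof -
      have "s \<le> 2 * h" by (simp add: h_def)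
      hence "real s \<le> 2 * real h" by linarith
      hence "x powr (1 - \<epsilon> / 2) / 4 \<le> real h" using s_gt s1 by linarith
      hence "x powr (1 - \<epsilon> / 2) / 4 * x powr (- 1 + \<epsilon>) \<le> real h * \<alpha>" using \<alpha> by (intro mult_mono) auto
      moreover have "x powr (1 - \<epsilon> / 2) * x powr (- 1 + \<epsilon>) = x powr (\<epsilon> / 2)" by (rule powr_mult_eq) simp
      ultimately show ?thesis by simp
    qed
    have "real p ^ n * qmean p \<xi> (2 * h) ^ (n + u) \<le> 3 * (1 / real p ^ u)" if p: "prime p" "p \<le> P0" for p
    proof -
      have pp: "p > 0" using prime_gt_0_nat[OF p(1)] .
      have px: "real p \<le> x powr (\<epsilon> / 16)" using p(2) P_le by linarith
      have "x powr (\<epsilon> / 16) \<le> x powr 1" using x0 \<epsilon> by (intro powr_mono) auto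
      hence px1: "real p \<le> x" using px x0 by simp
      have "real p ^ 2 \<le> (x powr (\<epsilon> / 16)) ^ 2" using px by (intro power_mono) auto
      also have "\<dots> = x powr (\<epsilon> / 8)" by (rule powr_square_eq) simp
      finally have p2: "real p ^ 2 \<le> x powr (\<epsilon> / 8)" .
      have "x powr (3 * \<epsilon> / 8) * real p ^ 2 \<le> x powr (3 * \<epsilon> / 8) * x powr (\<epsilon> / 8)" using p2 by (intro mult_left_mono) auto
      also have "\<dots> = x powr (\<epsilon> / 2)" by (rule powr_mult_eq) simp
      also have "\<dots> \<le> 4 * (real h * \<alpha>)" using ha by linarith
      finally have "x powr (3 * \<epsilon> / 8) / 2 \<le> 2 * (real h * \<alpha>) / real p ^ 2" using pp by (simp add: field_simps)
      hence ex: "exp (- 2 * (real h * \<alpha>) / real p ^ 2) \<le> exp (- (x powr (3 * \<epsilon> / 8)) / 2)" by simp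
      have "real p * exp (- 2 * (real h * \<alpha>) / real p ^ 2) \<le> x * exp (- (x powr (3 * \<epsilon> / 8)) / 2)"
        using px1 ex x0 by (intro mult_mono) auto
      also have "\<dots> \<le> 1 / (x + u)" by (rule f5)
      finally have pe: "real p * exp (- 2 * (real h * \<alpha>) / real p ^ 2) \<le> 1 / (x + u)" .
      have "qmean p \<xi> (2 * h) \<le> Theta p (h * \<alpha>)" by (rule qmean_even_le[OF p(1) bal \<alpha>0])
      also have "\<dots> \<le> 1 / p + exp (- 2 * (real h * \<alpha>) / real p ^ 2)" using \<alpha>0 by (intro Theta_le_small pp) auto
      finally have "real p * qmean p \<xi> (2 * h) \<le> real p * (1 / p + exp (- 2 * (real h * \<alpha>) / real p ^ 2))"
        by (intro mult_left_mono) auto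
      also have "\<dots> \<le> 1 + 1 / (x + u)" using pe pp by (simp add: distrib_left)
      \<comment> \<open>The relative error per column is at most \<open>1 / (x + u)\<close>, so all
        \<open>n + u\<close> columns together lose at most a factor \<open>exp 1\<close>.\<close>
      also have "\<dots> \<le> exp (1 / (x + u))" by (rule exp_ge_add_one_self)
      finally have "(real p * qmean p \<xi> (2 * h)) ^ (n + u) \<le> exp (1 / (x + u)) ^ (n + u)"
        by (intro power_mono mult_nonneg_nonneg qmean_nonneg) auto
      also have "\<dots> = exp (real (n + u) * (1 / (x + u)))" by (rule exp_of_nat_mult[symmetric])
      also have "real (n + u) * (1 / (x + u)) = 1" using x0 by (simp add: x_def)
      also have "exp (1::real) \<le> 3" by (rule exp_le)
      finally have "(real p * qmean p \<xi> (2 * h)) ^ (n + u) \<le> 3" .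
      hence "real p ^ u * (real p ^ n * qmean p \<xi> (2 * h) ^ (n + u)) \<le> 3"
        by (simp add: power_mult_distrib power_add mult_ac)
      thus ?thesis using pp by (simp add: field_simps)
    qed
    hence "(\<Sum>p | prime p \<and> p \<le> P0. real p ^ n * qmean p \<xi> (2 * h) ^ (n + u)) \<le> (\<Sum>p | prime p \<and> p \<le> P0. 3 * (1 / real p ^ u))"
      by (intro sum_mono) auto
    also have "\<dots> = 3 * (\<Sum>p | prime p \<and> p \<le> P0. 1 / real p ^ u)" by (rule sum_distrib_left[symmetric])
    also have "\<dots> \<le> 3 * (4 / 2 ^ u)" by (intro mult_left_mono sum_primes_power_le u) auto
    finally show ?thesis by simp
  qed
  have "measure_pmf.prob (columns n (n + u) \<xi>) {X. \<exists>p. prime p \<and> lker p {..<n} X {..<n + u} \<noteq> {\<lambda>_. 0}} \<le>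
     x ^ 2 * real p0 * ?e + x ^ 6 * ?e + (2 * z0 + z1) + 12 / 2 ^ u + 2 * real (u + 3) ^ u / x"
    using R.prob_ker_nontrivial[of "G z1" "2 * h", OF g G0 h] E1 E2 E3 E4 E5 by linarith
  thus ?thesis by (simp add: y_def z1_def)
qed

theorem theorem1p4:
  fixes \<epsilon> T :: real
    and \<alpha> :: "nat \<Rightarrow> real"
    and \<xi> :: "nat \<Rightarrow> int pmf"
  assumes "0 < \<epsilon>" and "\<epsilon> < 1" and "0 < T"
    and "\<forall>\<^sub>F n in sequentially. balanced (\<alpha> n) (\<xi> n)"
    and "\<forall>\<^sub>F n in sequentially. \<alpha> n \<ge> real n powr (- 1 + \<epsilon>)"
    and "\<forall>\<^sub>F n in sequentially. \<forall>x\<in>set_pmf (\<xi> n). \<bar>real_of_int x\<bar> \<le> real n powr T"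
  shows "((\<lambda>(n, u). measure_pmf.prob (iid_mat n (n + u) (\<xi> n)) {M. trivial_group (cokernel M)})
           \<longlongrightarrow> 1) (filtercomap (\<lambda>(n, u). min u n) at_top)"
proof (subst tendsto_1_min_at_top_iff, goal_cases)
  case 2
  note \<epsilon> = assms(1,2) and T = assms(3)
  show ?case
  proof (intro allI impI)
    fix \<delta> :: real assume \<delta>: "\<delta> > 0"
    \<comment> \<open>\<open>\<delta>\<close> is shared by six terms.
      \<open>p0 \<ge> 288 / \<delta>\<^sup>2\<close> gives
      \<open>2 * sqrt (2 / p0) \<le> \<delta> / 6\<close>; the summand 8 provides
      \<open>p0 \<ge> 8\<close>.\<close>
    obtain m :: nat where m: "real m \<ge> 288 / \<delta>\<^sup>2 + 8" using real_arch_simple by blast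
    obtain p0 where p0: "prime p0" "m < p0" using bigger_prime by blast
    have mp: "real m < real p0" using p0(2) by simp
    have "0 \<le> 288 / \<delta>\<^sup>2" by simp
    hence "8 < real p0" using m mp by linarith
    hence p08: "8 \<le> p0" by simp
    have "288 / \<delta>\<^sup>2 \<le> real p0" using m mp by linarith
    hence "2 / real p0 \<le> (\<delta> / 12)\<^sup>2" using \<delta> p08 by (simp add: field_simps power2_eq_square)
    hence "sqrt (2 / real p0) \<le> \<delta> / 12" using \<delta> by (intro real_le_lsqrt) auto
    hence z0: "2 * sqrt (2 / real p0) \<le> \<delta> / 6" by simp
    \<comment> \<open>\<open>256 / \<epsilon>\<close> serves the large primes, and
      \<open>72 / \<delta> \<le> u0 \<le> 2 ^ u0\<close> makes the term of the small primes at most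
      \<open>\<delta> / 6\<close>.\<close>
    obtain u0 :: nat where u0: "real u0 \<ge> 2 + 256 / \<epsilon> + 72 / \<delta>" using real_arch_simple by blast
    have pos: "0 < 256 / \<epsilon>" "0 < 72 / \<delta>" using \<epsilon> \<delta> by auto
    have "2 \<le> real u0" using u0 pos by linarith
    hence u2: "2 \<le> u0" by simp
    have "256 / \<epsilon> \<le> real u0" using u0 pos by linarith
    hence u\<epsilon>: "real u0 * \<epsilon> \<ge> 256" using \<epsilon> by (simp add: field_simps)
    have "72 / \<delta> \<le> real u0" using u0 pos by linarith
    also have "real u0 \<le> 2 ^ u0" using of_nat_less_two_power[of u0, where ?'a = real] by linarith
    finally have u\<delta>: "12 / 2 ^ u0 \<le> \<delta> / 6" using \<delta> by (simp add: field_simps)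
    define c where "c = 2 * real (u0 + 3) ^ u0"
    have c0: "c > 0" by (simp add: c_def)
    have pp: "real p0 > 0" "1 / real p0 > 0" using p08 by auto
    have \<delta>6: "\<delta> / 6 > 0" using \<delta> by simp
    have ev1: "\<forall>\<^sub>F n in sequentially. 16 \<le> real n" by real_asymp
    have ev2: "\<forall>\<^sub>F n in sequentially. 16 \<le> real n powr (\<epsilon> / 2)" using \<epsilon>(1) by real_asymp
    have ev3: "\<forall>\<^sub>F n in sequentially. (1 + T) * ln (real n) \<le> real n * ln 2" using T by real_asymp
    have ev4: "\<forall>\<^sub>F n in sequentially. 4 * real n powr (- \<epsilon> / 16) + exp (- 2 * real n powr (\<epsilon> / 8)) \<le> real n powr (- \<epsilon> / 32)"
      using \<epsilon>(1) by real_asymp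
    have ev5: "\<forall>\<^sub>F n in sequentially. (real n + real u0) * (exp (- (real n powr (\<epsilon> / 2)) / 16) + 2 * (1 / 2) powr (real n powr (\<epsilon> / 8))) \<le> real n powr (- \<epsilon> / 64)"
      using \<epsilon>(1) by real_asymp
    have ev6: "\<forall>\<^sub>F n in sequentially. real n * exp (- (real n powr (3 * \<epsilon> / 8)) / 2) \<le> 1 / (real n + real u0)"
      using \<epsilon>(1) by real_asymp
    have ev7: "\<forall>\<^sub>F n in sequentially. exp (- 2 * real n powr (\<epsilon> / 4) / real p0 ^ 2) \<le> 1 / real p0"
      using \<epsilon>(1) pp by real_asymp
    have ev8: "\<forall>\<^sub>F n in sequentially. real n * real p0 * exp (- (real n powr (\<epsilon> / 2)) / 32) \<le> 1"
      using \<epsilon>(1) pp by real_asymp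
    have ev9: "\<forall>\<^sub>F n in sequentially. real n ^ 3 * exp (- (real n powr (\<epsilon> / 2)) / 32) \<le> 1"
      using \<epsilon>(1) by real_asymp
    have ev10: "\<forall>\<^sub>F n in sequentially. real n powr (- \<epsilon> / 64) \<le> 1 / 2" using \<epsilon>(1) by real_asymp
    have ev11: "\<forall>\<^sub>F n in sequentially. real n ^ 2 * real p0 * exp (- (real n powr (\<epsilon> / 2)) / 32) \<le> \<delta> / 6"
      using \<epsilon>(1) pp \<delta>6 by real_asymp
    have ev12: "\<forall>\<^sub>F n in sequentially. real n ^ 6 * exp (- (real n powr (\<epsilon> / 2)) / 32) \<le> \<delta> / 6"
      using \<epsilon>(1) \<delta>6 by real_asymp
    have ev13: "\<forall>\<^sub>F n in sequentially. real n powr (- \<epsilon> / 64) \<le> \<delta> / 6" using \<epsilon>(1) \<delta>6 by real_asymp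
    have ev14: "\<forall>\<^sub>F n in sequentially. c / real n \<le> \<delta> / 6" using c0 \<delta>6 by real_asymp
    have "\<forall>\<^sub>F n in sequentially. 1 - measure_pmf.prob (columns n (n + u0) (\<xi> n))
        {X. \<exists>p. prime p \<and> lker p {..<n} X {..<n + u0} \<noteq> {\<lambda>_. 0}} \<ge> 1 - \<delta>"
      using assms(4,5,6) ev1 ev2 ev3 ev4 ev5 ev6 ev7 ev8 ev9 ev10 ev11 ev12 ev13 ev14
    proof eventually_elim
      case (elim n)
      have "\<And>y. y \<in> set_pmf (\<xi> n) \<Longrightarrow> \<bar>real_of_int y\<bar> \<le> real n powr T" using elim(3) by blast
      from prob_nontrivial_le[OF \<epsilon> T elim(1,2) this p0(1) p08 u2 u\<epsilon> elim(4-13)]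
      show ?case using z0 u\<delta> elim(14-17) unfolding c_def by linarith
    qed
    then obtain N where N: "\<And>n. n \<ge> N \<Longrightarrow> 1 - measure_pmf.prob (columns n (n + u0) (\<xi> n))
        {X. \<exists>p. prime p \<and> lker p {..<n} X {..<n + u0} \<noteq> {\<lambda>_. 0}} \<ge> 1 - \<delta>"
      by (auto simp: eventually_sequentially)
    show "\<exists>N. \<forall>n\<ge>N. \<forall>u\<ge>N. 1 - \<delta> \<le> measure_pmf.prob (iid_mat n (n + u) (\<xi> n)) {M. trivial_group (cokernel M)}"
    \<comment> \<open>The limit in \<open>n\<close> was taken for exactly \<open>u0\<close> extra
      columns; \<open>prob_iid_mat_trivial\<close> passes to every \<open>u\<close> from
      \<open>u0\<close> on.\<close>
    proof (intro exI[of _ "max N u0"] allI impI)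
      fix n u assume "max N u0 \<le> n" "max N u0 \<le> u"
      hence "N \<le> n" "n + u0 \<le> n + u" by auto
      thus "1 - \<delta> \<le> measure_pmf.prob (iid_mat n (n + u) (\<xi> n)) {M. trivial_group (cokernel M)}"
        using N[of n] prob_iid_mat_trivial[of "n + u0" "n + u" n "\<xi> n"] by linarith
    qed
  qed
qed simp

end
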